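(* For each $0<s\leq 1$ there exist a rapidly increasing sequence $\{q_i\}_{i\geq1}$ of real numbers $q_i>1$ and a nonzero finite Borel measure $\mu$ supported on $$\bigcap_i\ \bigcup_{1\leq H\leq q_i^{s/2}}\mathcal{N}_{q_i^{-1}}\left(\frac{\mathbb{Z}}{H}\right)\cap\left[-\tfrac12,\tfrac12\right]$$ (the union being over integers $H$) with positive Fourier coefficients, i.e. $\widehat{\mu}(k)>0$ for all $k\in\mathbb{Z}$, such that $\dim_{\mathcal H}(\operatorname{supp}\mu)=s$; for every $\epsilon>0$ there is $C_\epsilon$ with $|\widehat{\mu}(\xi)|\leq C_\epsilon|\xi|^{-s/2+\epsilon}$ for all $|\xi|\geq 1$; and $\mu$ does not admit any Fourier frame.
   Context: $\mathcal{N}_\delta(S)$ denotes the $\delta$-neighborhood of $S\subset\mathbb{R}$, and $\frac{\mathbb{Z}}{H}=\{m/H:m\in\mathbb{Z}\}$. "Rapidly increasing" can be taken to mean $q_{i+1}\geq q_i^{10i}$ for all $i$. $\dim_{\mathcal H}$ is Hausdorff dimension and $\widehat{\mu}(\xi)=\int e^{-2\pi i x\xi}\,d\mu(x)$; for $f\in L^2(\mu)$, $\widehat{f\,d\mu}(\xi)=\int e^{-2\pi i x\xi}f(x)\,d\mu(x)$. A discrete set $\Lambda\subset\mathbb{R}$ is a frame spectrum of $\mu$ if there exist constants $0<A\leq B<\infty$ with $$A\|f\|_{L^2(\mu)}^2\leq\sum_{\lambda\in\Lambda}|\widehat{f\,d\mu}(\lambda)|^2\leq B\|f\|_{L^2(\mu)}^2\quad\forall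 f\in L^2(\mu).$$ If such a $\Lambda$ exists, $\mu$ is said to admit a Fourier frame. *)

theory Defs
  imports "HOL-Probability.Probability"
begin

subsection \<open>Hausdorff dimension\<close>

text \<open>
  The \<open>t\<close>-th power of the diameter, with the usual conventions \<open>diam({}) ^ t = 0\<close> and
  \<open>diam(U) ^ 0 = 1\<close> for nonempty \<open>U\<close> (whereas \<open>0 powr 0 = 0\<close>).  It is only used for bounded
  sets, since \<open>diameter\<close> carries no information on unbounded ones.
\<close>
definition diameter_powr :: "'a::metric_space set \<Rightarrow> real \<Rightarrow> ennreal" where
  "diameter_powr U t =
     (if U = {} then 0 else if t = 0 then 1 else ennreal (diameter U powr t))"

definition hausdorff_premeasure :: "real \<Rightarrow> real \<Rightarrow> 'a::metric_space set \<Rightarrow> ennreal" where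
  "hausdorff_premeasure t \<delta> S =
     (INF U \<in> {U :: nat \<Rightarrow> 'a set.
                 S \<subseteq> (\<Union>k. U k) \<and> (\<forall>k. bounded (U k) \<and> diameter (U k) \<le> \<delta>)}.
        \<Sum>k. diameter_powr (U k) t)"

definition hausdorff_measure :: "real \<Rightarrow> 'a::metric_space set \<Rightarrow> ennreal" where
  "hausdorff_measure t S = (SUP \<delta> \<in> {0<..}. hausdorff_premeasure t \<delta> S)"

definition hausdorff_dim :: "'a::metric_space set \<Rightarrow> ennreal" where
  "hausdorff_dim S = Inf (ennreal ` {t. 0 \<le> t \<and> hausdorff_measure t S = 0})"

subsection \<open>Support of a measure, Fourier transforms and Fourier frames\<close>

definition measure_support :: "'a::topological_space measure \<Rightarrow> 'a set" where
  "measure_support M = {x. \<forall>U. open U \<and> x \<in> U \<longrightarrow> emeasure M U > 0}"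

definition fourier_measure :: "real measure \<Rightarrow> real \<Rightarrow> complex" where
  "fourier_measure M \<xi> = (LINT x|M. exp (- 2 * pi * \<i> * of_real (x * \<xi>)))"

definition fourier_density :: "real measure \<Rightarrow> (real \<Rightarrow> complex) \<Rightarrow> real \<Rightarrow> complex" where
  "fourier_density M f \<xi> = (LINT x|M. exp (- 2 * pi * \<i> * of_real (x * \<xi>)) * f x)"

definition square_integrable :: "'a measure \<Rightarrow> ('a \<Rightarrow> complex) \<Rightarrow> bool" where
  "square_integrable M f \<longleftrightarrow>
     f \<in> borel_measurable M \<and> integrable M (\<lambda>x. (norm (f x))\<^sup>2)"

text \<open>
  Summability is required separately, as a divergent \<open>infsum\<close> of reals is \<open>0\<close>.
\<close>
definition frame_spectrum :: "real measure \<Rightarrow> real set \<Rightarrow> bool" where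
  "frame_spectrum M \<Lambda> \<longleftrightarrow>
     topological_space_class.discrete \<Lambda> \<and>
     (\<exists>A B :: real. 0 < A \<and> A \<le> B \<and>
       (\<forall>f. square_integrable M f \<longrightarrow>
          (\<lambda>l. (norm (fourier_density M f l))\<^sup>2) summable_on \<Lambda> \<and>
          A * (LINT x|M. (norm (f x))\<^sup>2) \<le> (\<Sum>\<^sub>\<infinity>l\<in>\<Lambda>. (norm (fourier_density M f l))\<^sup>2) \<and>
          (\<Sum>\<^sub>\<infinity>l\<in>\<Lambda>. (norm (fourier_density M f l))\<^sup>2) \<le> B * (LINT x|M. (norm (f x))\<^sup>2)))"

definition admits_fourier_frame :: "real measure \<Rightarrow> bool" where
  "admits_fourier_frame M \<longleftrightarrow> (\<exists>\<Lambda>. frame_spectrum M \<Lambda>)"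

subsection \<open>Neighborhoods of rationals with bounded denominator\<close>

definition nbhd :: "real \<Rightarrow> real set \<Rightarrow> real set" where
  "nbhd \<delta> S = (\<Union>y\<in>S. ball y \<delta>)"

definition int_over :: "nat \<Rightarrow> real set" where
  "int_over H = {real_of_int m / real H | m. True}"

text \<open>Sequences are indexed from \<open>1\<close>; the value \<open>q 0\<close> is irrelevant throughout.\<close>
definition rapidly_increasing :: "(nat \<Rightarrow> real) \<Rightarrow> bool" where
  "rapidly_increasing q \<longleftrightarrow> (\<forall>i\<ge>1. q (Suc i) \<ge> q i ^ (10 * i))"

definition well_approx_set :: "real \<Rightarrow> (nat \<Rightarrow> real) \<Rightarrow> real set" where
  "well_approx_set s q =
     (\<Inter>i\<in>{1..}. \<Union>H\<in>{H::nat. 1 \<le> H \<and> real H \<le> q i powr (s / 2)}.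
        nbhd (1 / q i) (int_over H) \<inter> {-1/2..1/2})"

end

theory Submission
  imports Defs "HOL-Computational_Algebra.Primes"
begin

text \<open>
  Kaufman's construction: multiply a fixed bump successively by combs \<open>F\<^sub>i\<close>, each an average over
  about \<open>q\<^sub>i powr (s/2)\<close> denominators \<open>H\<close> of \<open>1/H\<close>-periodic triangles of width \<open>1/(4 q\<^sub>i)\<close>.  The Fourier
  coefficients of \<open>F\<^sub>i\<close> are nonnegative, so every transform increases from stage to stage, and by the
  divisor bound they are \<open>O(l powr (-s/2 + \<epsilon>))\<close> with a small constant.  The normalised products
  converge weakly to a measure \<open>\<nu>\<close> carried by a compact set \<open>E\<close>.

  To destroy all frames, \<open>\<nu>\<close> is convolved with a symmetric discrete measure \<open>\<rho>\<close> on the shifts \<open>0\<close> and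
  \<open>\<plusminus>1/D\<^sub>k\<close>, where \<open>1/D\<^sub>k\<close> is negligible at the stages before \<open>k\<close> and \<open>D\<^sub>k\<close> is absorbed into the
  denominators from stage \<open>k\<close> on.  The translates of \<open>E\<close> are disjoint, and a lower frame
  bound tested on the indicator of \<open>E + x\<close> reads \<open>A \<le> \<rho>{x} \<Sum>\<^sub>l |\<nu>(l)|\<^sup>2\<close> (transform of \<open>\<nu>\<close>), which
  fails since \<open>\<rho>{x}\<close> takes arbitrarily small values.

  The dimension is bounded above by the obvious cover and below by finiteness of the \<open>t\<close>-energy,
  computed on the Fourier side for \<open>t < s\<close>.
\<close>

section \<open>Cosine series of the triangle wave\<close>

text \<open>\<open>D\<close> has to grow with the earlier scales without being felt by the decay
  exponent. At each stage \<open>D\<close> is therefore fixed before \<open>n\<close>, so powers of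
  \<open>D\<close> count as constants, and they are beaten by a factor
  \<open>n powr (-\<epsilon>/2)\<close>: a comb has no nonzero frequency up to \<open>D * n\<close>,
  so the decay left over at frequency \<open>l\<close> is a gain in \<open>n\<close>. The size
  \<open>q powr (s/2) = 2 * D^2 * n\<close> has two sources: denominators are of order
  \<open>D * n\<close>, and a shift \<open>b/D\<close> turns \<open>a/H\<close> into a fraction with
  denominator \<open>H * D\<close>. Stage \<open>i\<close> may lose \<open>s / (2 * (i + 1))\<close>
  in the exponent, with weight \<open>(1/2) ^ Suc i\<close>. Any given \<epsilon> > 0 exceeds all
  but finitely many losses, and the bump reached after those few stages still decays quadratically,
  with some constant. Positivity at the integers is put into the first bump, a tent of irrational
  width, and survives because transforms only increase; \<open>\<rho>\<close> preserves it because
  its atom at 0 has more than half of the mass.\<close>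

lemma integral_cos_int:
  fixes m :: int
  shows "integral {0..pi} (\<lambda>x. cos (of_int m * x)) = (if m = 0 then pi else 0)"
proof (cases "m = 0")
  case False
  have "((\<lambda>x. cos (of_int m * x)) has_integral
      (sin (of_int m * pi) / of_int m - sin (of_int m * 0) / of_int m)) {0..pi}"
    using False
    by (intro fundamental_theorem_of_calculus)
       (auto simp flip: has_real_derivative_iff_has_vector_derivative intro!: derivative_eq_intros)
  moreover have "sin (of_int m * pi) = 0"
    by (simp add: sin_zero_iff_int2)
  ultimately show ?thesis using False by (simp add: integral_unique)
qed auto

lemma integral_cos_cos:
  fixes k l :: nat
  shows "integral {0..pi} (\<lambda>x. cos (real k * x) * cos (real l * x)) =
    (if k = l then if l = 0 then pi else pi / 2 else 0)"
proof -
  have int: "(\<lambda>x. cos (of_int m * x)) integrable_on {0..pi}" for m :: int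
    by (intro integrable_continuous_real continuous_intros)
  have eq: "(\<lambda>x. cos (real k * x) * cos (real l * x)) =
      (\<lambda>x. (1/2) * (cos (of_int (int k - int l) * x) + cos (of_int (int k + int l) * x)))"
    by (auto simp: cos_times_cos algebra_simps)
  have "integral {0..pi} (\<lambda>x. cos (real k * x) * cos (real l * x)) = (1/2) * (integral {0..pi} (\<lambda>x. cos (of_int (int k - int l) * x))
      + integral {0..pi} (\<lambda>x. cos (of_int (int k + int l) * x)))"
    unfolding eq integral_mult_right by (subst integral_add) (use int in \<open>simp_all only: int\<close>)
  then show ?thesis
    unfolding integral_cos_int by auto
qed

text \<open>Product formulas turn \<open>cos x ^ m\<close> into a combination of cosines of integer
  multiples of \<open>x\<close>, so \<open>h\<close> is orthogonal to every polynomial in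
  \<open>cos x\<close>. Weierstrass approximation of \<open>h (arccos t)\<close> by polynomials then
  makes \<open>h\<close> orthogonal to itself.\<close>

lemma cosine_moments_zero:
  fixes h :: "real \<Rightarrow> real"
  assumes cont: "continuous_on {0..pi} h"
    and zero: "\<And>l::nat. integral {0..pi} (\<lambda>x. h x * cos (real l * x)) = 0"
    and x: "x \<in> {0..pi}"
  shows "h x = 0"
proof -
  have intg: "f integrable_on {0..pi}" if "continuous_on {0..pi} f" for f :: "real \<Rightarrow> real"
    using that by (rule integrable_continuous_real)
  \<comment> \<open>Integer frequencies keep the induction closed: the product formula produces
    \<open>1 - l\<close>, which may be negative.\<close>
  have moments: "integral {0..pi} (\<lambda>x. h x * cos x ^ m * cos (of_int l * x)) = 0" for m and l :: int
  proof (induction m arbitrary: l)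
    case 0
    have "cos (of_int l * x) = cos (real (nat \<bar>l\<bar>) * x)" for x
      by (cases "l \<ge> 0") auto
    then show ?case using zero[of "nat \<bar>l\<bar>"] by (simp del: of_nat_nat)
  next
    case (Suc m)
    have eq: "(\<lambda>x. h x * cos x ^ Suc m * cos (of_int l * x)) =
        (\<lambda>x. (1/2) * (h x * cos x ^ m * cos (of_int (1 - l) * x)
             + h x * cos x ^ m * cos (of_int (1 + l) * x)))"
    proof
      fix x :: real
      have "cos x * cos (of_int l * x) = (1/2) * (cos (of_int (1 - l) * x) + cos (of_int (1 + l) * x))"
        using cos_times_cos[of x "of_int l * x"] by (simp add: ring_distribs)
      then have "h x * cos x ^ m * (cos x * cos (of_int l * x)) =
          h x * cos x ^ m * ((1/2) * (cos (of_int (1 - l) * x) + cos (of_int (1 + l) * x)))"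
        by (rule arg_cong)
      then show "h x * cos x ^ Suc m * cos (of_int l * x) = (1/2) * (h x * cos x ^ m * cos (of_int (1 - l) * x)
             + h x * cos x ^ m * cos (of_int (1 + l) * x))"
        by (simp only: power_Suc ring_distribs mult_ac)
    qed
    have "integral {0..pi} (\<lambda>x. h x * cos x ^ Suc m * cos (of_int l * x)) = (1/2) * (integral {0..pi} (\<lambda>x. h x * cos x ^ m * cos (of_int (1 - l) * x))
             + integral {0..pi} (\<lambda>x. h x * cos x ^ m * cos (of_int (1 + l) * x)))"
      unfolding eq integral_mult_right
      by (subst integral_add) (auto intro!: intg continuous_intros cont)
    then show ?case by (simp only: Suc add_0 mult_zero_right)
  qed
  have poly: "integral {0..pi} (\<lambda>x. h x * p (cos x)) = 0" if "real_polynomial_function p" for p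
  proof -
    obtain a n where p: "p = (\<lambda>x. \<Sum>i\<le>n. a i * x ^ i)"
      using \<open>real_polynomial_function p\<close> by (auto simp: real_polynomial_function_iff_sum)
    have eq: "(\<lambda>x. h x * p (cos x)) = (\<lambda>x. \<Sum>i\<le>n. a i * (h x * cos x ^ i * cos (of_int 0 * x)))"
      by (auto simp: p sum_distrib_left mult_ac)
    have "integral {0..pi} (\<lambda>x. h x * p (cos x)) = (\<Sum>i\<le>n. integral {0..pi} (\<lambda>x. a i * (h x * cos x ^ i * cos (of_int 0 * x))))"
      unfolding eq by (intro integral_sum intg) (auto intro!: continuous_intros cont)
    also have "\<dots> = 0" unfolding integral_mult_right moments by simp
    finally show ?thesis .
  qed
  have sq_le: "integral {0..pi} (\<lambda>x. (h x)\<^sup>2) \<le> e * integral {0..pi} (\<lambda>x. \<bar>h x\<bar>)" if e: "e > 0" for e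
  proof -
    have arc: "continuous_on {-1..1} (\<lambda>t. h (arccos t))"
      by (rule continuous_on_compose2[OF cont]) (auto intro!: continuous_intros arccos_lbound arccos_ubound)
    obtain p where p: "real_polynomial_function p"
        "\<And>t. t \<in> {-1..1} \<Longrightarrow> \<bar>h (arccos t) - p t\<bar> < e"
      using Stone_Weierstrass_real_polynomial_function[OF compact_Icc arc e] by blast
    have pc: "continuous_on {0..pi} (\<lambda>x. p (cos x))"
      using p(1) by (intro continuous_on_compose2[OF continuous_on_polymonial_function[of p UNIV]])
        (auto simp: real_polynomial_function_eq intro!: continuous_intros)
    have "integral {0..pi} (\<lambda>x. (h x)\<^sup>2) = integral {0..pi} (\<lambda>x. (h x)\<^sup>2) - integral {0..pi} (\<lambda>x. h x * p (cos x))"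
      using poly[OF p(1)] by simp
    also have "\<dots> = integral {0..pi} (\<lambda>x. (h x)\<^sup>2 - h x * p (cos x))"
      by (intro integral_diff[symmetric] intg continuous_intros cont pc)
    also have "\<dots> \<le> integral {0..pi} (\<lambda>x. e * \<bar>h x\<bar>)"
    proof (intro integral_le intg continuous_intros cont pc)
      fix x assume "x \<in> {0..pi}"
      then have "\<bar>h x - p (cos x)\<bar> < e"
        using p(2)[of "cos x"] by (simp add: arccos_cos)
      then have "\<bar>h x\<bar> * \<bar>h x - p (cos x)\<bar> \<le> \<bar>h x\<bar> * e"
        by (intro mult_left_mono) auto
      then show "(h x)\<^sup>2 - h x * p (cos x) \<le> e * \<bar>h x\<bar>"
        unfolding abs_mult[symmetric] by (simp add: algebra_simps power2_eq_square)
    qed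
    also have "\<dots> = e * integral {0..pi} (\<lambda>x. \<bar>h x\<bar>)" by simp
    finally show ?thesis .
  qed
  define I where "I = integral {0..pi} (\<lambda>x. \<bar>h x\<bar>)"
  have I0: "I \<ge> 0" unfolding I_def by (intro integral_nonneg intg continuous_intros cont) auto
  have "integral {0..pi} (\<lambda>x. (h x)\<^sup>2) \<le> 0 + e" if "e > 0" for e
  proof -
    have "integral {0..pi} (\<lambda>x. (h x)\<^sup>2) \<le> e / (I + 1) * I"
      using sq_le[of "e / (I + 1)"] that I0 by (simp add: I_def)
    also have "\<dots> \<le> e" using that I0 by (simp add: field_simps)
    finally show ?thesis by simp
  qed
  then have "integral {0..pi} (\<lambda>x. (h x)\<^sup>2) \<le> 0" by (rule field_le_epsilon)
  moreover have "integral {0..pi} (\<lambda>x. (h x)\<^sup>2) \<ge> 0"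
    by (intro integral_nonneg intg continuous_intros cont) auto
  ultimately have "integral {0..pi} (\<lambda>x. (h x)\<^sup>2) = 0" by simp
  then have "\<forall>x\<in>{0..pi}. (h x)\<^sup>2 = 0"
    by (subst (asm) integral_eq_0_iff) (auto intro!: continuous_intros cont)
  then show ?thesis using x by simp
qed

text \<open>Absolute summability makes the series converge uniformly, so its sum is continuous and
  has the same cosine moments as \<open>h\<close>; the difference vanishes by
  \<open>cosine_moments_zero\<close>.\<close>

lemma cosine_series_sums:
  fixes h :: "real \<Rightarrow> real" and c :: "nat \<Rightarrow> real"
  assumes cont: "continuous_on {0..pi} h"
    and c: "summable (\<lambda>l. \<bar>c l\<bar>)"
    and coeff: "\<And>l. integral {0..pi} (\<lambda>x. h x * cos (real l * x)) = (if l = 0 then pi else pi / 2) * c l"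
    and x: "x \<in> {0..pi}"
  shows "(\<lambda>l. c l * cos (real l * x)) sums h x"
proof -
  define g where "g x = (\<Sum>l. c l * cos (real l * x))" for x
  have lim: "uniform_limit UNIV (\<lambda>n x. \<Sum>l<n. c l * cos (real l * x)) g sequentially"
    unfolding g_def
    by (rule Weierstrass_m_test[OF _ c]) (auto simp: abs_mult intro!: mult_left_le abs_cos_le_one)
  have gc: "continuous_on {0..pi} g"
    by (rule uniform_limit_theorem[OF _ uniform_limit_on_subset[OF lim]])
       (auto intro!: always_eventually continuous_intros)
  have "h x - g x = 0"
  proof (rule cosine_moments_zero[of "\<lambda>x. h x - g x", OF _ _ x])
    show "continuous_on {0..pi} (\<lambda>x. h x - g x)" by (intro continuous_intros cont gc)
  next
    fix k :: nat
    let ?S = "\<lambda>n x. (\<Sum>l<n. c l * cos (real l * x)) * cos (real k * x)"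
    have ul: "uniform_limit {0..pi} ?S (\<lambda>x. g x * cos (real k * x)) sequentially"
      using compact_imp_bounded[OF compact_continuous_image[OF gc]]
      by (intro uniform_lim_mult uniform_limit_on_subset[OF lim] uniform_limit_const)
        (auto intro: boundedI[where B = 1])
    have Sc: "continuous_on {0..pi} (?S n)" for n by (intro continuous_intros)
    obtain I J where IJ: "\<And>n. (?S n has_integral I n) {0..pi}"
      "((\<lambda>x. g x * cos (real k * x)) has_integral J) {0..pi}" "I \<longlonglongrightarrow> J"
      using uniform_limit_integral[OF ul Sc] by auto
    \<comment> \<open>By orthogonality the moment of a partial sum is constant once
      \<open>n > k\<close>.\<close>
    have In: "I n = (if k = 0 then pi else pi / 2) * c k" if "n > k" for n
    proof -
      have "I n = integral {0..pi} (?S n)" using IJ(1)[of n] by (rule integral_unique[symmetric])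
      also have "?S n = (\<lambda>x. \<Sum>l<n. c l * (cos (real l * x) * cos (real k * x)))"
        by (simp only: sum_distrib_right mult.assoc)
      also have "integral {0..pi} \<dots> = (\<Sum>l<n. integral {0..pi} (\<lambda>x. c l * (cos (real l * x) * cos (real k * x))))"
        by (intro integral_sum integrable_continuous_real continuous_intros) auto
      also have "\<dots> = (\<Sum>l<n. if l = k then (if k = 0 then pi else pi / 2) * c k else 0)"
        unfolding integral_mult_right integral_cos_cos by (intro sum.cong) auto
      also have "\<dots> = (if k = 0 then pi else pi / 2) * c k" using that by simp
      finally show ?thesis .
    qed
    have "I \<longlonglongrightarrow> (if k = 0 then pi else pi / 2) * c k"
      by (rule tendsto_eventually, rule eventually_mono[OF eventually_gt_at_top[of k] In])
    then have "J = (if k = 0 then pi else pi / 2) * c k" using IJ(3) LIMSEQ_unique by blast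
    then have "integral {0..pi} (\<lambda>x. g x * cos (real k * x)) = (if k = 0 then pi else pi / 2) * c k"
      using IJ(2) by (simp add: integral_unique)
    moreover have "(\<lambda>x. (h x - g x) * cos (real k * x)) = (\<lambda>x. h x * cos (real k * x) - g x * cos (real k * x))"
      by (auto simp: algebra_simps)
    moreover have "integral {0..pi} (\<lambda>x. h x * cos (real k * x) - g x * cos (real k * x))
       = integral {0..pi} (\<lambda>x. h x * cos (real k * x)) - integral {0..pi} (\<lambda>x. g x * cos (real k * x))"
      by (intro integral_diff integrable_continuous_real continuous_intros cont gc)
    ultimately show "integral {0..pi} (\<lambda>x. (h x - g x) * cos (real k * x)) = 0"
      using coeff[of k] by simp
  qed
  moreover have "summable (\<lambda>l. c l * cos (real l * x))"
    by (rule summable_comparison_test'[OF c, of 0]) (auto simp: abs_mult intro!: mult_left_le abs_cos_le_one)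
  ultimately show ?thesis unfolding g_def by (simp add: summable_sums)
qed

section \<open>The periodic tent and its nonnegative cosine coefficients\<close>

definition sinc_sq :: "real \<Rightarrow> real" where
  "sinc_sq u = (sinc u)\<^sup>2"

lemma sinc_sq_0 [simp]: "sinc_sq 0 = 1"
  by (simp add: sinc_sq_def)

lemma sinc_sq_nonneg [simp]: "0 \<le> sinc_sq u"
  by (simp add: sinc_sq_def)

lemma sinc_sq_le_1: "sinc_sq u \<le> 1"
  using abs_sin_x_le_abs_x[of u] by (auto simp: sinc_sq_def power_divide abs_le_square_iff)

lemma sinc_sq_le_inverse_square: "sinc_sq u \<le> 1 / u\<^sup>2" if "u \<noteq> 0"
  using that abs_sin_le_one[of u]
  by (auto simp: sinc_sq_def power_divide abs_le_square_iff divide_right_mono abs_square_le_1)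

text \<open>Half of the transform of a tent of mass one. Its nonnegativity, the source of all
  monotonicity below, comes from writing \<open>1 - cos v\<close> as twice the square of
  \<open>sin (v / 2)\<close>.\<close>

lemma has_integral_triangle_cos:
  fixes a w :: real
  assumes a: "a > 0"
  shows "((\<lambda>x. (1 - x / a) / a * cos (w * x)) has_integral sinc_sq (a * w / 2) / 2) {0..a}"
proof (cases "w = 0")
  case True
  have "((\<lambda>x. (1 - x / a) / a) has_integral (a / a - a\<^sup>2 / (2 * a\<^sup>2)) - (0 / a - 0\<^sup>2 / (2 * a\<^sup>2))) {0..a}"
    using a
    by (intro fundamental_theorem_of_calculus[where f = "\<lambda>x. x / a - x\<^sup>2 / (2 * a\<^sup>2)"])
       (auto simp flip: has_real_derivative_iff_has_vector_derivative intro!: derivative_eq_intros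
         simp: field_simps power2_eq_square)
  then show ?thesis using a True by simp
next
  case False
  \<comment> \<open>The antiderivative found by one integration by parts.\<close>
  define G where "G x = (1 - x / a) / a * (sin (w * x) / w) - cos (w * x) / (a\<^sup>2 * w\<^sup>2)" for x
  have "((\<lambda>x. (1 - x / a) / a * cos (w * x)) has_integral (G a - G 0)) {0..a}"
    using a False unfolding G_def
    by (intro fundamental_theorem_of_calculus)
       (auto simp flip: has_real_derivative_iff_has_vector_derivative intro!: derivative_eq_intros
         simp: field_simps power2_eq_square)
  moreover have "G a - G 0 = (1 - cos (w * a)) / (a\<^sup>2 * w\<^sup>2)"
    using a False by (simp add: G_def diff_divide_distrib)
  moreover have "1 - cos (w * a) = 2 * (sin (a * w / 2))\<^sup>2"
    using cos_double_sin[of "a * w / 2"] by (simp add: mult_ac)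
  ultimately show ?thesis
    using a False by (simp add: sinc_sq_def power_divide power_mult_distrib)
qed

text \<open>For \<open>0 < \<eta> \<le> 1/2\<close> this is the 1-periodisation of the tent of
  half-width \<open>\<eta>\<close> and mass one, so its mean is 1.\<close>

definition triangle_wave :: "real \<Rightarrow> real \<Rightarrow> real" where
  "triangle_wave \<eta> x = max 0 (1 - infdist x \<int> / \<eta>) / \<eta>"

text \<open>The factor 2 for \<open>l > 0\<close> merges the frequencies \<open>l\<close> and
  \<open>-l\<close> of the Fourier series into one cosine.\<close>

definition fejer_coeff :: "real \<Rightarrow> nat \<Rightarrow> real" where
  "fejer_coeff \<eta> l = (if l = 0 then 1 else 2 * sinc_sq (pi * \<eta> * real l))"

lemma infdist_Ints_le: "infdist (x::real) \<int> \<le> \<bar>x - of_int m\<bar>"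
  using infdist_le[of "of_int m" "\<int> :: real set" x] by (simp add: dist_real_def)

lemma infdist_Ints_attained: obtains m :: int where "infdist (x::real) \<int> = \<bar>x - of_int m\<bar>"
proof -
  have "closed (\<int> :: real set)" "(\<int> :: real set) \<noteq> {}" by auto
  then obtain y where "y \<in> \<int>" "infdist x \<int> = dist x y" by (rule infdist_attains_inf)
  then show ?thesis using that by (auto simp: dist_real_def elim!: Ints_cases)
qed

lemma infdist_Ints_minus: "infdist (- x) \<int> = infdist (x::real) \<int>"
proof -
  have le: "infdist (- y) \<int> \<le> infdist (y::real) \<int>" for y
  proof -
    obtain m where "infdist y \<int> = \<bar>y - of_int m\<bar>" by (rule infdist_Ints_attained)
    then show ?thesis using infdist_Ints_le[of "- y" "- m"] by simp
  qed
  show ?thesis using le[of x] le[of "- x"] by simp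
qed

lemma infdist_Ints_half:
  assumes "\<bar>x\<bar> \<le> 1/2" shows "infdist (x::real) \<int> = \<bar>x\<bar>"
proof (rule antisym)
  show "infdist x \<int> \<le> \<bar>x\<bar>" using infdist_Ints_le[of x 0] by simp
  obtain m where m: "infdist x \<int> = \<bar>x - of_int m\<bar>" by (rule infdist_Ints_attained)
  show "\<bar>x\<bar> \<le> infdist x \<int>"
  proof (cases "m = 0")
    case False
    then have "\<bar>of_int m :: real\<bar> \<ge> 1" by linarith
    then show ?thesis using assms m by linarith
  qed (use m in simp)
qed

lemma continuous_on_triangle_wave [continuous_intros]:
  "continuous_on A f \<Longrightarrow> continuous_on A (\<lambda>x. triangle_wave \<eta> (f x))"
  unfolding triangle_wave_def divide_inverse by (intro continuous_intros)

lemma triangle_wave_nonneg: "\<eta> \<ge> 0 \<Longrightarrow> 0 \<le> triangle_wave \<eta> x"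
  by (simp add: triangle_wave_def)

lemma fejer_coeff_nonneg: "0 \<le> fejer_coeff \<eta> l"
  by (simp add: fejer_coeff_def)

lemma fejer_coeff_le: 
  assumes "\<eta> > 0"
  shows "fejer_coeff \<eta> l \<le> 2" "l > 0 \<Longrightarrow> fejer_coeff \<eta> l \<le> 2 / (\<eta> * real l)\<^sup>2"
proof -
  show "fejer_coeff \<eta> l \<le> 2" using sinc_sq_le_1 by (simp add: fejer_coeff_def)
  assume l: "l > 0"
  have "sinc_sq (pi * \<eta> * real l) \<le> 1 / (pi * \<eta> * real l)\<^sup>2"
    using l assms by (intro sinc_sq_le_inverse_square) auto
  also have "\<dots> \<le> 1 / (1 * \<eta> * real l)\<^sup>2"
    using l assms pi_gt3 by (intro divide_left_mono power_mono mult_right_mono) auto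
  finally show "fejer_coeff \<eta> l \<le> 2 / (\<eta> * real l)\<^sup>2" using l by (simp add: fejer_coeff_def)
qed

lemma summable_fejer_coeff: "\<eta> > 0 \<Longrightarrow> summable (fejer_coeff \<eta>)"
proof (rule summable_comparison_test'[of "\<lambda>l. 2 / \<eta>\<^sup>2 * (1 / real l ^ 2)" 1])
  assume "\<eta> > 0"
  show "summable (\<lambda>l. 2 / \<eta>\<^sup>2 * (1 / real l ^ 2))"
    using inverse_power_summable[of 2, where 'a = real] by (intro summable_mult) (simp add: field_simps)
  fix n :: nat assume "n \<ge> 1"
  then show "norm (fejer_coeff \<eta> n) \<le> 2 / \<eta>\<^sup>2 * (1 / real n ^ 2)"
    using fejer_coeff_le(2)[OF \<open>\<eta> > 0\<close>, of n] fejer_coeff_nonneg[of \<eta> n]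
    by (simp add: power_mult_distrib)
qed

text \<open>After the substitution \<open>\<theta> = 2 * pi * x\<close> the wave on
  \<open>{0..pi}\<close> is a single half tent, whose moments are known. Both sides are even and
  1-periodic in \<open>x\<close>, which gives the remaining points.\<close>

lemma triangle_wave_sums:
  assumes \<eta>: "0 < \<eta>" "\<eta> \<le> 1/2"
  shows "(\<lambda>l. fejer_coeff \<eta> l * cos (2 * pi * (real l * x))) sums triangle_wave \<eta> x"
proof -
  define h where "h \<theta> = triangle_wave \<eta> (\<theta> / (2 * pi))" for \<theta>
  define b where "b = 2 * pi * \<eta>"
  have b: "0 < b" "b \<le> pi" using \<eta> by (auto simp: b_def)
  have hx: "h \<theta> = (if \<theta> \<le> b then 2 * pi * ((1 - \<theta> / b) / b) else 0)" if "\<theta> \<in> {0..pi}" for \<theta>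
  proof -
    have "infdist (\<theta> / (2 * pi)) \<int> / \<eta> = \<theta> / b"
      using that infdist_Ints_half[of "\<theta> / (2 * pi)"] by (auto simp: b_def)
    moreover have "\<theta> \<le> b \<longleftrightarrow> \<theta> / b \<le> 1" using b by simp
    ultimately show ?thesis by (auto simp: h_def triangle_wave_def b_def)
  qed
  have I: "integral {0..pi} (\<lambda>\<theta>. h \<theta> * cos (real l * \<theta>)) = (if l = 0 then pi else pi / 2) * fejer_coeff \<eta> l" for l
  proof -
    have "((\<lambda>\<theta>. 2 * pi * ((1 - \<theta> / b) / b * cos (real l * \<theta>))) has_integral 2 * pi * (sinc_sq (b * real l / 2) / 2)) {0..b}"
      by (intro has_integral_mult_right has_integral_triangle_cos b)
    then have "((\<lambda>\<theta>. if \<theta> \<in> {0..b} then 2 * pi * ((1 - \<theta> / b) / b * cos (real l * \<theta>)) else 0) has_integral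
        2 * pi * (sinc_sq (b * real l / 2) / 2)) {0..pi}"
      using b by (subst has_integral_restrict) auto
    then have "((\<lambda>\<theta>. h \<theta> * cos (real l * \<theta>)) has_integral 2 * pi * (sinc_sq (b * real l / 2) / 2)) {0..pi}"
      by (rule has_integral_eq[rotated]) (auto simp: hx)
    then show ?thesis by (simp add: integral_unique fejer_coeff_def b_def mult_ac)
  qed
  have "continuous_on {0..pi} h" unfolding h_def by (intro continuous_intros) auto
  then have *: "(\<lambda>l. fejer_coeff \<eta> l * cos (real l * \<theta>)) sums h \<theta>" if "\<theta> \<in> {0..pi}" for \<theta>
    using that summable_fejer_coeff[OF \<eta>(1)] I
    by (intro cosine_series_sums) (auto simp: fejer_coeff_nonneg)
  obtain m where m: "infdist x \<int> = \<bar>x - of_int m\<bar>" by (rule infdist_Ints_attained)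
  \<comment> \<open>The distance to a nearest integer is at most one half, so
    \<open>2 * pi * y\<close> lies in the interval already treated.\<close>
  define y where "y = \<bar>x - of_int m\<bar>"
  have "\<bar>x - of_int (round x)\<bar> \<le> 1/2" using of_int_round_abs_le[of x] by (simp add: abs_minus_commute)
  then have y: "0 \<le> y" "y \<le> 1/2" using infdist_Ints_le[of x "round x"] m by (auto simp: y_def)
  have "triangle_wave \<eta> x = h (2 * pi * y)"
    using y m infdist_Ints_half[of y] by (simp add: h_def triangle_wave_def y_def)
  moreover have "cos (2 * pi * (real l * x)) = cos (real l * (2 * pi * y))" for l
  proof -
    have "cos (2 * pi * (real l * x)) = cos (2 * pi * (real l * (x - of_int m)) + 2 * pi * of_int (int l * m))"
      by (simp add: algebra_simps)
    also have "\<dots> = cos (2 * pi * (real l * (x - of_int m)))"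
      unfolding cos_add by (simp only: sin_int_2pin cos_int_2pin)
    also have "\<dots> = cos \<bar>2 * pi * (real l * (x - of_int m))\<bar>" by (simp add: cos_abs_real)
    also have "\<bar>2 * pi * (real l * (x - of_int m))\<bar> = real l * (2 * pi * y)"
      by (simp add: y_def abs_mult)
    finally show ?thesis .
  qed
  moreover have "2 * pi * y \<in> {0..pi}" using y by auto
  ultimately show ?thesis using *[of "2 * pi * y"] by (simp only:)
qed

section \<open>The divisor bound\<close>

lemma card_divisors_prime_power_mult:
  fixes p m :: nat
  assumes "prime p" "m > 0"
  shows "card {d. d dvd p ^ a * m} \<le> (a + 1) * card {d. d dvd m}"
proof -
  have "{d. d dvd p ^ a * m} \<subseteq> (\<lambda>(i, e). p ^ i * e) ` ({..a} \<times> {d. d dvd m})"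
  proof
    fix d assume "d \<in> {d. d dvd p ^ a * m}"
    then obtain b c where "d = b * c" "b dvd p ^ a" "c dvd m"
      using division_decomp by blast
    moreover from this obtain i where "i \<le> a" "b = p ^ i"
      using divides_primepow_nat[OF \<open>prime p\<close>] by auto
    ultimately show "d \<in> (\<lambda>(i, e). p ^ i * e) ` ({..a} \<times> {d. d dvd m})" by force
  qed
  then have "card {d. d dvd p ^ a * m} \<le> card ({..a} \<times> {d. d dvd m})"
    by (rule surj_card_le[rotated]) (use \<open>m > 0\<close> in auto)
  then show ?thesis by (simp add: card_cartesian_product)
qed

text \<open>Prime powers \<open>p ^ a\<close> are split off one at a time, each multiplying the
  divisor count by at most \<open>a + 1\<close>. For \<open>p \<ge> P\<close> this is at most
  \<open>2 ^ a\<close>, which \<open>p powr (a * \<epsilon>)\<close> pays for; a small prime costs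
  one factor \<open>K\<close>, hence the exponent counting small prime divisors.\<close>

lemma divisor_bound_small_primes:
  fixes \<epsilon> K :: real and P :: nat
  assumes K: "K \<ge> 1" "\<And>a. real a + 1 \<le> K * 2 powr (real a * \<epsilon>)"
    and P: "real P powr \<epsilon> \<ge> 2" and \<epsilon>: "\<epsilon> > 0" and "n > 0"
  shows "real (card {d. d dvd n}) \<le> K ^ card {p. prime p \<and> p < P \<and> p dvd n} * real n powr \<epsilon>"
  using \<open>n > 0\<close>
proof (induction n rule: less_induct)
  case (less n)
  show ?case
  proof (cases "n = 1")
    case True
    then show ?thesis using one_le_power[OF K(1)] by simp
  next
    case False
    then obtain p where p: "prime p" "p dvd n" using prime_factor_nat by blast
    obtain a m where n: "n = p ^ a * m" and pm: "\<not> p dvd m"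
      using prime_power_canonical[OF p(1) less.prems] by (auto simp: mult.commute)
    have a: "a > 0" using p(2) pm n by (cases a) auto
    have m: "m > 0" using less.prems n by (cases m) auto
    have p2: "p \<ge> 2" using p(1) by (rule prime_ge_2_nat)
    have "1 < p ^ a" using p2 a by (intro one_less_power) auto
    then have "m < n" using m n by simp
    define A where "A = {q. prime q \<and> q < P \<and> q dvd m}"
    define B where "B = {q. prime q \<and> q < P \<and> q dvd n}"
    have fin: "finite A" "finite B" unfolding A_def B_def by auto
    have AB: "A \<subseteq> B" unfolding A_def B_def n by auto
    have IH: "real (card {d. d dvd m}) \<le> K ^ card A * real m powr \<epsilon>"
      using less.IH[OF \<open>m < n\<close> m] by (simp add: A_def)
    have "real n powr \<epsilon> = (real p powr real a) powr \<epsilon> * real m powr \<epsilon>"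
      using p2 by (simp add: n powr_mult powr_realpow)
    then have npow: "real n powr \<epsilon> = (real p powr \<epsilon>) powr real a * real m powr \<epsilon>"
      by (simp add: powr_powr mult.commute)
    have step: "(real a + 1) * K ^ card A \<le> K ^ card B * (real p powr \<epsilon>) powr real a"
    proof (cases "p < P")
      case True
      have "insert p A \<subseteq> B" using AB True p n by (auto simp: B_def)
      then have "card (insert p A) \<le> card B" using fin by (intro card_mono)
      moreover have "p \<notin> A" using pm by (auto simp: A_def)
      ultimately have cB: "Suc (card A) \<le> card B" using fin by simp
      have "2 powr (real a * \<epsilon>) \<le> real p powr (real a * \<epsilon>)"
        using p2 \<epsilon> by (intro powr_mono2) auto
      then have "2 powr (real a * \<epsilon>) \<le> (real p powr \<epsilon>) powr real a"
        by (simp add: powr_powr mult.commute)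
      then have "(real a + 1) * K ^ card A \<le> (K * (real p powr \<epsilon>) powr real a) * K ^ card A"
        using K by (intro mult_right_mono order.trans[OF K(2)] mult_left_mono) auto
      also have "\<dots> = K ^ Suc (card A) * (real p powr \<epsilon>) powr real a" by simp
      also have "\<dots> \<le> K ^ card B * (real p powr \<epsilon>) powr real a"
        using K cB by (intro mult_right_mono power_increasing) auto
      finally show ?thesis .
    next
      case False
      have "2 \<le> real p powr \<epsilon>"
        using P False \<epsilon> by (intro order.trans[OF P] powr_mono2) auto
      then have "2 powr real a \<le> (real p powr \<epsilon>) powr real a" by (intro powr_mono2) auto
      moreover have "real a + 1 \<le> 2 ^ a"
      proof (induction a)
        case (Suc a)
        have "1 \<le> (2::real) ^ a" by simp
        then show ?case using Suc by simp
      qed simp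
      ultimately have "real a + 1 \<le> (real p powr \<epsilon>) powr real a"
        by (simp add: powr_realpow)
      moreover have "K ^ card A \<le> K ^ card B"
        using K AB fin by (intro power_increasing card_mono) auto
      ultimately have "(real a + 1) * K ^ card A \<le> (real p powr \<epsilon>) powr real a * K ^ card B"
        using K by (intro mult_mono) auto
      then show ?thesis by (simp add: mult.commute)
    qed
    have "card {d. d dvd n} \<le> (a + 1) * card {d. d dvd m}"
      unfolding n by (rule card_divisors_prime_power_mult[OF p(1) m])
    then have "real (card {d. d dvd n}) \<le> real ((a + 1) * card {d. d dvd m})"
      by (rule of_nat_mono)
    then have "real (card {d. d dvd n}) \<le> (real a + 1) * real (card {d. d dvd m})"
      by (simp add: algebra_simps)
    also have "\<dots> \<le> (real a + 1) * (K ^ card A * real m powr \<epsilon>)"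
      using IH by (intro mult_left_mono) auto
    also have "\<dots> = ((real a + 1) * K ^ card A) * real m powr \<epsilon>" by simp
    also have "\<dots> \<le> (K ^ card B * (real p powr \<epsilon>) powr real a) * real m powr \<epsilon>"
      using step by (intro mult_right_mono) auto
    also have "\<dots> = K ^ card B * real n powr \<epsilon>" by (simp add: npow)
    finally show ?thesis by (simp add: B_def)
  qed
qed

lemma divisor_bound:
  fixes \<epsilon> :: real
  assumes \<epsilon>: "\<epsilon> > 0"
  obtains C where "C > 0" "\<And>n. n > 0 \<Longrightarrow> real (card {d. d dvd n}) \<le> C * real n powr \<epsilon>"
proof -
  \<comment> \<open>Chosen so that \<open>K * (1 + a * \<epsilon> * ln 2)\<close> dominates
    \<open>a + 1\<close>; the bracket is the linear lower bound of
    \<open>2 powr (a * \<epsilon>)\<close>.\<close>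
  define K where "K = 1 + 1 / (\<epsilon> * ln 2)"
  have K1: "K \<ge> 1" using \<epsilon> by (simp add: K_def)
  have Ka: "real a + 1 \<le> K * 2 powr (real a * \<epsilon>)" for a
  proof -
    have "real a + 1 \<le> K * (1 + real a * \<epsilon> * ln 2)"
      using \<epsilon> by (simp add: K_def field_simps)
    also have "\<dots> \<le> K * 2 powr (real a * \<epsilon>)"
      using K1 exp_ge_add_one_self[of "real a * \<epsilon> * ln 2"]
      by (intro mult_left_mono) (auto simp: powr_def)
    finally show ?thesis .
  qed
  \<comment> \<open>From here on \<open>p powr \<epsilon>\<close> is at least 2; there are at most
    \<open>P\<close> smaller primes, hence the constant \<open>K ^ P\<close>.\<close>
  define P where "P = nat \<lceil>2 powr (1 / \<epsilon>)\<rceil>"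
  have "2 powr (1 / \<epsilon>) \<le> real P" unfolding P_def by linarith
  then have "(2 powr (1 / \<epsilon>)) powr \<epsilon> \<le> real P powr \<epsilon>" using \<epsilon> by (intro powr_mono2) auto
  then have P: "real P powr \<epsilon> \<ge> 2" using \<epsilon> by (simp add: powr_powr)
  show ?thesis
  proof (rule that)
    show "K ^ P > 0" using K1 by simp
    fix n :: nat assume n: "n > 0"
    have "card {p. prime p \<and> p < P \<and> p dvd n} \<le> card {..<P}"
      by (intro card_mono) auto
    then have "K ^ card {p. prime p \<and> p < P \<and> p dvd n} \<le> K ^ P"
      using K1 by (intro power_increasing) auto
    then have "K ^ card {p. prime p \<and> p < P \<and> p dvd n} * real n powr \<epsilon> \<le> K ^ P * real n powr \<epsilon>"
      by (intro mult_right_mono) auto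
    with divisor_bound_small_primes[OF K1 Ka P \<epsilon> n]
    show "real (card {d. d dvd n}) \<le> K ^ P * real n powr \<epsilon>" by linarith
  qed
qed

section \<open>Averaged bumps around fractions\<close>

text \<open>
  The denominators are \<open>1\<close> modulo \<open>D\<close>: being coprime to \<open>D\<close>, two of their fractions cannot differ by
  a multiple of \<open>1/D\<close> other than an integer.
\<close>
definition denominator :: "nat \<Rightarrow> nat \<Rightarrow> nat \<Rightarrow> nat" where
  "denominator D n j = D * (n + j) + 1"

text \<open>Rescaling both width and argument by the denominator \<open>H\<close> gives tents of the
  same half-width \<open>\<delta>\<close> around all fractions \<open>a/H\<close>, with mean 1 for
  each \<open>H\<close> as long as \<open>H * \<delta> \<le> 1/2\<close>.\<close>

definition comb :: "nat \<Rightarrow> nat \<Rightarrow> real \<Rightarrow> real \<Rightarrow> real" where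
  "comb D n \<delta> x = (\<Sum>j<n. triangle_wave (real (denominator D n j) * \<delta>) (real (denominator D n j) * x)) / real n"

definition comb_coeff :: "nat \<Rightarrow> nat \<Rightarrow> real \<Rightarrow> nat \<Rightarrow> real" where
  "comb_coeff D n \<delta> l = fejer_coeff \<delta> l * real (card {j. j < n \<and> denominator D n j dvd l}) / real n"

lemma denominator_bounds:
  assumes "D > 0" "j < n"
  shows "D * n < denominator D n j" "denominator D n j \<le> 2 * D * n"
proof -
  show "D * n < denominator D n j" by (simp add: denominator_def algebra_simps)
  have "D * (n + j) + 1 \<le> D * (n + j) + D" using assms by simp
  also have "\<dots> = D * (n + (j + 1))" by (simp add: algebra_simps)
  also have "\<dots> \<le> D * (n + n)" using assms by (intro mult_le_mono) auto
  finally show "denominator D n j \<le> 2 * D * n" by (simp add: denominator_def algebra_simps)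
qed

lemma denominator_pos: "denominator D n j > 0"
  by (simp add: denominator_def)

lemma inj_denominator: "D > 0 \<Longrightarrow> inj (denominator D n)"
  by (auto simp: denominator_def inj_on_def)

lemma coprime_denominator: "coprime D (denominator D n j)"
proof (rule coprimeI)
  fix c assume "c dvd D" "c dvd denominator D n j"
  then show "is_unit c"
    using dvd_add_right_iff[of c "D * (n + j)" 1] by (simp add: denominator_def del: One_nat_def)
qed

text \<open>The comb of a single denominator \<open>H\<close> has only frequencies \<open>l\<close>
  divisible by \<open>H\<close>, and there its coefficient is \<open>fejer_coeff \<delta> l\<close>,
  in which \<open>H\<close> cancels. Averaging therefore merely counts the denominators dividing
  \<open>l\<close>.\<close>

lemma comb_sums:
  assumes "D > 0" "n > 0" "\<delta> > 0" and small: "2 * real D * real n * \<delta> \<le> 1/2"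
  shows "(\<lambda>l. comb_coeff D n \<delta> l * cos (2 * pi * (real l * x))) sums comb D n \<delta> x"
proof -
  let ?H = "denominator D n"
  have *: "(\<lambda>l. (if ?H j dvd l then fejer_coeff \<delta> l else 0) * cos (2 * pi * (real l * x)))
      sums triangle_wave (real (?H j) * \<delta>) (real (?H j) * x)" if "j < n" for j
  proof -
    have "real (?H j) \<le> real (2 * D * n)"
      using denominator_bounds(2)[OF \<open>D > 0\<close> that] by (rule of_nat_mono)
    then have "real (?H j) * \<delta> \<le> real (2 * D * n) * \<delta>"
      using \<open>\<delta> > 0\<close> by (intro mult_right_mono) auto
    then have H: "?H j > 0" "real (?H j) * \<delta> \<le> 1 / 2"
      using small denominator_pos by auto
    then have "(\<lambda>l. fejer_coeff (real (?H j) * \<delta>) l * cos (2 * pi * (real l * (real (?H j) * x))))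
        sums triangle_wave (real (?H j) * \<delta>) (real (?H j) * x)"
      using \<open>\<delta> > 0\<close> by (intro triangle_wave_sums) auto
    moreover have "fejer_coeff (real (?H j) * \<delta>) l = fejer_coeff \<delta> (?H j * l)" for l
      using H by (simp add: fejer_coeff_def mult_ac)
    ultimately have "(\<lambda>l. (if ?H j dvd ?H j * l then fejer_coeff \<delta> (?H j * l) else 0)
        * cos (2 * pi * (real (?H j * l) * x))) sums triangle_wave (real (?H j) * \<delta>) (real (?H j) * x)"
      by (simp add: mult_ac)
    moreover have "strict_mono (\<lambda>l. ?H j * l)" using H by (auto simp: strict_mono_def)
    ultimately show ?thesis
      by (subst (asm) sums_mono_reindex[of "\<lambda>l. ?H j * l"]) (auto simp: dvd_def)
  qed
  have "(\<lambda>l. (\<Sum>j<n. (if ?H j dvd l then fejer_coeff \<delta> l else 0) * cos (2 * pi * (real l * x))) / n)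
      sums comb D n \<delta> x"
    unfolding comb_def by (intro sums_divide sums_sum *) auto
  moreover have "(\<Sum>j<n. (if ?H j dvd l then fejer_coeff \<delta> l else 0) * cos (2 * pi * (real l * x))) / n
      = comb_coeff D n \<delta> l * cos (2 * pi * (real l * x))" for l
  proof -
    have "(\<Sum>j<n. if ?H j dvd l then fejer_coeff \<delta> l else 0) = (\<Sum>j\<in>{j. j < n \<and> ?H j dvd l}. fejer_coeff \<delta> l)"
      by (intro sum.mono_neutral_cong_right) auto
    then show ?thesis
      unfolding comb_coeff_def sum_distrib_right[symmetric] by (simp add: mult_ac)
  qed
  ultimately show ?thesis by simp
qed

lemma comb_coeff_nonneg: "0 \<le> comb_coeff D n \<delta> l"
  by (simp add: comb_coeff_def fejer_coeff_nonneg)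

lemma comb_coeff_0: "n > 0 \<Longrightarrow> comb_coeff D n \<delta> 0 = 1"
  by (simp add: comb_coeff_def fejer_coeff_def)

lemma comb_coeff_le_fejer: "comb_coeff D n \<delta> l \<le> fejer_coeff \<delta> l"
proof -
  have "card {j. j < n \<and> denominator D n j dvd l} \<le> card {..<n}" by (intro card_mono) auto
  then have "real (card {j. j < n \<and> denominator D n j dvd l}) / n \<le> 1"
    by (cases "n = 0") (auto simp: divide_le_eq)
  then have "fejer_coeff \<delta> l * (real (card {j. j < n \<and> denominator D n j dvd l}) / n) \<le> fejer_coeff \<delta> l * 1"
    by (intro mult_left_mono fejer_coeff_nonneg)
  then show ?thesis by (simp add: comb_coeff_def)
qed

text \<open>Every denominator exceeds \<open>D * n\<close>, so none divides a smaller positive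
  \<open>l\<close>. This gap of low frequencies is what makes a comb with large \<open>n\<close> a
  small perturbation.\<close>

lemma comb_coeff_eq_0:
  assumes "D > 0" "0 < l" "l \<le> D * n" shows "comb_coeff D n \<delta> l = 0"
proof -
  have "\<not> denominator D n j dvd l" if "j < n" for j
    using denominator_bounds(1)[OF assms(1) that] assms by (auto dest: dvd_imp_le)
  then show ?thesis by (auto simp: comb_coeff_def)
qed

lemma comb_coeff_le_divisors:
  assumes "D > 0" "l > 0"
  shows "comb_coeff D n \<delta> l \<le> fejer_coeff \<delta> l * real (card {d. d dvd l}) / real n"
proof -
  have "card {j. j < n \<and> denominator D n j dvd l} \<le> card {d. d dvd l}"
    using assms inj_denominator[OF assms(1), of n]
    by (intro card_inj_on_le[of "denominator D n"]) (auto simp: inj_on_def)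
  then show ?thesis
    unfolding comb_coeff_def
    by (intro divide_right_mono mult_left_mono) (auto simp: fejer_coeff_nonneg)
qed

text \<open>Chosen so that \<open>D\<close> times any denominator is at most \<open>scale s D n powr (s/2)\<close>.\<close>
definition scale :: "real \<Rightarrow> nat \<Rightarrow> nat \<Rightarrow> real" where
  "scale s D n = (2 * real D ^ 2 * real n) powr (2 / s)"

lemma scale_powr: "s > 0 \<Longrightarrow> scale s D n powr (s / 2) = 2 * real D ^ 2 * real n"
  by (simp add: scale_def powr_powr)

text \<open>Since \<open>s \<le> 1\<close>, the exponent \<open>2 / s\<close> is at least 2. The
  quadratic lower bound later separates fractions whose denominators belong to one stage.\<close>

lemma scale_ge:
  assumes "0 < s" "s \<le> 1" "D > 0" "n > 0"
  shows "(2 * real D ^ 2 * real n) ^ 2 \<le> scale s D n" "2 \<le> 2 * real D ^ 2 * real n" 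
proof -
  have "1 * 1 \<le> real D ^ 2 * real n" using assms by (intro mult_mono) auto
  then show *: "2 \<le> 2 * real D ^ 2 * real n" by simp
  have "(2 * real D ^ 2 * real n) powr 2 \<le> (2 * real D ^ 2 * real n) powr (2 / s)"
    using assms * by (intro powr_mono) (auto simp: field_simps)
  then show "(2 * real D ^ 2 * real n) ^ 2 \<le> scale s D n"
    using * by (simp add: scale_def powr_numeral)
qed

lemma scale_gt_1:
  assumes "0 < s" "s \<le> 1" "D > 0" "n > 0"
  shows "scale s D n > 1" "real n \<le> scale s D n" "2 * real D * real n * (1 / (4 * scale s D n)) \<le> 1/2"
proof -
  let ?x = "2 * real D ^ 2 * real n"
  note * = scale_ge[OF assms]
  have "?x \<le> ?x ^ 2" using *(2) by (intro self_le_power) linarith+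
  then have **: "?x \<le> scale s D n" using *(1) by (rule order.trans)
  then show "scale s D n > 1" using *(2) by linarith
  have "1 \<le> real D ^ 2" using assms by (intro one_le_power) auto
  then have "1 * real n \<le> 2 * real D ^ 2 * real n"
    by (intro mult_right_mono) linarith+
  then show "real n \<le> scale s D n" using ** by linarith
  have "real D * 1 \<le> real D * real D" using assms by (intro mult_left_mono) auto
  then have "2 * real D * real n \<le> ?x" by (simp add: power2_eq_square mult_right_mono)
  then have "2 * real D * real n \<le> scale s D n" using ** by linarith
  then show "2 * real D * real n * (1 / (4 * scale s D n)) \<le> 1/2"
    using \<open>scale s D n > 1\<close> by (simp add: field_simps)
qed

text \<open>The Fejer coefficient is at most a constant times \<open>n * l powr (-s/2)\<close>; the
  \<open>n\<close> cancels against the averaging, and the divisor bound costs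
  \<open>l powr (\<epsilon>/2)\<close>. The remaining \<open>l powr (-\<epsilon>/2)\<close> becomes
  the gain in \<open>n\<close>, since the coefficients at positive \<open>l \<le> n\<close> vanish.
  \<open>K\<close> depends on \<open>D\<close> but not on \<open>n\<close>.\<close>

lemma comb_coeff_decay:
  fixes s \<epsilon> :: real
  assumes s: "0 < s" "s \<le> 1" and \<epsilon>: "\<epsilon> > 0" and D: "D > 0"
  obtains K where "K > 0"
    "\<And>n l. n > 0 \<Longrightarrow> l > 0 \<Longrightarrow> comb_coeff D n (1 / (4 * scale s D n)) l
        \<le> K * real n powr (- \<epsilon> / 2) * real l powr (- s / 2 + \<epsilon>)"
proof -
  obtain C where C: "C > 0" "\<And>n. n > 0 \<Longrightarrow> real (card {d. d dvd n}) \<le> C * real n powr (\<epsilon> / 2)"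
    using divisor_bound[of "\<epsilon> / 2"] \<epsilon> by auto
  show ?thesis
  proof (rule that)
    show "64 * real D ^ 2 * C > 0" using C D by simp
    fix n l :: nat assume n: "n > 0" and l: "l > 0"
    define q where "q = scale s D n"
    have q: "q > 1" unfolding q_def by (rule scale_gt_1) fact+
    define \<delta> where "\<delta> = 1 / (4 * q)"
    have \<delta>: "\<delta> > 0" using q by (simp add: \<delta>_def)
    show "comb_coeff D n (1 / (4 * scale s D n)) l
        \<le> (64 * real D ^ 2 * C) * real n powr (- \<epsilon> / 2) * real l powr (- s / 2 + \<epsilon>)"
    proof (cases "l \<le> D * n")
      case True
      then show ?thesis using comb_coeff_eq_0[OF D l True] C by simp
    next
      case False
      have "n \<le> D * n" using D by simp
      then have nl: "n \<le> l" using False by linarith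
      \<comment> \<open>Below \<open>q\<close> the trivial bound 2 suffices. Above,
        \<open>\<delta> = 1 / (4 * q)\<close> turns the inverse-square bound into 32 times the
        square of \<open>q / l\<close>, which lowering the exponent to \<open>s/2\<close> only
        enlarges.\<close>
      have fej: "fejer_coeff \<delta> l \<le> 32 * (q / l) powr (s / 2)"
      proof (cases "real l \<le> q")
        case True
        then have "1 \<le> (q / l) powr (s / 2)" using s l by (intro ge_one_powr_ge_zero) auto
        then show ?thesis using fejer_coeff_le(1)[OF \<delta>, of l] by linarith
      next
        case False
        have "fejer_coeff \<delta> l \<le> 2 / (\<delta> * real l)\<^sup>2" by (rule fejer_coeff_le(2)[OF \<delta> l])
        also have "\<dots> = 32 * (q / l) powr 2"
          using q l by (simp add: \<delta>_def field_simps power2_eq_square)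
        also have "\<dots> \<le> 32 * (q / l) powr (s / 2)"
          using False q l s by (intro mult_left_mono powr_mono') auto
        finally show ?thesis .
      qed
      also have "(q / l) powr (s / 2) = (2 * real D ^ 2 * real n) * real l powr (- s / 2)"
        using q s l scale_powr[of s D n] by (simp add: powr_divide q_def powr_minus_divide)
      finally have fej': "fejer_coeff \<delta> l \<le> 64 * real D ^ 2 * real n * real l powr (- s / 2)" by simp
      have "comb_coeff D n \<delta> l \<le> fejer_coeff \<delta> l * real (card {d. d dvd l}) / real n"
        by (rule comb_coeff_le_divisors[OF D l])
      also have "\<dots> \<le> (64 * real D ^ 2 * real n * real l powr (- s / 2)) * (C * real l powr (\<epsilon> / 2)) / n"
        using fej' C(2)[OF l] by (intro divide_right_mono mult_mono) auto
      also have "\<dots> = (64 * real D ^ 2 * C) * real l powr (- \<epsilon> / 2) * real l powr (- s / 2 + \<epsilon>)"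
        using n l by (simp add: powr_add[symmetric] mult_ac)
      also have "\<dots> \<le> (64 * real D ^ 2 * C) * real n powr (- \<epsilon> / 2) * real l powr (- s / 2 + \<epsilon>)"
        using nl n \<epsilon> C by (intro mult_right_mono mult_left_mono powr_mono2') auto
      finally show ?thesis by (simp add: \<delta>_def q_def)
    qed
  qed
qed

lemma comb_nonneg: "\<delta> \<ge> 0 \<Longrightarrow> 0 \<le> comb D n \<delta> x"
  by (simp add: comb_def sum_nonneg triangle_wave_nonneg)

lemma continuous_on_comb: "continuous_on A (comb D n \<delta>)"
  unfolding comb_def divide_inverse by (intro continuous_intros)

lemma comb_minus: "comb D n \<delta> (- x) = comb D n \<delta> x"
  by (simp add: comb_def triangle_wave_def infdist_Ints_minus)

lemma comb_nonzeroD: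
  assumes "comb D n \<delta> x \<noteq> 0" "\<delta> > 0"
  obtains j where "j < n" "infdist (real (denominator D n j) * x) \<int> \<le> real (denominator D n j) * \<delta>"
proof -
  obtain j where j: "j < n" "triangle_wave (real (denominator D n j) * \<delta>) (real (denominator D n j) * x) \<noteq> 0"
    using assms(1) unfolding comb_def by (auto elim!: sum.not_neutral_contains_not_neutral)
  have pos: "real (denominator D n j) * \<delta> > 0" using denominator_pos assms(2) by simp
  have "1 - infdist (real (denominator D n j) * x) \<int> / (real (denominator D n j) * \<delta>) > 0"
  proof (rule ccontr)
    assume "\<not> ?thesis"
    then have "max 0 (1 - infdist (real (denominator D n j) * x) \<int> / (real (denominator D n j) * \<delta>)) = 0"
      by (simp only: not_less max_absorb1)
    then show False using j(2) by (simp add: triangle_wave_def)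
  qed
  then have "infdist (real (denominator D n j) * x) \<int> / (real (denominator D n j) * \<delta>) < 1"
    by linarith
  then have "infdist (real (denominator D n j) * x) \<int> \<le> real (denominator D n j) * \<delta>"
    using pos by (subst (asm) pos_divide_less_eq) auto
  then show ?thesis using that j(1) by blast
qed

section \<open>Decay of discrete convolutions\<close>

lemma inverse_square_translates_bound:
  obtains M :: real where "M > 0" "\<And>\<xi>. summable (\<lambda>l. (1 + \<bar>\<xi> - real l\<bar>) powr (-2))"
    "\<And>\<xi>. (\<Sum>l. (1 + \<bar>\<xi> - real l\<bar>) powr (-2)) \<le> M"
proof -
  define b where "b j = 1 / real (Suc j) ^ 2" for j
  have sb: "summable b"
    using inverse_power_summable[of 2, where 'a = real] 
    unfolding b_def by (subst summable_Suc_iff) (simp add: divide_inverse)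
  have b0: "b j \<ge> 0" for j by (simp add: b_def)
  have part: "(\<Sum>l<N. (1 + \<bar>\<xi> - real l\<bar>) powr (-2)) \<le> 8 * suminf b" for \<xi> N
  proof -
    define z where "z = \<lfloor>\<xi>\<rfloor>"
    \<comment> \<open>Replacing \<open>\<xi>\<close> by its floor at most doubles one plus the
      distance, hence the factor 4 after squaring.\<close>
    have le: "(1 + \<bar>\<xi> - real l\<bar>) powr (-2) \<le> 4 * b (nat \<bar>z - int l\<bar>)" for l
    proof -
      have z: "real_of_int z \<le> \<xi>" "\<xi> \<le> real_of_int z + 1" unfolding z_def by linarith+
      have r: "real (Suc (nat \<bar>z - int l\<bar>)) = 1 + \<bar>real_of_int z - real l\<bar>"
        by simp
      have "real (Suc (nat \<bar>z - int l\<bar>)) \<le> 2 * (1 + \<bar>\<xi> - real l\<bar>)"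
        unfolding r using z by (auto simp: abs_if)
      then have "real (Suc (nat \<bar>z - int l\<bar>)) ^ 2 \<le> (2 * (1 + \<bar>\<xi> - real l\<bar>)) ^ 2"
        by (intro power_mono) auto
      then have "real (Suc (nat \<bar>z - int l\<bar>)) ^ 2 \<le> 4 * (1 + \<bar>\<xi> - real l\<bar>) ^ 2"
        unfolding power_mult_distrib by simp
      moreover have "(1 + \<bar>\<xi> - real l\<bar>) powr (-2) = 1 / (1 + \<bar>\<xi> - real l\<bar>) ^ 2"
        by (simp add: powr_minus_divide powr_numeral)
      moreover have "0 < (1 + \<bar>\<xi> - real l\<bar>) ^ 2" by (intro zero_less_power) linarith
      moreover have "0 < real (Suc (nat \<bar>z - int l\<bar>)) ^ 2" by simp
      moreover have "1 / x \<le> 4 * (1 / y)" if "y \<le> 4 * x" "0 < x" "0 < y" for x y :: real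
        using that by (simp add: field_simps)
      ultimately show ?thesis unfolding b_def by presburger
    qed
    have inj: "(\<Sum>l\<in>S. b (nat \<bar>z - int l\<bar>)) \<le> suminf b"
      if "finite S" "inj_on (\<lambda>l. nat \<bar>z - int l\<bar>) S" for S
      using sum_le_suminf[OF sb, of "(\<lambda>l. nat \<bar>z - int l\<bar>) ` S"] that b0
      by (simp add: sum.reindex)
    have "(\<Sum>l<N. (1 + \<bar>\<xi> - real l\<bar>) powr (-2)) \<le> (\<Sum>l<N. 4 * b (nat \<bar>z - int l\<bar>))"
      by (intro sum_mono le)
    also have "\<dots> = 4 * (\<Sum>l<N. b (nat \<bar>z - int l\<bar>))" by (simp add: sum_distrib_left)
    \<comment> \<open>Each distance to \<open>z\<close> occurs at most once on either side of
      \<open>z\<close>, so within each part the terms are distinct terms of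
      \<open>b\<close>.\<close>
    also have "(\<Sum>l<N. b (nat \<bar>z - int l\<bar>)) = (\<Sum>l\<in>{l. l < N \<and> int l \<le> z}. b (nat \<bar>z - int l\<bar>))
        + (\<Sum>l\<in>{l. l < N \<and> \<not> int l \<le> z}. b (nat \<bar>z - int l\<bar>))"
      by (subst sum.union_disjoint[symmetric]) (auto intro!: sum.cong)
    also have "\<dots> \<le> suminf b + suminf b"
      by (intro add_mono inj) (auto simp: inj_on_def)
    finally show ?thesis by simp
  qed
  have b1: "suminf b > 0" using suminf_pos[OF sb] by (simp add: b_def)
  have sm: "summable (\<lambda>l. (1 + \<bar>\<xi> - real l\<bar>) powr (-2))" for \<xi>
    by (rule summableI_nonneg_bounded[OF _ part]) auto
  moreover have "(\<Sum>l. (1 + \<bar>\<xi> - real l\<bar>) powr (-2)) \<le> 8 * suminf b" for \<xi>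
    by (rule suminf_le_const[OF sm part])
  ultimately show ?thesis using that[of "8 * suminf b"] b1 by auto
qed

text \<open>One of \<open>A\<close>, \<open>B\<close> is at least \<open>X / 2\<close> and supplies
  \<open>X powr (-\<beta>)\<close> at a cost of \<open>2 powr \<beta> \<le> 4\<close>. If it is
  \<open>B\<close>, only the part \<open>\<beta>\<close> of its exponent 2 is spent and the rest is
  handed to \<open>A\<close>.\<close>

lemma powr_product_le:
  fixes A B X \<beta> :: real
  assumes "A \<ge> 1" "B \<ge> 1" "X \<ge> 1" "X \<le> A + B" "0 \<le> \<beta>" "\<beta> \<le> 2"
  shows "A powr (-\<beta>) * B powr (-2) \<le> 4 * X powr (-\<beta>) * (A powr (-2) + B powr (-2))"
proof -
  have key: "Y powr (-\<beta>) \<le> 4 * X powr (-\<beta>)" if "X \<le> 2 * Y" "Y \<ge> 1" for Y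
  proof -
    have "Y powr (-\<beta>) \<le> (X / 2) powr (-\<beta>)"
      using that assms by (intro powr_mono2') auto
    also have "\<dots> = X powr (-\<beta>) * 2 powr \<beta>"
      using assms by (simp add: powr_divide powr_minus_divide)
    also have "\<dots> \<le> X powr (-\<beta>) * 2 powr 2"
      using assms by (intro mult_left_mono powr_mono) auto
    finally show ?thesis by (simp add: powr_numeral)
  qed
  show ?thesis
  proof (cases "B \<le> A")
    case True
    have "A powr (-\<beta>) * B powr (-2) \<le> 4 * X powr (-\<beta>) * B powr (-2)"
      using True assms by (intro mult_right_mono key) auto
    also have "\<dots> \<le> 4 * X powr (-\<beta>) * (A powr (-2) + B powr (-2))"
      by (intro mult_left_mono) auto
    finally show ?thesis .
  next
    case False
    have "A powr (-\<beta>) * B powr (-2) = B powr (-\<beta>) * (A powr (-\<beta>) * B powr (-(2 - \<beta>)))"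
      using assms by (simp add: powr_add[symmetric])
    also have "\<dots> \<le> (4 * X powr (-\<beta>)) * (A powr (-\<beta>) * A powr (-(2 - \<beta>)))"
      using False assms by (intro mult_mono key powr_mono2') auto
    also have "A powr (-\<beta>) * A powr (-(2 - \<beta>)) = A powr (-2)"
      by (simp add: powr_add[symmetric])
    also have "4 * X powr (-\<beta>) * A powr (-2) \<le> 4 * X powr (-\<beta>) * (A powr (-2) + B powr (-2))"
      by (intro mult_left_mono) auto
    finally show ?thesis .
  qed
qed

text \<open>Since \<open>|\<xi>|\<close> is at most \<open>l + |\<xi> - l|\<close> and at most
  \<open>l + |\<xi> + l|\<close>, \<open>powr_product_le\<close> splits each term into the desired
  decay times summable inverse squares. All data are quantified after \<open>M\<close> because one
  \<open>M\<close> serves two coefficient sequences: \<open>\<beta> = s/2 - \<epsilon>\<close> for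
  the increment of a transform, \<open>\<beta> = 2\<close> for the next bump.\<close>

lemma convolution_decay:
  obtains M :: real where "M > 0"
    "\<forall>g e C \<kappa> \<beta> \<xi>. (\<forall>\<xi>. 0 \<le> g \<xi> \<and> g \<xi> \<le> C * (1 + \<bar>\<xi>\<bar>) powr (-2)) \<longrightarrow> 0 \<le> \<kappa> \<longrightarrow>
       (\<forall>l. 0 \<le> e l \<and> e l \<le> \<kappa> * (1 + real l) powr (-\<beta>)) \<longrightarrow> 0 \<le> \<beta> \<longrightarrow> \<beta> \<le> 2 \<longrightarrow>
       summable (\<lambda>l. e l * ((g (\<xi> - real l) + g (\<xi> + real l)) / 2)) \<and>
       (\<Sum>l. e l * ((g (\<xi> - real l) + g (\<xi> + real l)) / 2)) \<le> M * C * \<kappa> * (1 + \<bar>\<xi>\<bar>) powr (-\<beta>)"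
proof -
  obtain M :: real where M: "M > 0" "\<And>\<xi>. summable (\<lambda>l. (1 + \<bar>\<xi> - real l\<bar>) powr (-2))"
    "\<And>\<xi>. (\<Sum>l. (1 + \<bar>\<xi> - real l\<bar>) powr (-2)) \<le> M"
    using inverse_square_translates_bound by blast
  show ?thesis
  proof (rule that)
    show "8 * M > 0" using M by simp
  next
    show "\<forall>g e C \<kappa> \<beta> \<xi>. (\<forall>\<xi>. 0 \<le> g \<xi> \<and> g \<xi> \<le> C * (1 + \<bar>\<xi>\<bar>) powr (-2)) \<longrightarrow> 0 \<le> \<kappa> \<longrightarrow>
       (\<forall>l. 0 \<le> e l \<and> e l \<le> \<kappa> * (1 + real l) powr (-\<beta>)) \<longrightarrow> 0 \<le> \<beta> \<longrightarrow> \<beta> \<le> 2 \<longrightarrow>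
       summable (\<lambda>l. e l * ((g (\<xi> - real l) + g (\<xi> + real l)) / 2)) \<and>
       (\<Sum>l. e l * ((g (\<xi> - real l) + g (\<xi> + real l)) / 2)) \<le> 8 * M * C * \<kappa> * (1 + \<bar>\<xi>\<bar>) powr (-\<beta>)"
    proof (intro allI impI)
      fix g :: "real \<Rightarrow> real" and e :: "nat \<Rightarrow> real" and C \<kappa> \<beta> \<xi> :: real
      assume g': "\<forall>\<xi>. 0 \<le> g \<xi> \<and> g \<xi> \<le> C * (1 + \<bar>\<xi>\<bar>) powr (-2)" and \<kappa>: "0 \<le> \<kappa>"
        and e': "\<forall>l. 0 \<le> e l \<and> e l \<le> \<kappa> * (1 + real l) powr (-\<beta>)" and \<beta>: "0 \<le> \<beta>" "\<beta> \<le> 2"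
      note g = g'[rule_format] and e = e'[rule_format]
      define X where "X = 1 + \<bar>\<xi>\<bar>"
      have C0: "C \<ge> 0" using g[of 0] by simp
      define a where "a \<xi> l = (1 + \<bar>\<xi> - real l\<bar>) powr (-2)" for \<xi> :: real and l
      have one: "e l * g \<zeta> \<le> \<kappa> * C * (4 * X powr (-\<beta>) * (a 0 l + (1 + \<bar>\<zeta>\<bar>) powr (-2)))"
        if "\<bar>\<xi>\<bar> \<le> real l + \<bar>\<zeta>\<bar>" for l \<zeta>
      proof -
        have "e l * g \<zeta> \<le> (\<kappa> * (1 + real l) powr (-\<beta>)) * (C * (1 + \<bar>\<zeta>\<bar>) powr (-2))"
          using e[of l] g[of \<zeta>] \<kappa> by (intro mult_mono) auto
        also have "\<dots> = \<kappa> * C * ((1 + real l) powr (-\<beta>) * (1 + \<bar>\<zeta>\<bar>) powr (-2))" by simp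
        also have "\<dots> \<le> \<kappa> * C * (4 * X powr (-\<beta>) * ((1 + real l) powr (-2) + (1 + \<bar>\<zeta>\<bar>) powr (-2)))"
          using \<kappa> C0 \<beta> that by (intro mult_left_mono powr_product_le) (auto simp: X_def)
        finally show ?thesis by (simp add: a_def)
      qed
      define t where "t l = \<kappa> * C * (2 * X powr (-\<beta>)) * (2 * a 0 l + a \<xi> l + a (-\<xi>) l)" for l
      have term_le: "e l * ((g (\<xi> - real l) + g (\<xi> + real l)) / 2) \<le> t l" for l
      proof -
        have "\<bar>\<xi>\<bar> \<le> real l + \<bar>\<xi> - real l\<bar>" "\<bar>\<xi>\<bar> \<le> real l + \<bar>\<xi> + real l\<bar>" by linarith+
        moreover have "\<bar>\<xi> + real l\<bar> = \<bar>- \<xi> - real l\<bar>" by simp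
        ultimately have "e l * g (\<xi> - real l) + e l * g (\<xi> + real l) \<le> 2 * t l"
          using one[of l "\<xi> - real l"] one[of l "\<xi> + real l"]
          unfolding t_def a_def by (auto simp: algebra_simps)
        then show ?thesis by (simp add: algebra_simps)
      qed
      have nn: "0 \<le> e l * ((g (\<xi> - real l) + g (\<xi> + real l)) / 2)" for l using e g by auto
      have sa: "summable (a \<zeta>)" "suminf (a \<zeta>) \<le> M" for \<zeta> using M unfolding a_def by auto
      have ts: "t sums (\<kappa> * C * (2 * X powr (-\<beta>)) * (2 * suminf (a 0) + suminf (a \<xi>) + suminf (a (-\<xi>))))"
        unfolding t_def by (intro sums_mult sums_add summable_sums sa)
      have sm: "summable (\<lambda>l. e l * ((g (\<xi> - real l) + g (\<xi> + real l)) / 2))"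
        by (rule summable_comparison_test'[OF sums_summable[OF ts], of 0]) (use nn term_le in auto)
      have "(\<Sum>l. e l * ((g (\<xi> - real l) + g (\<xi> + real l)) / 2)) \<le> suminf t"
        by (intro suminf_le term_le sm sums_summable[OF ts])
      also have "\<dots> = \<kappa> * C * (2 * X powr (-\<beta>)) * (2 * suminf (a 0) + suminf (a \<xi>) + suminf (a (-\<xi>)))"
        using ts by (rule sums_unique[symmetric])
      also have "\<dots> \<le> \<kappa> * C * (2 * X powr (-\<beta>)) * (2 * M + M + M)"
        using \<kappa> C0 by (intro mult_left_mono add_mono sa) auto
      finally show "summable (\<lambda>l. e l * ((g (\<xi> - real l) + g (\<xi> + real l)) / 2)) \<and>
         (\<Sum>l. e l * ((g (\<xi> - real l) + g (\<xi> + real l)) / 2)) \<le> 8 * M * C * \<kappa> * (1 + \<bar>\<xi>\<bar>) powr (-\<beta>)"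
        using sm by (simp add: X_def mult_ac)
    qed
  qed
qed

section \<open>Multiplying a bump by an averaged comb\<close>

text \<open>For the even functions considered here this is the Fourier transform, kept real so that
  transforms can be compared by \<open>\<le>\<close>.\<close>

definition cos_transform :: "(real \<Rightarrow> real) \<Rightarrow> real \<Rightarrow> real" where
  "cos_transform \<psi> \<xi> = (LINT x|lborel. \<psi> x * cos (2 * pi * (x * \<xi>)))"

text \<open>The invariant of the iteration. Support in \<open>[-1/4, 1/4]\<close> leaves room for
  shifts of size up to 1/4, and quadratic decay lets the transform act as the kernel of the
  convolution estimate. \<open>C\<close> may grow without control from stage to stage, because
  \<open>n\<close> is chosen after it.\<close>

definition bump :: "real \<Rightarrow> (real \<Rightarrow> real) \<Rightarrow> bool" where
  "bump C \<psi> \<longleftrightarrow> continuous_on UNIV \<psi> \<and> (\<forall>x. 0 \<le> \<psi> x) \<and> (\<forall>x. \<psi> (- x) = \<psi> x) \<and>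
     (\<forall>x. \<bar>x\<bar> > 1/4 \<longrightarrow> \<psi> x = 0) \<and>
     (\<forall>\<xi>. 0 \<le> cos_transform \<psi> \<xi> \<and> cos_transform \<psi> \<xi> \<le> C * (1 + \<bar>\<xi>\<bar>) powr (-2))"

lemma bump_integrable:
  assumes "bump C \<psi>" shows "integrable lborel \<psi>"
proof -
  have "continuous_on {-1/4..1/4} \<psi>"
    using assms continuous_on_subset unfolding bump_def by blast
  then have "set_integrable lborel {-1/4..1/4} \<psi>" by (rule borel_integrable_atLeastAtMost')
  moreover have "indicator {-1/4..1/4} x *\<^sub>R \<psi> x = \<psi> x" for x
    using assms by (cases "\<bar>x\<bar> > 1/4") (auto simp: bump_def indicator_def)
  ultimately show ?thesis by (simp only: set_integrable_def)
qed

lemma integrable_times_cos: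
  fixes \<psi> :: "real \<Rightarrow> real"
  assumes "integrable lborel \<psi>" shows "integrable lborel (\<lambda>x. \<psi> x * cos (a * x))"
  by (rule Bochner_Integration.integrable_bound[OF assms])
     (use assms in \<open>auto simp: abs_mult intro!: mult_left_le\<close>)

lemma cos_transform_minus: "cos_transform \<psi> (- \<xi>) = cos_transform \<psi> \<xi>"
  by (simp add: cos_transform_def)

text \<open>Multiplying by a cosine of frequency \<open>l\<close> averages the transform over the
  two translates by \<open>l\<close>; the summable majorants \<open>e l * |\<psi> x|\<close> allow
  sum and integral to be exchanged.\<close>

lemma cos_transform_times_series:
  fixes \<psi> F :: "real \<Rightarrow> real" and e :: "nat \<Rightarrow> real"
  assumes \<psi>: "integrable lborel \<psi>" and e: "summable e" "\<And>l. e l \<ge> 0"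
    and F: "\<And>x. (\<lambda>l. e l * cos (2 * pi * (real l * x))) sums F x"
  shows "(\<lambda>l. e l * ((cos_transform \<psi> (\<xi> - real l) + cos_transform \<psi> (\<xi> + real l)) / 2))
    sums cos_transform (\<lambda>x. \<psi> x * F x) \<xi>"
proof -
  define f where "f l x = \<psi> x * (e l * cos (2 * pi * (real l * x))) * cos (2 * pi * (x * \<xi>))" for l x
  have f_eq: "f l x = (e l / 2) * (\<psi> x * cos (2 * pi * (\<xi> - real l) * x) + \<psi> x * cos (2 * pi * (\<xi> + real l) * x))" for l x
  proof -
    have *: "2 * pi * (\<xi> - real l) * x = 2 * pi * (x * \<xi>) - 2 * pi * (real l * x)"
      "2 * pi * (\<xi> + real l) * x = 2 * pi * (x * \<xi>) + 2 * pi * (real l * x)"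
      by (simp_all add: algebra_simps)
    show ?thesis unfolding f_def * cos_add cos_diff by (simp add: algebra_simps)
  qed
  have fi: "integrable lborel (f l)" for l
    unfolding f_eq by (intro integrable_mult_right Bochner_Integration.integrable_add integrable_times_cos \<psi>)
  have f_int: "integral\<^sup>L lborel (f l) = e l * ((cos_transform \<psi> (\<xi> - real l) + cos_transform \<psi> (\<xi> + real l)) / 2)" for l
  proof -
    have "integral\<^sup>L lborel (f l) = (e l / 2) * (integral\<^sup>L lborel (\<lambda>x. \<psi> x * cos (2 * pi * (\<xi> - real l) * x))
        + integral\<^sup>L lborel (\<lambda>x. \<psi> x * cos (2 * pi * (\<xi> + real l) * x)))"
      unfolding f_eq
      by (subst integral_mult_right_zero, subst Bochner_Integration.integral_add)
         (intro integrable_times_cos \<psi> refl)+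
    then show ?thesis by (simp add: cos_transform_def mult_ac)
  qed
  have norm_le: "norm (f l x) \<le> e l * \<bar>\<psi> x\<bar>" for l x
  proof -
    have "norm (f l x) = e l * \<bar>\<psi> x\<bar> * (\<bar>cos (2 * pi * (real l * x))\<bar> * \<bar>cos (2 * pi * (x * \<xi>))\<bar>)"
      using e by (simp add: f_def abs_mult)
    also have "\<dots> \<le> e l * \<bar>\<psi> x\<bar> * (1 * 1)"
      using e by (intro mult_left_mono mult_mono) auto
    finally show ?thesis by simp
  qed
  have s1: "summable (\<lambda>l. norm (f l x))" for x
    by (rule summable_comparison_test'[OF summable_mult2[OF e(1)], of 0 _ "\<bar>\<psi> x\<bar>"]) (use norm_le in auto)
  have "integral\<^sup>L lborel (\<lambda>x. norm (f l x)) \<le> integral\<^sup>L lborel (\<lambda>x. e l * \<bar>\<psi> x\<bar>)" for l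
    by (intro integral_mono norm_le integrable_norm fi integrable_mult_right) (use \<psi> in auto)
  then have s2: "summable (\<lambda>l. integral\<^sup>L lborel (\<lambda>x. norm (f l x)))"
    by (intro summable_comparison_test'[OF summable_mult2[OF e(1)], of 0 _ "integral\<^sup>L lborel (\<lambda>x. \<bar>\<psi> x\<bar>)"])
      auto
  have "(\<lambda>l. integral\<^sup>L lborel (f l)) sums integral\<^sup>L lborel (\<lambda>x. \<Sum>l. f l x)"
    by (rule sums_integral) (use fi s1 s2 in auto)
  moreover have "(\<Sum>l. f l x) = \<psi> x * F x * cos (2 * pi * (x * \<xi>))" for x
    using sums_mult2[OF sums_mult[OF F[of x], of "\<psi> x"], of "cos (2 * pi * (x * \<xi>))"]
    unfolding f_def by (simp add: sums_iff)
  ultimately show ?thesis by (simp add: f_int cos_transform_def)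
qed

text \<open>The term \<open>l = 0\<close> of the series reproduces the transform of
  \<open>\<psi>\<close>. The others are nonnegative, giving monotonicity, and carry the factor
  \<open>n powr (-\<epsilon>/2)\<close>, so for large \<open>n\<close> the convolution estimate
  pushes the increment below \<open>\<eta>\<close>.\<close>

lemma bump_times_comb:
  fixes s \<epsilon> \<eta> C :: real
  assumes \<psi>: "bump C \<psi>" and s: "0 < s" "s \<le> 1" and \<epsilon>: "0 < \<epsilon>" "\<epsilon> \<le> s / 2"
    and D: "D > 0" and \<eta>: "\<eta> > 0"
  shows "\<exists>N. \<forall>n\<ge>N. n > 0 \<longrightarrow> (\<exists>C'. bump C' (\<lambda>x. \<psi> x * comb D n (1 / (4 * scale s D n)) x)) \<and>
    (\<forall>\<xi>. cos_transform \<psi> \<xi> \<le> cos_transform (\<lambda>x. \<psi> x * comb D n (1 / (4 * scale s D n)) x) \<xi> \<and>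
       cos_transform (\<lambda>x. \<psi> x * comb D n (1 / (4 * scale s D n)) x) \<xi>
         \<le> cos_transform \<psi> \<xi> + \<eta> * (1 + \<bar>\<xi>\<bar>) powr (- s / 2 + \<epsilon>))"
proof -
  obtain K where K: "K > 0" "\<And>n l. n > 0 \<Longrightarrow> l > 0 \<Longrightarrow> comb_coeff D n (1 / (4 * scale s D n)) l
        \<le> K * real n powr (- \<epsilon> / 2) * real l powr (- s / 2 + \<epsilon>)"
    using comb_coeff_decay[OF s \<epsilon>(1) D] by blast
  obtain M :: real where M: "M > 0"
    "\<forall>g e C \<kappa> \<beta> \<xi>. (\<forall>\<xi>. 0 \<le> g \<xi> \<and> g \<xi> \<le> C * (1 + \<bar>\<xi>\<bar>) powr (-2)) \<longrightarrow> 0 \<le> \<kappa> \<longrightarrow>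
       (\<forall>l. 0 \<le> e l \<and> e l \<le> \<kappa> * (1 + real l) powr (-\<beta>)) \<longrightarrow> 0 \<le> \<beta> \<longrightarrow> \<beta> \<le> 2 \<longrightarrow>
       summable (\<lambda>l. e l * ((g (\<xi> - real l) + g (\<xi> + real l)) / 2)) \<and>
       (\<Sum>l. e l * ((g (\<xi> - real l) + g (\<xi> + real l)) / 2)) \<le> M * C * \<kappa> * (1 + \<bar>\<xi>\<bar>) powr (-\<beta>)"
    by (rule convolution_decay)
  have ct: "0 \<le> cos_transform \<psi> \<xi> \<and> cos_transform \<psi> \<xi> \<le> C * (1 + \<bar>\<xi>\<bar>) powr (-2)" for \<xi>
    using \<psi> by (auto simp: bump_def)
  have C: "C \<ge> 0" using ct[of 0] by simp
  have "((\<lambda>n. real n powr (- \<epsilon> / 2)) \<longlongrightarrow> 0) sequentially"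
    by (rule tendsto_neg_powr[OF _ filterlim_real_sequentially]) (use \<epsilon> in auto)
  then have "((\<lambda>n. M * C * (4 * (K * real n powr (- \<epsilon> / 2)))) \<longlongrightarrow> M * C * (4 * (K * 0))) sequentially"
    by (intro tendsto_mult_left)
  then have "eventually (\<lambda>n. M * C * (4 * (K * real n powr (- \<epsilon> / 2))) < \<eta>) sequentially"
    using order_tendstoD(2)[of _ "M * C * (4 * (K * 0))" sequentially \<eta>] \<eta> by simp
  then obtain N where N: "\<And>n. n \<ge> N \<Longrightarrow> M * C * (4 * (K * real n powr (- \<epsilon> / 2))) < \<eta>"
    by (auto simp: eventually_at_top_linorder)
  show ?thesis
  proof (intro exI[of _ N] allI impI)
    fix n assume n: "n \<ge> N" "n > 0"
    define \<delta> where "\<delta> = 1 / (4 * scale s D n)"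
    have sc: "scale s D n > 1" "2 * real D * real n * \<delta> \<le> 1/2"
      using scale_gt_1[OF s D n(2)] by (simp_all add: \<delta>_def)
    then have \<delta>: "\<delta> > 0" by (simp add: \<delta>_def)
    define e where "e = comb_coeff D n \<delta>"
    define e' where "e' l = (if l = 0 then 0 else e l)" for l
    define \<psi>' where "\<psi>' x = \<psi> x * comb D n \<delta> x" for x
    define h where "h \<xi> l = (cos_transform \<psi> (\<xi> - real l) + cos_transform \<psi> (\<xi> + real l)) / 2" for \<xi> l
    have h0: "h \<xi> l \<ge> 0" "h \<xi> 0 = cos_transform \<psi> \<xi>" for \<xi> l using ct by (auto simp: h_def)
    have e0: "e l \<ge> 0" "e 0 = 1" for l using n by (auto simp: e_def comb_coeff_nonneg comb_coeff_0)
    have esum: "summable e"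
      by (rule summable_comparison_test'[OF summable_fejer_coeff[OF \<delta>], of 0])
         (auto simp: e_def comb_coeff_nonneg comb_coeff_le_fejer)
    have ser: "(\<lambda>l. e l * h \<xi> l) sums cos_transform \<psi>' \<xi>" for \<xi>
      unfolding h_def \<psi>'_def using comb_sums[OF D n(2) \<delta> sc(2)]
      by (intro cos_transform_times_series bump_integrable[OF \<psi>] esum e0) (auto simp: e_def)
    have ser': "(\<lambda>l. e' l * h \<xi> l) sums (cos_transform \<psi>' \<xi> - cos_transform \<psi> \<xi>)" for \<xi>
    proof -
      have "(\<lambda>l. e l * h \<xi> l - (if l = 0 then cos_transform \<psi> \<xi> else 0)) sums (cos_transform \<psi>' \<xi> - cos_transform \<psi> \<xi>)"
        by (intro sums_diff ser sums_single)
      then show ?thesis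
        by (rule sums_cong[THEN iffD1, rotated]) (auto simp: e'_def h0 e0)
    qed
    \<comment> \<open>The factor 4 bounds \<open>2 powr (s/2 - \<epsilon>)\<close>, the price of
      passing from \<open>l\<close> to \<open>1 + l\<close>.\<close>
    have e'_le: "0 \<le> e' l \<and> e' l \<le> (4 * (K * real n powr (- \<epsilon> / 2))) * (1 + real l) powr (-(s / 2 - \<epsilon>))" for l
    proof (cases "l = 0")
      case False
      then have l: "l > 0" by simp
      have "real l powr (- s / 2 + \<epsilon>) \<le> ((1 + real l) / 2) powr (- s / 2 + \<epsilon>)"
        using l \<epsilon> by (intro powr_mono2') auto
      also have "\<dots> = (1 + real l) powr (-(s / 2 - \<epsilon>)) * 2 powr (s / 2 - \<epsilon>)"
      proof -
        have "(y / 2) powr (- b) = y powr (- b) * 2 powr b" if "y \<ge> 0" for y b :: real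
          using that by (simp add: powr_divide powr_minus_divide)
        from this[of "1 + real l" "s / 2 - \<epsilon>"] show ?thesis by simp
      qed
      also have "\<dots> \<le> (1 + real l) powr (-(s / 2 - \<epsilon>)) * 2 powr 2"
        using s \<epsilon> by (intro mult_left_mono powr_mono) auto
      finally have "real l powr (- s / 2 + \<epsilon>) \<le> 4 * (1 + real l) powr (-(s / 2 - \<epsilon>))"
        by (simp add: powr_numeral)
      then have "K * real n powr (- \<epsilon> / 2) * real l powr (- s / 2 + \<epsilon>)
          \<le> K * real n powr (- \<epsilon> / 2) * (4 * (1 + real l) powr (-(s / 2 - \<epsilon>)))"
        using K(1) by (intro mult_left_mono) auto
      moreover have "e' l \<le> K * real n powr (- \<epsilon> / 2) * real l powr (- s / 2 + \<epsilon>)"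
        using K(2)[OF n(2) l] False by (simp add: e'_def e_def \<delta>_def)
      moreover have "0 \<le> e' l" using e0 by (simp add: e'_def)
      ultimately show ?thesis by (simp add: mult_ac)
    qed (use K in \<open>simp add: e'_def\<close>)
    have upper: "cos_transform \<psi>' \<xi> \<le> cos_transform \<psi> \<xi> + \<eta> * (1 + \<bar>\<xi>\<bar>) powr (- s / 2 + \<epsilon>)" for \<xi>
    proof -
      have "(\<Sum>l. e' l * h \<xi> l) \<le> M * C * (4 * (K * real n powr (- \<epsilon> / 2))) * (1 + \<bar>\<xi>\<bar>) powr (-(s / 2 - \<epsilon>))"
        unfolding h_def using ct e'_le K(1) s \<epsilon>
        by (intro M(2)[rule_format, where g = "cos_transform \<psi>" and e = e', THEN conjunct2]) auto
      also have "\<dots> \<le> \<eta> * (1 + \<bar>\<xi>\<bar>) powr (-(s / 2 - \<epsilon>))"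
        using N[OF n(1)] by (intro mult_right_mono) auto
      finally show ?thesis using sums_unique[OF ser'[of \<xi>]] by simp
    qed
    have lower: "cos_transform \<psi> \<xi> \<le> cos_transform \<psi>' \<xi>" for \<xi>
    proof -
      have "0 \<le> (\<Sum>l. e' l * h \<xi> l)"
        using e'_le h0 by (intro suminf_nonneg sums_summable[OF ser'] mult_nonneg_nonneg) auto
      then show ?thesis using sums_unique[OF ser'[of \<xi>]] by simp
    qed
    \<comment> \<open>The first summand serves \<open>l > 0\<close>, where
      \<open>1 + l \<le> 2 * l\<close>; the 1 covers \<open>e 0 = 1\<close>. That
      \<open>\<kappa>\<close> blows up with \<open>n\<close> is harmless, since only some constant
      is wanted for the new bump.\<close>
    define \<kappa> where "\<kappa> = 8 / \<delta>\<^sup>2 + 1"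
    have \<kappa>: "\<kappa> \<ge> 1" using \<delta> by (simp add: \<kappa>_def)
    have e_le: "0 \<le> e l \<and> e l \<le> \<kappa> * (1 + real l) powr (-2)" for l
    proof (cases "l = 0")
      case False
      then have l: "l > 0" by simp
      have "e l \<le> 2 / (\<delta> * real l)\<^sup>2"
        using comb_coeff_le_fejer[of D n \<delta> l] fejer_coeff_le(2)[OF \<delta> l] by (simp add: e_def)
      also have "\<dots> \<le> 2 / (\<delta> * ((1 + real l) / 2))\<^sup>2"
        using l \<delta> by (intro divide_left_mono power_mono mult_left_mono) auto
      also have "\<dots> = 8 / \<delta>\<^sup>2 * (1 + real l) powr (-2)"
        by (simp add: powr_minus_divide powr_numeral power_mult_distrib power_divide)
      also have "\<dots> \<le> \<kappa> * (1 + real l) powr (-2)"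
        unfolding \<kappa>_def by (intro mult_right_mono) auto
      finally show ?thesis using e0 by simp
    qed (use \<kappa> e0 in simp)
    have "cos_transform \<psi>' \<xi> \<le> M * C * \<kappa> * (1 + \<bar>\<xi>\<bar>) powr (-2)" for \<xi>
    proof -
      have "(\<Sum>l. e l * h \<xi> l) \<le> M * C * \<kappa> * (1 + \<bar>\<xi>\<bar>) powr (-2)"
        unfolding h_def using ct e_le \<kappa>
        by (intro M(2)[rule_format, where g = "cos_transform \<psi>" and e = e, THEN conjunct2]) auto
      then show ?thesis using sums_unique[OF ser[of \<xi>]] by simp
    qed
    moreover have "0 \<le> cos_transform \<psi>' \<xi>" for \<xi> using lower[of \<xi>] ct[of \<xi>] by linarith
    ultimately have "bump (M * C * \<kappa>) \<psi>'"
      using \<psi> \<delta> unfolding bump_def \<psi>'_def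
      by (auto intro!: continuous_on_mult continuous_on_comb mult_nonneg_nonneg comb_nonneg simp: comb_minus)
    then show "(\<exists>C'. bump C' (\<lambda>x. \<psi> x * comb D n (1 / (4 * scale s D n)) x)) \<and>
      (\<forall>\<xi>. cos_transform \<psi> \<xi> \<le> cos_transform (\<lambda>x. \<psi> x * comb D n (1 / (4 * scale s D n)) x) \<xi> \<and>
         cos_transform (\<lambda>x. \<psi> x * comb D n (1 / (4 * scale s D n)) x) \<xi>
           \<le> cos_transform \<psi> \<xi> + \<eta> * (1 + \<bar>\<xi>\<bar>) powr (- s / 2 + \<epsilon>))"
      using lower upper unfolding \<psi>'_def \<delta>_def by blast
  qed
qed

section \<open>A tent whose transform is positive at all integers\<close>

lemma cos_transform_tent:
  fixes a :: real
  assumes a: "a > 0"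
  defines "\<psi> \<equiv> \<lambda>x. max 0 (1 - \<bar>x\<bar> / a) / a"
  shows "cos_transform \<psi> \<xi> = sinc_sq (pi * a * \<xi>)"
proof -
  let ?f = "\<lambda>x. \<psi> x * cos (2 * pi * (x * \<xi>))"
  have \<psi>0: "\<psi> x = 0" if "\<bar>x\<bar> > a" for x using a that by (auto simp: \<psi>_def max_def field_simps)
  have c: "continuous_on S \<psi>" for S unfolding \<psi>_def using a by (intro continuous_intros) auto
  have "((\<lambda>x. (1 - x / a) / a * cos ((2 * pi * \<xi>) * x)) has_integral sinc_sq (a * (2 * pi * \<xi>) / 2) / 2) {0..a}"
    by (rule has_integral_triangle_cos[OF a])
  then have r: "(?f has_integral sinc_sq (pi * a * \<xi>) / 2) {0..a}"
    by (rule has_integral_eq_rhs[OF has_integral_eq[rotated]])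
       (use a in \<open>auto simp: \<psi>_def mult_ac max_def field_simps\<close>)
  then have "((\<lambda>x. ?f (- x)) has_integral sinc_sq (pi * a * \<xi>) / 2) {-a..-0}"
    by (subst has_integral_reflect_real)
  then have l: "(?f has_integral sinc_sq (pi * a * \<xi>) / 2) {-a..0}" by (simp add: \<psi>_def)
  have "(?f has_integral (sinc_sq (pi * a * \<xi>) / 2 + sinc_sq (pi * a * \<xi>) / 2)) {-a..a}"
    by (rule has_integral_combine[OF _ _ l r]) (use a in auto)
  then have "(?f has_integral sinc_sq (pi * a * \<xi>)) {-a..a}" by simp
  then have 1: "(?f has_integral sinc_sq (pi * a * \<xi>)) UNIV"
    by (rule has_integral_on_superset) (auto simp: \<psi>0)
  have "set_integrable lborel {-a..a} ?f"
    by (intro borel_integrable_atLeastAtMost' continuous_intros c)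
  moreover have "indicator {-a..a} x *\<^sub>R ?f x = ?f x" for x
    using \<psi>0[of x] by (cases "\<bar>x\<bar> > a") (auto simp: indicator_def)
  ultimately have "integrable lborel ?f" by (simp only: set_integrable_def)
  then have "(?f has_integral integral\<^sup>L lborel ?f) UNIV" by (rule has_integral_integral_lborel)
  then show ?thesis using 1 has_integral_unique unfolding cos_transform_def by blast
qed

text \<open>The transform of the tent of half-width \<open>a\<close> vanishes exactly at the nonzero
  integer multiples of \<open>1/a\<close>; for irrational \<open>a\<close> none of these is an
  integer.\<close>

lemma bump_positive_exists:
  obtains C \<psi> where "bump C \<psi>" "cos_transform \<psi> 0 = 1" "\<And>k::int. cos_transform \<psi> (of_int k) > 0"
proof -
  have "uncountable ({0<..<1/4::real} - \<rat>)"
    by (intro uncountable_minus_countable countable_rat) (simp add: uncountable_open_interval)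
  then obtain a :: real where a: "0 < a" "a < 1/4" "a \<notin> \<rat>"
    using uncountable_infinite infinite_imp_nonempty by (metis DiffE ex_in_conv greaterThanLessThan_iff)
  define \<psi> where "\<psi> x = max 0 (1 - \<bar>x\<bar> / a) / a" for x
  have ct: "cos_transform \<psi> \<xi> = sinc_sq (pi * a * \<xi>)" for \<xi>
    unfolding \<psi>_def using cos_transform_tent[OF a(1)] .
  have pos: "cos_transform \<psi> (of_int k) > 0" for k
  proof (cases "k = 0")
    case False
    have "sin (pi * a * of_int k) \<noteq> 0"
    proof
      assume "sin (pi * a * of_int k) = 0"
      then obtain i :: int where "pi * a * of_int k = of_int i * pi" by (auto simp: sin_zero_iff_int2)
      then have "a = of_int i / of_int k" using False by (simp add: field_simps)
      then show False using a(3) by (metis Rats_divide Rats_of_int)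
    qed
    then show ?thesis using False a unfolding ct by (simp add: sinc_sq_def)
  qed (simp add: ct)
  have "sinc_sq (pi * a * \<xi>) \<le> 4 / a\<^sup>2 * (1 + \<bar>\<xi>\<bar>) powr (-2)" for \<xi>
  proof (cases "\<bar>\<xi>\<bar> \<le> 1")
    case True
    have "a\<^sup>2 * (1 + \<bar>\<xi>\<bar>)\<^sup>2 \<le> 1 * 2\<^sup>2"
      using True a by (intro mult_mono power_mono power_le_one) auto
    then have "1 \<le> 4 / a\<^sup>2 * (1 + \<bar>\<xi>\<bar>) powr (-2)"
      using a by (simp add: powr_minus_divide powr_numeral field_simps)
    then show ?thesis using sinc_sq_le_1[of "pi * a * \<xi>"] by linarith
  next
    case False
    have "\<bar>a * ((1 + \<bar>\<xi>\<bar>) / 2)\<bar> \<le> \<bar>pi * a * \<xi>\<bar>"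
    proof -
      have "a * ((1 + \<bar>\<xi>\<bar>) / 2) \<le> a * (pi * \<bar>\<xi>\<bar>)"
        using False a pi_gt3 mult_right_mono[of 1 pi "\<bar>\<xi>\<bar>"] by (intro mult_left_mono) auto
      then show ?thesis using a by (simp add: abs_mult mult_ac)
    qed
    then have "(a * ((1 + \<bar>\<xi>\<bar>) / 2))\<^sup>2 \<le> (pi * a * \<xi>)\<^sup>2" by (simp only: abs_le_square_iff)
    moreover have "(a * ((1 + \<bar>\<xi>\<bar>) / 2))\<^sup>2 > 0"
    proof -
      have "1 + \<bar>\<xi>\<bar> > 0" by linarith
      then show ?thesis using a by simp
    qed
    ultimately have "1 / (pi * a * \<xi>)\<^sup>2 \<le> 1 / (a * ((1 + \<bar>\<xi>\<bar>) / 2))\<^sup>2"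
      using frac_le[of 1 1 "(a * ((1 + \<bar>\<xi>\<bar>) / 2))\<^sup>2" "(pi * a * \<xi>)\<^sup>2"] by simp
    also have "\<dots> = 4 / a\<^sup>2 * (1 + \<bar>\<xi>\<bar>) powr (-2)"
      by (simp add: powr_minus_divide powr_numeral power_mult_distrib power_divide)
    finally show ?thesis using sinc_sq_le_inverse_square[of "pi * a * \<xi>"] False a by force
  qed
  moreover have "continuous_on UNIV \<psi>" unfolding \<psi>_def using a by (intro continuous_intros) auto
  ultimately have "bump (4 / a\<^sup>2) \<psi>"
    using a unfolding bump_def ct by (auto simp: \<psi>_def max_def field_simps)
  then show ?thesis using that pos by (simp add: ct)
qed

section \<open>The stages of the construction\<close>

text \<open>With \<open>q = scale s D n\<close>, tents of half-width \<open>1 / (4 * q)\<close>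
  leave a margin for shifts of size up to \<open>1 / (2 * q)\<close> inside the
  \<open>1/q\<close>-neighbourhood of the fractions.\<close>

definition next_bump :: "real \<Rightarrow> (real \<Rightarrow> real) \<Rightarrow> nat \<Rightarrow> nat \<Rightarrow> real \<Rightarrow> real" where
  "next_bump s \<psi> D n x = \<psi> x * comb D n (1 / (4 * scale s D n)) x"

text \<open>In a stage \<open>(\<psi>, D, n)\<close> the function \<open>\<psi>\<close> does not yet contain the comb with parameters \<open>D, n\<close>.\<close>
definition good_stage :: "real \<Rightarrow> nat \<Rightarrow> (real \<Rightarrow> real) \<times> nat \<times> nat \<Rightarrow> bool" where
  "good_stage s i = (\<lambda>(\<psi>, D, n). (\<exists>C. bump C \<psi>) \<and> (\<exists>C. bump C (next_bump s \<psi> D n)) \<and> 4 \<le> D \<and> 0 < n \<and>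
     (\<forall>\<xi>. cos_transform \<psi> \<xi> \<le> cos_transform (next_bump s \<psi> D n) \<xi> \<and>
        cos_transform (next_bump s \<psi> D n) \<xi>
          \<le> cos_transform \<psi> \<xi> + (1/2) ^ Suc i * (1 + \<bar>\<xi>\<bar>) powr (- s / 2 + s / (2 * (real i + 1)))))"

text \<open>\<open>D'\<close> is a multiple of \<open>D\<close>, so old shifts are multiples of
  \<open>1/D'\<close>; it is at least twice the old scale, so new shifts are negligible there. The
  exponent has \<open>Suc i\<close> because stage \<open>i\<close> supplies member
  \<open>i + 1\<close> of the final sequence.\<close>

definition stage_step :: "real \<Rightarrow> nat \<Rightarrow> (real \<Rightarrow> real) \<times> nat \<times> nat \<Rightarrow> (real \<Rightarrow> real) \<times> nat \<times> nat \<Rightarrow> bool" where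
  "stage_step s i = (\<lambda>(\<psi>, D, n) (\<psi>', D', n'). \<psi>' = next_bump s \<psi> D n \<and>
     D' = D * nat \<lceil>2 * scale s D n\<rceil> \<and> scale s D n ^ (10 * Suc i) \<le> scale s D' n')"

text \<open>All large \<open>n\<close> satisfy the transform bounds, and
  \<open>n \<le> scale s D n\<close>, so taking \<open>n\<close> beyond \<open>B\<close> as well
  yields the growth of the sequence.\<close>

lemma good_stage_exists:
  assumes s: "0 < s" "s \<le> 1" and \<psi>: "bump C \<psi>" and D: "4 \<le> D"
  shows "\<exists>n. good_stage s i (\<psi>, D, n) \<and> B \<le> scale s D n"
proof -
  have "\<exists>N. \<forall>n\<ge>N. n > 0 \<longrightarrow> (\<exists>C'. bump C' (\<lambda>x. \<psi> x * comb D n (1 / (4 * scale s D n)) x)) \<and>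
    (\<forall>\<xi>. cos_transform \<psi> \<xi> \<le> cos_transform (\<lambda>x. \<psi> x * comb D n (1 / (4 * scale s D n)) x) \<xi> \<and>
       cos_transform (\<lambda>x. \<psi> x * comb D n (1 / (4 * scale s D n)) x) \<xi>
         \<le> cos_transform \<psi> \<xi> + (1/2) ^ Suc i * (1 + \<bar>\<xi>\<bar>) powr (- s / 2 + s / (2 * (real i + 1))))"
    using D s by (intro bump_times_comb[OF \<psi> s]) (auto simp: field_simps)
  then obtain N where N: "\<And>n. n \<ge> N \<Longrightarrow> n > 0 \<Longrightarrow> (\<exists>C'. bump C' (next_bump s \<psi> D n)) \<and>
    (\<forall>\<xi>. cos_transform \<psi> \<xi> \<le> cos_transform (next_bump s \<psi> D n) \<xi> \<and>
       cos_transform (next_bump s \<psi> D n) \<xi>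
         \<le> cos_transform \<psi> \<xi> + (1/2) ^ Suc i * (1 + \<bar>\<xi>\<bar>) powr (- s / 2 + s / (2 * (real i + 1))))"
    unfolding next_bump_def by blast
  define n where "n = max (max N 1) (nat \<lceil>B\<rceil>)"
  have n: "n \<ge> N" "n > 0" "B \<le> real n" unfolding n_def by linarith+
  have "real n \<le> scale s D n" using D n s by (intro scale_gt_1) auto
  then have "good_stage s i (\<psi>, D, n)" "B \<le> scale s D n"
    using N[OF n(1,2)] D n \<psi> unfolding good_stage_def by auto
  then show ?thesis by blast
qed

text \<open>Stages are numbered from 0, and \<open>\<psi> i\<close> contains exactly the combs of
  the stages below \<open>i\<close>.\<close>

locale bump_stages =
  fixes s :: real and \<psi> :: "nat \<Rightarrow> real \<Rightarrow> real" and D n :: "nat \<Rightarrow> nat"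
  assumes s: "0 < s" "s \<le> 1"
    and bump_stage: "\<And>i. \<exists>C. bump C (\<psi> i)"
    and D_ge: "\<And>i. 4 \<le> D i" and n_pos: "\<And>i. 0 < n i"
    and stage_Suc: "\<And>i. \<psi> (Suc i) = next_bump s (\<psi> i) (D i) (n i)"
    and D_Suc: "\<And>i. D (Suc i) = D i * nat \<lceil>2 * scale s (D i) (n i)\<rceil>"
    and rapid: "\<And>i. scale s (D i) (n i) ^ (10 * Suc i) \<le> scale s (D (Suc i)) (n (Suc i))"
    and transform_mono: "\<And>i \<xi>. cos_transform (\<psi> i) \<xi> \<le> cos_transform (\<psi> (Suc i)) \<xi>"
    and transform_Suc_le: "\<And>i \<xi>. cos_transform (\<psi> (Suc i)) \<xi> \<le> cos_transform (\<psi> i) \<xi>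
        + (1/2) ^ Suc i * (1 + \<bar>\<xi>\<bar>) powr (- s / 2 + s / (2 * (real i + 1)))"
    and transform_0: "cos_transform (\<psi> 0) 0 = 1" "\<And>k::int. cos_transform (\<psi> 0) (of_int k) > 0"

lemma stages_exist:
  fixes s :: real
  assumes s: "0 < s" "s \<le> 1"
  obtains \<psi> D n where "bump_stages s \<psi> D n"
proof -
  obtain C \<psi>0 where \<psi>0: "bump C \<psi>0" "cos_transform \<psi>0 0 = 1" "\<And>k::int. cos_transform \<psi>0 (of_int k) > 0"
    using bump_positive_exists by blast
  \<comment> \<open>Starting with \<open>D = 4\<close> bounds every later shift \<open>1/D\<close>
    by 1/4.\<close>
  obtain n0 where n0: "good_stage s 0 (\<psi>0, 4, n0)"
    using good_stage_exists[OF s \<psi>0(1), of 4 0 0] by auto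
  have "\<exists>y. good_stage s (Suc i) y \<and> stage_step s i x y" if good: "good_stage s i x" for x i
  proof -
    obtain \<psi> D n where x: "x = (\<psi>, D, n)" by (cases x)
    obtain C where C: "bump C (next_bump s \<psi> D n)" and D: "4 \<le> D" "0 < n"
      using good unfolding x good_stage_def split_conv by blast
    have "scale s D n > 1" using s D by (intro scale_gt_1) auto
    then have "1 \<le> nat \<lceil>2 * scale s D n\<rceil>" by linarith
    then have "4 * 1 \<le> D * nat \<lceil>2 * scale s D n\<rceil>" using D by (intro mult_le_mono)
    then have "4 \<le> D * nat \<lceil>2 * scale s D n\<rceil>" by simp
    from good_stage_exists[OF s C this, of "Suc i" "scale s D n ^ (10 * Suc i)"]
    show ?thesis unfolding x stage_step_def by force
  qed
  then have "\<exists>f. \<forall>i. (good_stage s i (f i) \<and> (i = 0 \<longrightarrow> f i = (\<psi>0, 4, n0))) \<and> stage_step s i (f i) (f (Suc i))"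
    using n0 by (intro dependent_nat_choice) auto
  then obtain f where f: "\<And>i. good_stage s i (f i)" "f 0 = (\<psi>0, 4, n0)" "\<And>i. stage_step s i (f i) (f (Suc i))"
    by blast
  note gs = f(1)[unfolded good_stage_def split_beta] and ss = f(3)[unfolded stage_step_def split_beta]
  show ?thesis
  proof (rule that[of "\<lambda>i. fst (f i)" "\<lambda>i. fst (snd (f i))" "\<lambda>i. snd (snd (f i))"], rule bump_stages.intro)
    show "0 < s" "s \<le> 1" by fact+
    show "cos_transform (fst (f 0)) 0 = 1" "\<And>k::int. cos_transform (fst (f 0)) (of_int k) > 0"
      using \<psi>0 f(2) by auto
  next
    fix i \<xi>
    have Suc_eq: "fst (f (Suc i)) = next_bump s (fst (f i)) (fst (snd (f i))) (snd (snd (f i)))"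
      using ss by blast
    show "cos_transform (fst (f i)) \<xi> \<le> cos_transform (fst (f (Suc i))) \<xi>"
      "cos_transform (fst (f (Suc i))) \<xi> \<le> cos_transform (fst (f i)) \<xi>
        + (1/2) ^ Suc i * (1 + \<bar>\<xi>\<bar>) powr (- s / 2 + s / (2 * (real i + 1)))"
      unfolding Suc_eq using gs by blast+
  qed (use gs ss in blast)+
qed

section \<open>The limit measure\<close>

text \<open>The bounded continuous function \<open>min 1 (infdist x A)\<close> vanishes exactly on
  \<open>A\<close>; weak convergence transfers its vanishing integral to the limit.\<close>

lemma weak_limit_AE_closed:
  assumes M: "\<And>n. real_distribution (M n)" and N: "real_distribution N" and w: "weak_conv_m M N"
    and A: "closed A" "A \<noteq> {}" and ev: "eventually (\<lambda>n. AE x in M n. x \<in> A) sequentially"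
  shows "AE x in N. x \<in> A"
proof -
  interpret N: real_distribution N by fact
  define g where "g x = min 1 (infdist x A)" for x
  have g_cont: "isCont g x" for x
    unfolding g_def by (intro continuous_intros)
  have g_bdd: "norm (g x) \<le> 1" for x using infdist_nonneg[of x A] by (auto simp: g_def)
  have [measurable]: "g \<in> borel_measurable borel"
    using g_cont by (intro borel_measurable_continuous_onI) (simp add: continuous_on_eq_continuous_at)
  have "(\<lambda>n. integral\<^sup>L (M n) g) \<longlonglongrightarrow> integral\<^sup>L N g"
    using M N w g_cont g_bdd by (rule weak_conv_imp_integral_bdd_continuous_conv)
  moreover have "eventually (\<lambda>n. integral\<^sup>L (M n) g = 0) sequentially"
    using ev
  proof eventually_elim
    case (elim n)
    interpret M: real_distribution "M n" by fact
    have "integral\<^sup>L (M n) g = integral\<^sup>L (M n) (\<lambda>x. 0)"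
      using elim by (intro integral_cong_AE) (auto simp: g_def)
    then show ?case by simp
  qed
  ultimately have "integral\<^sup>L N g = 0"
    by (rule LIMSEQ_unique[OF _ tendsto_eventually])
  moreover have "integrable N g"
    using g_bdd by (intro N.integrable_const_bound[of _ 1]) auto
  moreover have "\<And>x. 0 \<le> g x" using infdist_nonneg by (auto simp: g_def)
  ultimately have "AE x in N. g x = 0"
    by (subst (asm) integral_nonneg_eq_0_iff_AE) auto
  then show ?thesis
  proof eventually_elim
    case (elim x)
    then have "infdist x A = 0" by (auto simp: g_def min_def split: if_splits)
    then show ?case using A by (simp add: in_closed_iff_infdist_zero)
  qed
qed

context bump_stages
begin

definition q :: "nat \<Rightarrow> real" where "q i = scale s (D i) (n i)"

abbreviation H :: "nat \<Rightarrow> nat \<Rightarrow> nat" where "H i \<equiv> denominator (D i) (n i)"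

text \<open>Contains every point at which the comb of stage \<open>i\<close> is nonzero; the
  non-strict inequality makes it closed, so that the weak limit inherits it.\<close>

definition level :: "nat \<Rightarrow> real set" where
  "level i = (\<Union>j<n i. {x. infdist (real (H i j) * x) \<int> \<le> real (H i j) * (1 / (4 * q i))})"

definition E :: "real set" where
  "E = {-1/4..1/4} \<inter> (\<Inter>i. level i)"

lemma D_pos: "0 < D i" using D_ge[of i] by linarith

lemma q_gt_1: "1 < q i" unfolding q_def by (rule scale_gt_1) (use s D_pos n_pos in auto)

lemma closed_level: "closed (level i)"
  unfolding level_def
  by (intro closed_UN finite_lessThan ballI closed_Collect_le continuous_intros)

lemma compact_E: "compact E"
  unfolding E_def by (intro compact_Int_closed closed_INT ballI closed_level) auto

lemma bump_stage_facts:
  shows "continuous_on UNIV (\<psi> i)" "0 \<le> \<psi> i x" "\<psi> i (- x) = \<psi> i x" "\<bar>x\<bar> > 1/4 \<Longrightarrow> \<psi> i x = 0"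
    "0 \<le> cos_transform (\<psi> i) \<xi>"
  using bump_stage[of i] by (auto simp: bump_def)

lemma stage_zero_outside_level: "i < j \<Longrightarrow> x \<notin> level i \<Longrightarrow> \<psi> j x = 0"
proof (induction j)
  case (Suc j)
  show ?case
  proof (cases "i = j")
    case True
    have "comb (D i) (n i) (1 / (4 * q i)) x = 0"
    proof (rule ccontr)
      assume "comb (D i) (n i) (1 / (4 * q i)) x \<noteq> 0"
      then obtain k where "k < n i" "infdist (real (H i k) * x) \<int> \<le> real (H i k) * (1 / (4 * q i))"
        using q_gt_1[of i] by (elim comb_nonzeroD) auto
      then show False using Suc.prems by (auto simp: level_def)
    qed
    then show ?thesis using True by (simp add: stage_Suc next_bump_def q_def)
  next
    case False
    then show ?thesis using Suc by (simp add: stage_Suc next_bump_def)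
  qed
qed simp

lemma transform_mono': "i \<le> j \<Longrightarrow> cos_transform (\<psi> i) \<xi> \<le> cos_transform (\<psi> j) \<xi>"
  using transform_mono lift_Suc_mono_le[of "\<lambda>i. cos_transform (\<psi> i) \<xi>"] by blast

text \<open>From stage \<open>i\<close> on, the losses in the exponent stay below
  \<open>\<epsilon>\<close>, and the weights add up like a geometric series.\<close>

lemma transform_le_tail:
  assumes \<epsilon>: "s / (2 * (real i + 1)) \<le> \<epsilon>"
  shows "cos_transform (\<psi> (i + j)) \<xi> \<le> cos_transform (\<psi> i) \<xi> + (1 - (1/2) ^ j) * (1 + \<bar>\<xi>\<bar>) powr (- s / 2 + \<epsilon>)"
proof (induction j)
  case (Suc j)
  have "s / (2 * (real (i + j) + 1)) \<le> s / (2 * (real i + 1))"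
    using s by (intro divide_left_mono) auto
  then have "(1 + \<bar>\<xi>\<bar>) powr (- s / 2 + s / (2 * (real (i + j) + 1))) \<le> (1 + \<bar>\<xi>\<bar>) powr (- s / 2 + \<epsilon>)"
    using \<epsilon> by (intro powr_mono) auto
  moreover have "(1/2::real) ^ Suc (i + j) \<le> (1/2) ^ Suc j" by (intro power_decreasing) auto
  ultimately have "(1/2) ^ Suc (i + j) * (1 + \<bar>\<xi>\<bar>) powr (- s / 2 + s / (2 * (real (i + j) + 1)))
      \<le> (1/2) ^ Suc j * (1 + \<bar>\<xi>\<bar>) powr (- s / 2 + \<epsilon>)"
    by (intro mult_mono) auto
  then show ?case
    using transform_Suc_le[of "i + j" \<xi>] Suc by (simp add: algebra_simps)
qed simp

text \<open>A stage \<open>i\<close> with loss at most \<open>\<epsilon>\<close> is fixed first. Its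
  bump decays quadratically with a constant \<open>C\<close>, the later stages add at most 1 to that
  constant, and the earlier ones are covered by monotonicity.\<close>

lemma transform_bound:
  assumes "\<epsilon> > 0"
  obtains C where "\<And>j \<xi>. cos_transform (\<psi> j) \<xi> \<le> C * (1 + \<bar>\<xi>\<bar>) powr (- s / 2 + \<epsilon>)"
proof -
  obtain i :: nat where i: "s / (2 * \<epsilon>) < real i" using reals_Archimedean2 by blast
  then have i': "s / (2 * (real i + 1)) \<le> \<epsilon>" using assms by (simp add: field_simps)
  obtain C where C: "bump C (\<psi> i)" using bump_stage by blast
  have C0: "C \<ge> 0"
  proof -
    have "0 \<le> cos_transform (\<psi> i) 0" "cos_transform (\<psi> i) 0 \<le> C * (1 + \<bar>0\<bar>) powr (-2)"
      using C unfolding bump_def by blast+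
    then show ?thesis by simp
  qed
  have "cos_transform (\<psi> j) \<xi> \<le> (C + 1) * (1 + \<bar>\<xi>\<bar>) powr (- s / 2 + \<epsilon>)" for j \<xi>
  proof -
    have "cos_transform (\<psi> j) \<xi> \<le> cos_transform (\<psi> (i + j)) \<xi>" by (rule transform_mono') simp
    also have "\<dots> \<le> cos_transform (\<psi> i) \<xi> + (1 - (1/2) ^ j) * (1 + \<bar>\<xi>\<bar>) powr (- s / 2 + \<epsilon>)"
      by (rule transform_le_tail[OF i'])
    also have "\<dots> \<le> C * (1 + \<bar>\<xi>\<bar>) powr (- s / 2 + \<epsilon>) + 1 * (1 + \<bar>\<xi>\<bar>) powr (- s / 2 + \<epsilon>)"
    proof (intro add_mono mult_right_mono)
      have "cos_transform (\<psi> i) \<xi> \<le> C * (1 + \<bar>\<xi>\<bar>) powr (-2)" using C unfolding bump_def by blast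
      also have "\<dots> \<le> C * (1 + \<bar>\<xi>\<bar>) powr (- s / 2 + \<epsilon>)"
        using C0 s assms by (intro mult_left_mono powr_mono) auto
      finally show "cos_transform (\<psi> i) \<xi> \<le> C * (1 + \<bar>\<xi>\<bar>) powr (- s / 2 + \<epsilon>)" .
    qed auto
    finally show ?thesis by (simp add: algebra_simps)
  qed
  then show ?thesis by (rule that)
qed

definition limit_transform :: "real \<Rightarrow> real" where
  "limit_transform \<xi> = lim (\<lambda>i. cos_transform (\<psi> i) \<xi>)"

lemma limit_transform: "(\<lambda>i. cos_transform (\<psi> i) \<xi>) \<longlonglongrightarrow> limit_transform \<xi>"
proof -
  obtain C where C: "\<And>j \<xi>. cos_transform (\<psi> j) \<xi> \<le> C * (1 + \<bar>\<xi>\<bar>) powr (- s / 2 + 1)"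
    using transform_bound[of 1] by auto
  have "incseq (\<lambda>i. cos_transform (\<psi> i) \<xi>)" by (intro incseq_SucI transform_mono)
  then have "convergent (\<lambda>i. cos_transform (\<psi> i) \<xi>)"
    using C by (elim incseq_convergent[where B = "C * (1 + \<bar>\<xi>\<bar>) powr (- s / 2 + 1)"]) (auto simp: convergent_def)
  then show ?thesis unfolding limit_transform_def by (rule convergent_LIMSEQ_iff[THEN iffD1])
qed

lemma limit_transform_ge: "cos_transform (\<psi> i) \<xi> \<le> limit_transform \<xi>"
  using limit_transform transform_mono' by (intro incseq_le) (auto simp: incseq_def)

lemma limit_transform_bound:
  assumes "\<epsilon> > 0"
  obtains C where "\<And>\<xi>. limit_transform \<xi> \<le> C * (1 + \<bar>\<xi>\<bar>) powr (- s / 2 + \<epsilon>)"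
proof -
  obtain C where "\<And>j \<xi>. cos_transform (\<psi> j) \<xi> \<le> C * (1 + \<bar>\<xi>\<bar>) powr (- s / 2 + \<epsilon>)"
    using transform_bound[OF assms] by blast
  then show ?thesis using that LIMSEQ_le_const2[OF limit_transform] by blast
qed

text \<open>The products are not renormalised from stage to stage, which would spoil the
  monotonicity of their transforms; their masses stay between 1 and
  \<open>limit_transform 0\<close>.\<close>

definition mass :: "nat \<Rightarrow> real" where "mass i = cos_transform (\<psi> i) 0"

lemma mass_ge_1: "1 \<le> mass i"
  using transform_mono'[of 0 i 0] transform_0 by (simp add: mass_def)

definition stage_measure :: "nat \<Rightarrow> real measure" where
  "stage_measure i = density lborel (\<lambda>x. ennreal (\<psi> i x / mass i))"

lemma stage_measurable [measurable]: "\<psi> i \<in> borel_measurable borel"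
  by (intro borel_measurable_continuous_onI bump_stage_facts)

lemma stage_integrable: "integrable lborel (\<psi> i)"
  using bump_stage bump_integrable by blast

lemma real_distribution_stage_measure: "real_distribution (stage_measure i)"
proof -
  have "emeasure (stage_measure i) UNIV = (\<integral>\<^sup>+x. ennreal (\<psi> i x / mass i) \<partial>lborel)"
    by (simp add: stage_measure_def emeasure_density)
  also have "\<dots> = ennreal (integral\<^sup>L lborel (\<lambda>x. \<psi> i x / mass i))"
    using mass_ge_1[of i] bump_stage_facts(2)[of i]
    by (intro nn_integral_eq_integral integrable_divide stage_integrable) (auto intro!: AE_I2 divide_nonneg_nonneg)
  also have "integral\<^sup>L lborel (\<lambda>x. \<psi> i x / mass i) = 1"
    using mass_ge_1[of i] by (simp add: mass_def cos_transform_def)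
  finally have "prob_space (stage_measure i)"
    by (intro prob_spaceI) (simp add: stage_measure_def)
  then show ?thesis
    by (simp add: real_distribution_def real_distribution_axioms_def stage_measure_def)
qed

lemma AE_stage_measure: "(AE x in stage_measure i. P x)" if "\<And>x. \<psi> i x \<noteq> 0 \<Longrightarrow> P x"
  unfolding stage_measure_def using that
  by (subst AE_density) (auto intro!: AE_I2 that)

text \<open>Evenness of \<open>\<psi> i\<close> cancels the sine part; the division by
  \<open>2 * pi\<close> translates between the two conventions for frequencies.\<close>

lemma char_stage_measure: "char (stage_measure i) t = of_real (cos_transform (\<psi> i) (t / (2 * pi)) / mass i)"
proof -
  have m: "mass i > 0" using mass_ge_1[of i] by linarith
  have I: "integrable lborel (\<lambda>x. (\<psi> i x / mass i) *\<^sub>R iexp (t * x))"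
    by (rule Bochner_Integration.integrable_bound[OF integrable_divide[OF stage_integrable, of i "mass i"]])
       (auto simp: norm_mult)
  have "char (stage_measure i) t = integral\<^sup>L lborel (\<lambda>x. (\<psi> i x / mass i) *\<^sub>R iexp (t * x))"
    unfolding char_def stage_measure_def
    using m bump_stage_facts(2) by (subst integral_density) (auto intro!: AE_I2 divide_nonneg_nonneg)
  also have "\<dots> = of_real (cos_transform (\<psi> i) (t / (2 * pi)) / mass i)"
  proof (rule complex_eqI)
    have "Re (integral\<^sup>L lborel (\<lambda>x. (\<psi> i x / mass i) *\<^sub>R iexp (t * x))) = integral\<^sup>L lborel (\<lambda>x. \<psi> i x / mass i * cos (t * x))"
      using I by (subst integral_Re[symmetric]) (auto simp: Re_exp)
    also have "\<dots> = integral\<^sup>L lborel (\<lambda>x. \<psi> i x * cos (t * x) / mass i)" by simp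
    also have "\<dots> = integral\<^sup>L lborel (\<lambda>x. \<psi> i x * cos (t * x)) / mass i"
      by (rule integral_divide_zero)
    finally show "Re (integral\<^sup>L lborel (\<lambda>x. (\<psi> i x / mass i) *\<^sub>R iexp (t * x))) =
        Re (of_real (cos_transform (\<psi> i) (t / (2 * pi)) / mass i))"
      by (simp add: cos_transform_def mult_ac)
    let ?g = "\<lambda>x. \<psi> i x / mass i * sin (t * x)"
    have "integral\<^sup>L lborel ?g = integral\<^sup>L lborel (\<lambda>x. ?g (- x))"
      using lborel_integral_real_affine[of "-1" ?g 0] by simp
    also have "\<dots> = - integral\<^sup>L lborel ?g"
      by (simp add: bump_stage_facts(3))
    finally have "integral\<^sup>L lborel ?g = 0" by linarith
    moreover have "Im (integral\<^sup>L lborel (\<lambda>x. (\<psi> i x / mass i) *\<^sub>R iexp (t * x))) = integral\<^sup>L lborel ?g"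
      using I by (subst integral_Im[symmetric]) (auto simp: Im_exp)
    ultimately show "Im (integral\<^sup>L lborel (\<lambda>x. (\<psi> i x / mass i) *\<^sub>R iexp (t * x))) =
        Im (of_real (cos_transform (\<psi> i) (t / (2 * pi)) / mass i))"
      by simp
  qed
  finally show ?thesis .
qed

text \<open>Common bounded support gives tightness, hence a weakly convergent subsequence. Its
  transform is known because the transforms of all stages already converge, and each closed level
  carries all late stages, hence also \<open>\<nu>\<close>.\<close>

lemma limit_measure_exists:
  obtains \<nu> where "real_distribution \<nu>" "AE x in \<nu>. x \<in> E"
    "\<And>\<xi>. fourier_measure \<nu> \<xi> = of_real (limit_transform \<xi> / limit_transform 0)"
proof -
  have AE_Icc: "AE x in stage_measure i. x \<in> {-1/4..1/4}" for i
  proof (rule AE_stage_measure)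
    fix x assume "\<psi> i x \<noteq> 0"
    then have "\<not> \<bar>x\<bar> > 1/4" using bump_stage_facts(4) by blast
    then show "x \<in> {-1/4..1/4}" by auto
  qed
  have "measure (stage_measure i) {-1<..1} = 1" for i
  proof -
    interpret real_distribution "stage_measure i" by (rule real_distribution_stage_measure)
    have "AE x in stage_measure i. x \<in> {-1<..1}" using AE_Icc[of i] by eventually_elim auto
    then show ?thesis by (subst prob_eq_1) auto
  qed
  then have "tight stage_measure"
    unfolding tight_def
    by (intro conjI allI impI real_distribution_stage_measure exI[of _ "-1"] exI[of _ 1]) simp_all
  then obtain r \<nu> where r: "strict_mono (r :: nat \<Rightarrow> nat)" and \<nu>: "real_distribution \<nu>"
      and w: "weak_conv_m (stage_measure \<circ> id \<circ> r) \<nu>"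
    using tight_imp_convergent_subsubsequence[of stage_measure id] by (auto simp: strict_mono_def)
  have w': "weak_conv_m (\<lambda>i. stage_measure (r i)) \<nu>" using w by (simp add: comp_def)
  have AE_closed: "AE x in \<nu>. x \<in> A"
    if "closed A" "A \<noteq> {}" "eventually (\<lambda>i. AE x in stage_measure (r i). x \<in> A) sequentially" for A
    by (rule weak_limit_AE_closed[OF real_distribution_stage_measure \<nu> w' that])
  have AE1: "AE x in \<nu>. x \<in> {-1/4..1/4}"
    by (rule AE_closed) (use AE_Icc in auto)
  have "AE x in \<nu>. x \<in> level i" for i
  proof (rule AE_closed)
    have "0 \<in> level i" using n_pos[of i] q_gt_1[of i] by (auto simp: level_def)
    then show "level i \<noteq> {}" by blast
    show "eventually (\<lambda>j. AE x in stage_measure (r j). x \<in> level i) sequentially"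
    proof (rule eventually_mono[OF eventually_gt_at_top[of i]])
      fix j assume "i < j"
      then have "i < r j" using seq_suble[OF r, of j] by linarith
      then show "AE x in stage_measure (r j). x \<in> level i"
        using stage_zero_outside_level by (intro AE_stage_measure) blast
    qed
  qed (rule closed_level)
  then have "AE x in \<nu>. \<forall>i. x \<in> level i" by (simp add: AE_all_countable)
  with AE1 have "AE x in \<nu>. x \<in> E" by eventually_elim (auto simp: E_def)
  moreover have "fourier_measure \<nu> \<xi> = of_real (limit_transform \<xi> / limit_transform 0)" for \<xi>
  proof -
    have "(\<lambda>i. char (stage_measure (r i)) (- 2 * pi * \<xi>)) \<longlonglongrightarrow> char \<nu> (- 2 * pi * \<xi>)"
      by (rule levy_continuity1[OF real_distribution_stage_measure \<nu> w'])
    moreover have "(\<lambda>i. char (stage_measure (r i)) (- 2 * pi * \<xi>)) \<longlonglongrightarrow> of_real (limit_transform \<xi> / limit_transform 0)"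
    proof -
      have "(\<lambda>i. of_real (cos_transform (\<psi> i) \<xi> / mass i) :: complex) \<longlonglongrightarrow> of_real (limit_transform \<xi> / limit_transform 0)"
        unfolding mass_def using limit_transform_ge[of 0 0] transform_0
        by (intro tendsto_of_real tendsto_divide limit_transform) auto
      from LIMSEQ_subseq_LIMSEQ[OF this r] show ?thesis
        by (simp add: comp_def char_stage_measure cos_transform_minus)
    qed
    ultimately have "char \<nu> (- 2 * pi * \<xi>) = of_real (limit_transform \<xi> / limit_transform 0)"
      by (rule LIMSEQ_unique)
    then show ?thesis
      by (simp add: fourier_measure_def char_def mult_ac)
  qed
  ultimately show ?thesis using that \<nu> by blast
qed

end

section \<open>Translates of the limit set\<close>

context bump_stages
begin

text \<open>The point 0 is the limit of the others, which makes the set compact, and it will carry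
  the dominant atom of \<open>\<rho>\<close>; the symmetry keeps the transform of
  \<open>\<rho>\<close> real.\<close>

definition shifts :: "real set" where
  "shifts = insert 0 (\<Union>k. {1 / real (D k), - (1 / real (D k))})"

lemma D_dvd: "i \<le> j \<Longrightarrow> D i dvd D j"
  by (induction rule: dec_induct) (auto simp: D_Suc)

lemma D_Suc_ge: "2 * q i \<le> real (D (Suc i))"
proof -
  have "2 * q i \<le> 1 * real (nat \<lceil>2 * q i\<rceil>)" by linarith
  also have "\<dots> \<le> real (D i) * real (nat \<lceil>2 * q i\<rceil>)"
    using D_ge[of i] by (intro mult_right_mono) auto
  finally show ?thesis unfolding D_Suc q_def by simp
qed

lemma D_less_Suc: "D i < D (Suc i)"
proof -
  have "1 < nat \<lceil>2 * q i\<rceil>" using q_gt_1[of i] by linarith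
  then show ?thesis using D_pos[of i] by (simp add: D_Suc q_def)
qed

lemma strict_mono_D: "strict_mono D"
  by (rule strict_monoI_Suc) (rule D_less_Suc)

lemma shift_integral:
  assumes "k \<le> m" "x = 1 / real (D k) \<or> x = - (1 / real (D k))"
  obtains b :: int where "x * real (D m) = of_int b"
proof -
  obtain c where "D m = D k * c" using D_dvd[OF assms(1)] by (auto elim: dvdE)
  then have "x * real (D m) = of_int (int c) \<or> x * real (D m) = of_int (- int c)"
    using assms(2) D_pos[of k] by auto
  then show ?thesis using that by blast
qed

text \<open>At scale \<open>q m\<close>, the shifts from \<open>D k\<close> with
  \<open>k \<le> m\<close> are fractions over \<open>D m\<close>, since \<open>D k\<close> divides
  \<open>D m\<close>; for \<open>k > m\<close> their size is at most
  \<open>1 / D (Suc m) \<le> 1 / (2 * q m)\<close>.\<close>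

lemma shift_cases:
  assumes "x \<in> shifts"
  obtains (integral) b :: int where "x * real (D m) = of_int b" | (small) "\<bar>x\<bar> \<le> 1 / (2 * q m)"
proof -
  consider "x = 0" | k where "x = 1 / real (D k) \<or> x = - (1 / real (D k))"
    using assms by (auto simp: shifts_def)
  then show ?thesis
  proof cases
    case 1
    then show ?thesis using integral[of 0] by simp
  next
    case 2
    show ?thesis
    proof (cases "k \<le> m")
      case True
      then show ?thesis using shift_integral[OF True 2] integral by blast
    next
      case False
      then have "D (Suc m) \<le> D k" by (intro dvd_imp_le[OF D_dvd D_pos]) linarith
      then have "2 * q m \<le> real (D k)" using D_Suc_ge[of m] by linarith
      then have "1 / real (D k) \<le> 1 / (2 * q m)" using q_gt_1[of m] by (intro divide_left_mono) auto
      then show ?thesis using 2 small by auto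
    qed
  qed
qed

lemma shift_eventually_integral:
  assumes "x \<in> shifts"
  obtains k where "\<And>m. k \<le> m \<Longrightarrow> \<exists>b::int. x * real (D m) = of_int b"
proof -
  consider "x = 0" | k where "x = 1 / real (D k) \<or> x = - (1 / real (D k))"
    using assms by (auto simp: shifts_def)
  then show ?thesis
  proof cases
    case 1
    show ?thesis by (rule that[of 0]) (use 1 in \<open>auto intro: exI[of _ 0]\<close>)
  next
    case 2
    show ?thesis by (rule that[of k]) (meson shift_integral[OF _ 2])
  qed
qed

lemma shift_le: "x \<in> shifts \<Longrightarrow> \<bar>x\<bar> \<le> 1/4"
proof -
  have "1 / real (D k) \<le> 1 / 4" for k
    using of_nat_mono[OF D_ge[of k], where 'a = real] by (intro divide_left_mono) auto
  moreover have "0 \<le> 1 / real (D k)" for k by simp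
  moreover assume "x \<in> shifts"
  ultimately show ?thesis by (auto simp: shifts_def)
qed

lemma E_approx:
  assumes "y \<in> E"
  obtains j and a :: int where "j < n m" "\<bar>y - of_int a / real (H m j)\<bar> \<le> 1 / (4 * q m)"
proof -
  obtain j where j: "j < n m" "infdist (real (H m j) * y) \<int> \<le> real (H m j) * (1 / (4 * q m))"
    using assms by (auto simp: E_def level_def)
  obtain a where a: "infdist (real (H m j) * y) \<int> = \<bar>real (H m j) * y - of_int a\<bar>"
    by (rule infdist_Ints_attained)
  have h: "real (H m j) > 0" using denominator_pos by simp
  have "\<bar>real (H m j) * y - of_int a\<bar> = real (H m j) * \<bar>y - of_int a / real (H m j)\<bar>"
  proof -
    have "real (H m j) * y - of_int a = real (H m j) * (y - of_int a / real (H m j))"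
      using h by (simp add: right_diff_distrib)
    then show ?thesis using h by (simp only: abs_mult abs_of_pos)
  qed
  then have "\<bar>y - of_int a / real (H m j)\<bar> \<le> 1 / (4 * q m)"
    using j(2) a h by (metis mult_le_cancel_left_pos)
  then show ?thesis using that j(1) by blast
qed

lemma q_ge: "(2 * real (D m) ^ 2 * real (n m)) ^ 2 \<le> q m"
  unfolding q_def by (rule scale_ge) (use s D_pos n_pos in auto)

lemma H_le: "j < n m \<Longrightarrow> real (H m j) \<le> 2 * real (D m) * real (n m)"
  using of_nat_mono[OF denominator_bounds(2)[OF D_pos]] by fastforce

text \<open>At a stage where both shifts are fractions over \<open>D\<close>, let \<open>u/H\<close>
  and \<open>u'/H'\<close> approximate \<open>y\<close> and \<open>y'\<close>. Then
  \<open>D * H * H'\<close> times \<open>u'/H' - u/H - (x - x')\<close> is an integer of modulus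
  below 1, hence 0. As \<open>D\<close> is coprime to \<open>H\<close> and \<open>H'\<close>, it
  divides \<open>b - b'\<close>; so \<open>x - x'\<close> is an integer, and it has modulus at most
  1/2.\<close>

lemma translates_disjoint:
  assumes "x \<in> shifts" "x' \<in> shifts" "y \<in> E" "y' \<in> E" "y + x = y' + x'"
  shows "x = x'"
proof -
  obtain k where k: "\<And>m. k \<le> m \<Longrightarrow> \<exists>b::int. x * real (D m) = of_int b"
    using shift_eventually_integral[OF assms(1)] by blast
  obtain k' where k': "\<And>m. k' \<le> m \<Longrightarrow> \<exists>b::int. x' * real (D m) = of_int b"
    using shift_eventually_integral[OF assms(2)] by blast
  define m where "m = max k k'"
  obtain b b' :: int where b: "x * real (D m) = of_int b" "x' * real (D m) = of_int b'"
    using k[of m] k'[of m] unfolding m_def by auto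
  obtain j and u :: int where j: "j < n m" and u: "\<bar>y - of_int u / real (H m j)\<bar> \<le> 1 / (4 * q m)"
    by (rule E_approx[OF assms(3)])
  obtain j' and u' :: int where j': "j' < n m" and u': "\<bar>y' - of_int u' / real (H m j')\<bar> \<le> 1 / (4 * q m)"
    by (rule E_approx[OF assms(4)])
  define N where "N = int (D m) * (u' * int (H m j) - u * int (H m j')) - (b - b') * int (H m j) * int (H m j')"
  have h: "real (H m j) > 0" "real (H m j') > 0" "real (D m) > 0"
    using denominator_pos D_pos by auto
  have "of_int N = real (D m) * real (H m j) * real (H m j') *
      (of_int u' / real (H m j') - of_int u / real (H m j) - (x - x'))"
  proof -
    have x_eq: "x = of_int b / real (D m)" "x' = of_int b' / real (D m)"
      using b h by (auto simp: field_simps)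
    show ?thesis unfolding N_def x_eq using h by (simp add: field_simps)
  qed
  also have "of_int u' / real (H m j') - of_int u / real (H m j) - (x - x') =
      (y - of_int u / real (H m j)) - (y' - of_int u' / real (H m j'))"
    using assms(5) by (simp add: algebra_simps)
  finally have "\<bar>of_int N\<bar> = real (D m) * real (H m j) * real (H m j') *
      \<bar>(y - of_int u / real (H m j)) - (y' - of_int u' / real (H m j'))\<bar>"
    using h by (simp add: abs_mult)
  also have "\<dots> \<le> real (D m) * (2 * real (D m) * real (n m)) * (2 * real (D m) * real (n m)) * (1 / (2 * q m))"
  proof (intro mult_mono H_le j j')
    have "\<bar>(y - of_int u / real (H m j)) - (y' - of_int u' / real (H m j'))\<bar> \<le> 1 / (4 * q m) + 1 / (4 * q m)"
      using u u' by linarith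
    then show "\<bar>(y - of_int u / real (H m j)) - (y' - of_int u' / real (H m j'))\<bar> \<le> 1 / (2 * q m)" by simp
  qed auto
  \<comment> \<open>The first three factors multiply to \<open>4 * D^3 * n^2\<close>, at most
    \<open>q\<close> since \<open>q \<ge> 4 * D^4 * n^2\<close>; the whole product is thus at most
    1/2.\<close>
  also have "\<dots> < 1"
  proof -
    have n: "real (n m) > 0" using n_pos by simp
    have "real (D m) * (2 * real (D m) * real (n m)) * (2 * real (D m) * real (n m)) * real (D m)
        = (2 * real (D m) ^ 2 * real (n m)) ^ 2"
      by (simp add: power2_eq_square)
    also have "\<dots> \<le> q m" by (rule q_ge)
    finally have *: "real (D m) * (2 * real (D m) * real (n m)) * (2 * real (D m) * real (n m)) * real (D m) \<le> q m" .
    define P where "P = real (D m) * (2 * real (D m) * real (n m)) * (2 * real (D m) * real (n m))"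
    have "P * 1 \<le> P * real (D m)"
      unfolding P_def using h n D_ge[of m] by (intro mult_left_mono) auto
    then have "P \<le> q m" using * by (simp add: P_def)
    then have "P * (1 / (2 * q m)) < 1" using q_gt_1[of m] by (simp add: field_simps)
    then show ?thesis by (simp only: P_def)
  qed
  finally have "N = 0" by linarith
  then have "int (D m) dvd (b - b') * int (H m j) * int (H m j')"
    unfolding N_def by (metis dvd_triv_left eq_iff_diff_eq_0)
  moreover have "coprime (int (D m)) (int (H m j))" "coprime (int (D m)) (int (H m j'))"
    using coprime_denominator by auto
  ultimately have "int (D m) dvd b - b'"
    by (metis coprime_dvd_mult_left_iff)
  then obtain c where "b - b' = int (D m) * c" by (auto elim: dvdE)
  then have "(x - x') * real (D m) = real (D m) * of_int c"
    using b by (simp add: left_diff_distrib flip: of_int_diff)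
  then have "x - x' = of_int c" using h by simp
  moreover have "\<bar>x - x'\<bar> \<le> 1/2" using shift_le[OF assms(1)] shift_le[OF assms(2)] by linarith
  ultimately have "c = 0" by linarith
  then show ?thesis using \<open>x - x' = of_int c\<close> by simp
qed

text \<open>For an integral shift, \<open>u/H\<close> and \<open>b/D\<close> combine to a fraction
  with denominator \<open>H * D \<le> 2 * D^2 * n = q powr (s/2)\<close>. A small shift keeps the
  denominator \<open>H\<close>, and \<open>1/4 + 1/2 < 1\<close> keeps the point in the
  neighbourhood. The index \<open>i - 1\<close> renumbers stages from 0 as a sequence from
  1.\<close>

lemma translates_well_approximable:
  assumes x: "x \<in> shifts" and y: "y \<in> E"
  shows "y + x \<in> well_approx_set s (\<lambda>i. q (i - 1))"
proof -
  have "\<exists>h. 1 \<le> h \<and> real h \<le> q m powr (s / 2) \<and> y + x \<in> nbhd (1 / q m) (int_over h)" for m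
  proof -
    obtain j and u :: int where j: "j < n m" and u: "\<bar>y - of_int u / real (H m j)\<bar> \<le> 1 / (4 * q m)"
      by (rule E_approx[OF y])
    have h: "real (H m j) > 0" "real (D m) > 0" "H m j > 0" "D m > 0"
      using denominator_pos D_pos by auto
    have qp: "q m powr (s / 2) = 2 * real (D m) ^ 2 * real (n m)"
      unfolding q_def by (rule scale_powr[OF s(1)])
    have HD: "real (H m j * D m) \<le> q m powr (s / 2)"
      using mult_right_mono[OF H_le[OF j], of "real (D m)"] by (simp add: qp power2_eq_square mult_ac)
    show ?thesis
      using x
    proof (cases rule: shift_cases[where m = m])
      case (integral b)
      have xb: "x = of_int b / real (D m)" using integral h by (simp add: field_simps)
      have eq: "of_int (u * int (D m) + b * int (H m j)) / real (H m j * D m) = of_int u / real (H m j) + x"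
        using h by (simp add: xb field_simps)
      have "\<bar>y + x - of_int (u * int (D m) + b * int (H m j)) / real (H m j * D m)\<bar> \<le> 1 / (4 * q m)"
        unfolding eq using u by simp
      also have "\<dots> < 1 / q m" using q_gt_1[of m] by (simp add: field_simps)
      finally have "y + x \<in> nbhd (1 / q m) (int_over (H m j * D m))"
        unfolding nbhd_def int_over_def mem_ball dist_real_def
        by (intro UN_I CollectI exI conjI TrueI) (rule refl, simp only: mem_ball dist_real_def abs_minus_commute)
      moreover have "1 \<le> H m j * D m" using h by (simp add: Suc_le_eq)
      ultimately show ?thesis using HD by blast
    next
      case small
      have "\<bar>y + x - of_int u / real (H m j)\<bar> \<le> 1 / (4 * q m) + 1 / (2 * q m)"
        using u small by linarith
      also have "\<dots> < 1 / q m" using q_gt_1[of m] by (simp add: field_simps)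
      finally have "y + x \<in> nbhd (1 / q m) (int_over (H m j))"
        unfolding nbhd_def int_over_def by (auto simp: dist_real_def abs_minus_commute)
      moreover have "1 \<le> H m j" using h by (simp add: Suc_le_eq)
      moreover have "real (H m j) \<le> real (H m j * D m)" using h by (intro of_nat_mono) auto
      ultimately show ?thesis using HD order.trans by blast
    qed
  qed
  moreover have "y + x \<in> {-1/2..1/2}"
    using y shift_le[OF x] by (auto simp: E_def)
  ultimately show ?thesis unfolding well_approx_set_def by fastforce
qed

lemma compact_shifts: "compact shifts"
proof -
  have inv: "(\<lambda>k. 1 / real (D k)) \<longlonglongrightarrow> 0"
  proof -
    have "(\<lambda>k. 1 / real k) \<longlonglongrightarrow> 0" by (rule lim_1_over_n)
    from LIMSEQ_subseq_LIMSEQ[OF this strict_mono_D] show ?thesis by (simp add: comp_def)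
  qed
  have "compact (insert 0 (range (\<lambda>k. 1 / real (D k))))"
    "compact (insert (- 0) (range (\<lambda>k. - (1 / real (D k)))))"
    by (rule compact_sequence_with_limit inv tendsto_minus)+
  then have "compact (insert 0 (range (\<lambda>k. 1 / real (D k))) \<union> insert (- 0) (range (\<lambda>k. - (1 / real (D k)))))"
    by (rule compact_Un)
  also have "insert 0 (range (\<lambda>k. 1 / real (D k))) \<union> insert (- 0) (range (\<lambda>k. - (1 / real (D k)))) = shifts"
    by (auto simp: shifts_def)
  finally show ?thesis .
qed

lemma infinite_shifts: "infinite shifts"
proof -
  have "inj (\<lambda>k. 1 / real (D k))"
    using strict_mono_D by (auto simp: inj_on_def strict_mono_eq)
  then have "infinite (range (\<lambda>k. 1 / real (D k)))" by (rule range_inj_infinite)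
  moreover have "range (\<lambda>k. 1 / real (D k)) \<subseteq> shifts" by (auto simp: shifts_def)
  ultimately show ?thesis using finite_subset by blast
qed

text \<open>A geometric variable picks a position \<open>k\<close>, a fair sign the direction. Every
  position has positive probability, and the parameter 3/4 gives the shift 0, at
  \<open>k = 0\<close>, more than half of the mass.\<close>

lemma shift_distribution_exists:
  obtains \<rho> :: "real pmf" where "set_pmf \<rho> = shifts" "map_pmf uminus \<rho> = \<rho>" "pmf \<rho> 0 > 1/2"
proof -
  define x where "x k = (if k = 0 then 0 else 1 / real (D (k - 1)))" for k
  define w where "w = geometric_pmf (3/4)"
  define \<rho> where "\<rho> = bind_pmf w (\<lambda>k. pmf_of_set {x k, - x k})"
  have "set_pmf w = UNIV" by (simp add: w_def set_pmf_geometric)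
  then have "set_pmf \<rho> = (\<Union>k. {x k, - x k})" by (simp add: \<rho>_def)
  also have "\<dots> = shifts"
  proof -
    have "x 0 = 0" "x (Suc k) = 1 / real (D k)" for k by (simp_all add: x_def)
    then have "(\<exists>k. z = x k \<or> z = - x k) \<longleftrightarrow> z = 0 \<or> (\<exists>k. z = 1 / real (D k) \<or> z = - (1 / real (D k)))" for z
      by (metis not0_implies_Suc minus_zero)
    then show ?thesis by (auto simp: shifts_def)
  qed
  finally have "set_pmf \<rho> = shifts" .
  moreover have "map_pmf uminus (pmf_of_set {x k, - x k}) = pmf_of_set {x k, - x k}" for k
    by (subst map_pmf_of_set_inj) (auto intro!: arg_cong[of _ _ pmf_of_set])
  then have "map_pmf uminus \<rho> = \<rho>" by (simp add: \<rho>_def map_bind_pmf)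
  moreover have "pmf \<rho> 0 > 1/2"
  proof -
    have "pmf (pmf_of_set {x k, - x k}) 0 = indicator {0} k" for k
      using D_pos by (auto simp: x_def indicator_def)
    then have "pmf \<rho> 0 = measure_pmf.expectation w (indicator {0})"
      by (simp add: \<rho>_def pmf_bind)
    also have "\<dots> = 3/4" by (simp add: w_def measure_pmf_single)
    finally show ?thesis by simp
  qed
  ultimately show ?thesis using that by blast
qed

end

section \<open>Convolution with a discrete measure\<close>

lemma integral_convolution_bounded:
  fixes f :: "real \<Rightarrow> complex"
  assumes M: "finite_measure M" "sets M = sets borel" and N: "finite_measure N" "sets N = sets borel"
    and f: "f \<in> borel_measurable borel" "\<And>x. norm (f x) \<le> B"
  shows "integral\<^sup>L (M \<star> N) f = (LINT x|M. LINT y|N. f (x + y))"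
proof -
  interpret M: finite_measure M by fact
  interpret N: finite_measure N by fact
  interpret P: pair_sigma_finite M N ..
  interpret PF: finite_measure "M \<Otimes>\<^sub>M N" by (rule finite_measure_pair_measure) fact+
  note [measurable_cong] = M(2) N(2)
  note [measurable] = f(1)
  have "integral\<^sup>L (M \<star> N) f = (LINT z|(M \<Otimes>\<^sub>M N). f (case z of (x, y) \<Rightarrow> x + y))"
    unfolding convolution_def by (rule integral_distr) auto
  also have "\<dots> = (LINT z|(M \<Otimes>\<^sub>M N). (case z of (x, y) \<Rightarrow> f (x + y)))"
    by (intro Bochner_Integration.integral_cong) auto
  also have "\<dots> = (LINT x|M. LINT y|N. (case (x, y) of (x, y) \<Rightarrow> f (x + y)))"
  proof (rule P.integral_fst'[symmetric])
    show "integrable (M \<Otimes>\<^sub>M N) (\<lambda>(x, y). f (x + y))"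
      by (rule PF.integrable_const_bound[where B = B]) (use f(2) in \<open>auto simp: split_beta\<close>)
  qed
  finally show ?thesis by simp
qed

lemma fourier_kernel_add:
  "exp (- 2 * pi * \<i> * of_real ((x + y) * \<xi>)) = exp (- 2 * pi * \<i> * of_real (x * \<xi>)) * exp (- 2 * pi * \<i> * of_real (y * \<xi>))"
  by (simp add: exp_add[symmetric] algebra_simps)

lemma fourier_kernel_eq:
  "exp (- 2 * pi * \<i> * of_real (x * \<xi>)) = of_real (cos (2 * pi * (x * \<xi>))) - \<i> * of_real (sin (2 * pi * (x * \<xi>)))"
proof -
  have "- 2 * pi * \<i> * of_real (x * \<xi>) = \<i> * of_real (- (2 * pi * (x * \<xi>)))" by simp
  then show ?thesis by (simp only: cis_conv_exp[symmetric]) (simp add: complex_eq_iff)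
qed

lemma norm_fourier_kernel [simp]: "norm (exp (- 2 * pi * \<i> * of_real (x * \<xi>))) = 1"
proof -
  have "- 2 * pi * \<i> * of_real (x * \<xi>) = \<i> * of_real (- 2 * pi * (x * \<xi>))" by simp
  then show ?thesis by (simp only: norm_exp_i_times)
qed

lemma fourier_measure_convolution:
  assumes M: "finite_measure M" "sets M = sets borel" and N: "finite_measure N" "sets N = sets borel"
  shows "fourier_measure (M \<star> N) \<xi> = fourier_measure M \<xi> * fourier_measure N \<xi>"
  unfolding fourier_measure_def
  by (subst integral_convolution_bounded[OF assms, where B = 1])
     (auto simp only: fourier_kernel_add integral_mult_right_zero integral_mult_left_zero norm_fourier_kernel
       intro!: borel_measurable_continuous_onI continuous_intros)

text \<open>\<open>measure_pmf\<close> carries the power set as its sigma-algebra, whereas the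
  convolution with \<open>\<nu>\<close> is formed over Borel sets.\<close>

definition borel_pmf :: "real pmf \<Rightarrow> real measure" where
  "borel_pmf \<rho> = distr (measure_pmf \<rho>) borel (\<lambda>x. x)"

lemma sets_borel_pmf [simp]: "sets (borel_pmf \<rho>) = sets borel"
  by (simp add: borel_pmf_def)

lemma prob_space_borel_pmf: "prob_space (borel_pmf \<rho>)"
  unfolding borel_pmf_def by (rule measure_pmf.prob_space_distr) auto

lemma integral_borel_pmf:
  fixes f :: "real \<Rightarrow> 'a::{banach, second_countable_topology}"
  assumes "f \<in> borel_measurable borel"
  shows "integral\<^sup>L (borel_pmf \<rho>) f = measure_pmf.expectation \<rho> f"
  unfolding borel_pmf_def by (subst integral_distr) (use assms in auto)

lemma AE_borel_pmf: "(AE x in borel_pmf \<rho>. P x)" if "\<And>x. x \<in> set_pmf \<rho> \<Longrightarrow> P x" "Measurable.pred borel P"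
  unfolding borel_pmf_def by (subst AE_distr_iff) (use that in \<open>auto simp: AE_measure_pmf_iff\<close>)

text \<open>Symmetry cancels the sine part. The cosine is 1 at 0 and at least -1 elsewhere, so the
  atom at 0 outweighs the rest.\<close>

lemma fourier_symmetric_pmf_pos:
  assumes sym: "map_pmf uminus \<rho> = \<rho>" and half: "pmf \<rho> 0 > 1/2"
  obtains a where "0 < a" "a \<le> 1" "fourier_measure (borel_pmf \<rho>) \<xi> = of_real a"
proof -
  define w where "w = 2 * pi * \<xi>"
  have int: "integrable (measure_pmf \<rho>) f" if "\<And>x. norm (f x) \<le> 1" for f :: "real \<Rightarrow> 'b::{banach, second_countable_topology}"
    by (rule measure_pmf.integrable_const_bound[where B = 1]) (use that in auto)
  have "fourier_measure (borel_pmf \<rho>) \<xi> = measure_pmf.expectation \<rho> (\<lambda>x. exp (- 2 * pi * \<i> * of_real (x * \<xi>)))"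
    unfolding fourier_measure_def
    by (rule integral_borel_pmf) (intro borel_measurable_continuous_onI continuous_intros)
  also have "\<dots> = measure_pmf.expectation \<rho> (\<lambda>x. of_real (cos (w * x)) - \<i> * of_real (sin (w * x)))"
    unfolding fourier_kernel_eq by (simp add: w_def mult_ac)
  also have "\<dots> = of_real (measure_pmf.expectation \<rho> (\<lambda>x. cos (w * x))) - \<i> * of_real (measure_pmf.expectation \<rho> (\<lambda>x. sin (w * x)))"
    by (subst Bochner_Integration.integral_diff) (auto intro!: int simp: norm_mult)
  also have "measure_pmf.expectation \<rho> (\<lambda>x. sin (w * x)) = 0"
  proof -
    have "measure_pmf.expectation \<rho> (\<lambda>x. sin (w * x)) = measure_pmf.expectation (map_pmf uminus \<rho>) (\<lambda>x. sin (w * x))"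
      by (simp only: sym)
    also have "\<dots> = - measure_pmf.expectation \<rho> (\<lambda>x. sin (w * x))" by simp
    finally show ?thesis by linarith
  qed
  finally have "fourier_measure (borel_pmf \<rho>) \<xi> = of_real (measure_pmf.expectation \<rho> (\<lambda>x. cos (w * x)))" by simp
  moreover have "measure_pmf.expectation \<rho> (\<lambda>x. cos (w * x)) \<le> 1"
    by (rule measure_pmf.integral_le_const) (auto intro!: int)
  moreover have "0 < measure_pmf.expectation \<rho> (\<lambda>x. cos (w * x))"
  proof -
    have "0 < 2 * pmf \<rho> 0 - 1" using half by simp
    also have "\<dots> = measure_pmf.expectation \<rho> (\<lambda>x. 2 * indicator {0} x - 1)"
      by (subst Bochner_Integration.integral_diff) (auto simp: measure_pmf_single intro!: int)
    also have "\<dots> \<le> measure_pmf.expectation \<rho> (\<lambda>x. cos (w * x))"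
      by (intro integral_mono int) (auto simp: indicator_def)
    finally show ?thesis .
  qed
  ultimately show ?thesis using that by blast
qed

lemma pmf_bounded_below_finite_support:
  assumes c: "c > 0" "\<And>x. x \<in> set_pmf \<rho> \<Longrightarrow> c \<le> pmf \<rho> x"
  shows "finite (set_pmf \<rho>)"
proof (rule ccontr)
  assume "infinite (set_pmf \<rho>)"
  obtain N :: nat where N: "1 / c < real N" using reals_Archimedean2 by blast
  obtain F where F: "finite F" "card F = N" "F \<subseteq> set_pmf \<rho>"
    using infinite_arbitrarily_large[OF \<open>infinite (set_pmf \<rho>)\<close>] by blast
  have "real N * c = (\<Sum>x\<in>F. c)" using F by simp
  also have "\<dots> \<le> (\<Sum>x\<in>F. pmf \<rho> x)" using F c by (intro sum_mono) auto
  also have "\<dots> = measure_pmf.prob \<rho> F" using F by (simp add: measure_measure_pmf_finite)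
  also have "\<dots> \<le> 1" by simp
  finally show False using N c by (simp add: field_simps)
qed

text \<open>By disjointness the indicator of \<open>E + x0\<close> singles out the atom
  \<open>x0\<close>: its squared norm is linear in \<open>pmf \<rho> x0\<close>, but its transform
  is \<open>pmf \<rho> x0\<close> times a phase times that of \<open>\<nu>\<close>, so the frame sum
  is quadratic.\<close>

lemma no_fourier_frame_convolution:
  assumes \<nu>: "prob_space \<nu>" "sets \<nu> = sets borel"
    and E: "E \<in> sets borel" "AE y in \<nu>. y \<in> E" and inf: "infinite (set_pmf \<rho>)"
    and disj: "\<And>x x' y y'. x \<in> set_pmf \<rho> \<Longrightarrow> x' \<in> set_pmf \<rho> \<Longrightarrow> y \<in> E \<Longrightarrow> y' \<in> E \<Longrightarrow> y + x = y' + x' \<Longrightarrow> x = x'"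
  shows "\<not> admits_fourier_frame (borel_pmf \<rho> \<star> \<nu>)"
proof
  interpret \<nu>: prob_space \<nu> by fact
  interpret \<rho>: prob_space "borel_pmf \<rho>" by (rule prob_space_borel_pmf)
  define \<mu> where "\<mu> = (borel_pmf \<rho> \<star> \<nu>)"
  note [measurable_cong] = \<nu>(2)
  note [measurable] = E(1)
  have \<mu>: "finite_measure \<mu>" "sets \<mu> = sets borel"
    unfolding \<mu>_def
    by (rule convolution_finite[OF \<rho>.finite_measure_axioms \<nu>.finite_measure_axioms \<nu>(2) sets_borel_pmf])
       simp
  interpret \<mu>: finite_measure \<mu> by fact
  note [measurable_cong] = \<mu>(2)
  define f where "f x0 z = (indicator E (z - x0) :: complex)" for x0 z
  have f_meas [measurable]: "f x0 \<in> borel_measurable borel" for x0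
    unfolding f_def by measurable
  have f_norm: "norm (f x0 z) = indicator E (z - x0)" "norm (f x0 z) \<le> 1" for x0 z
    by (auto simp: f_def indicator_def)
  \<comment> \<open>Used with \<open>h = 1\<close> for the norm and with the Fourier kernel for the
    frame sum.\<close>
  have key: "(LINT z|\<mu>. h z * f x0 z) = pmf \<rho> x0 * (LINT y|\<nu>. h (x0 + y))"
    if x0: "x0 \<in> set_pmf \<rho>" and h [measurable]: "h \<in> borel_measurable borel" and h1: "\<And>z. norm (h z) \<le> 1"
    for x0 and h :: "real \<Rightarrow> complex"
  proof -
    have "norm (h z * f x0 z) \<le> 1" for z
      using mult_mono[OF h1[of z] f_norm(2)[of x0 z]] by (simp add: norm_mult)
    then have "(LINT z|\<mu>. h z * f x0 z) = (LINT x|borel_pmf \<rho>. LINT y|\<nu>. h (x + y) * f x0 (x + y))"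
      unfolding \<mu>_def
      by (intro integral_convolution_bounded \<rho>.finite_measure_axioms \<nu>.finite_measure_axioms) (auto simp: \<nu>(2))
    also have "\<dots> = measure_pmf.expectation \<rho> (\<lambda>x. LINT y|\<nu>. h (x + y) * f x0 (x + y))"
      by (rule integral_borel_pmf) measurable
    also have "\<dots> = measure_pmf.expectation \<rho> (\<lambda>x. indicator {x0} x *\<^sub>R (LINT y|\<nu>. h (x0 + y)))"
    proof (intro integral_cong_AE)
      show "AE x in measure_pmf \<rho>. (LINT y|\<nu>. h (x + y) * f x0 (x + y)) = indicator {x0} x *\<^sub>R (LINT y|\<nu>. h (x0 + y))"
        unfolding AE_measure_pmf_iff
      proof
        fix x assume x: "x \<in> set_pmf \<rho>"
        have "(LINT y|\<nu>. h (x + y) * f x0 (x + y)) = (LINT y|\<nu>. indicator {x0} x *\<^sub>R h (x0 + y))"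
        proof (intro integral_cong_AE)
          show "AE y in \<nu>. h (x + y) * f x0 (x + y) = indicator {x0} x *\<^sub>R h (x0 + y)"
            using E(2)
          proof eventually_elim
            case (elim y)
            show ?case
            proof (cases "x = x0")
              case False
              then have "x + y - x0 \<notin> E" using disj[OF x x0 elim, of "x + y - x0"] by auto
              then show ?thesis using False by (simp add: f_def)
            qed (use elim in \<open>simp add: f_def\<close>)
          qed
        qed measurable
        then show "(LINT y|\<nu>. h (x + y) * f x0 (x + y)) = indicator {x0} x *\<^sub>R (LINT y|\<nu>. h (x0 + y))"
          by simp
      qed
    qed auto
    also have "\<dots> = pmf \<rho> x0 * (LINT y|\<nu>. h (x0 + y))"
      by (simp add: measure_pmf_single scaleR_conv_of_real)
    finally show ?thesis .
  qed
  assume "admits_fourier_frame (borel_pmf \<rho> \<star> \<nu>)"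
  then obtain \<Lambda> A B where A: "0 < A" and frame: "\<And>f. square_integrable \<mu> f \<Longrightarrow>
      A * (LINT x|\<mu>. (norm (f x))\<^sup>2) \<le> (\<Sum>\<^sub>\<infinity>l\<in>\<Lambda>. (norm (fourier_density \<mu> f l))\<^sup>2)"
    unfolding admits_fourier_frame_def frame_spectrum_def \<mu>_def by blast
  define S where "S = (\<Sum>\<^sub>\<infinity>l\<in>\<Lambda>. (norm (fourier_measure \<nu> l))\<^sup>2)"
  have lower: "A \<le> pmf \<rho> x0 * S" if x0: "x0 \<in> set_pmf \<rho>" for x0
  proof -
    have p: "pmf \<rho> x0 > 0" using x0 by (simp add: pmf_positive)
    have "integrable \<mu> (\<lambda>x. (norm (f x0 x))\<^sup>2)"
      by (rule \<mu>.integrable_const_bound[where B = 1]) (auto simp: f_norm(1) indicator_def)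
    then have "square_integrable \<mu> (f x0)" by (simp add: square_integrable_def)
    from frame[OF this]
    have "A * (LINT x|\<mu>. (norm (f x0 x))\<^sup>2) \<le> (\<Sum>\<^sub>\<infinity>l\<in>\<Lambda>. (norm (fourier_density \<mu> (f x0) l))\<^sup>2)" .
    moreover have "(LINT x|\<mu>. (norm (f x0 x))\<^sup>2) = pmf \<rho> x0"
    proof -
      have "complex_of_real (LINT x|\<mu>. (norm (f x0 x))\<^sup>2) = (LINT x|\<mu>. 1 * f x0 x)"
        unfolding integral_complex_of_real[symmetric]
        by (intro Bochner_Integration.integral_cong) (auto simp: f_def indicator_def)
      also have "\<dots> = of_real (pmf \<rho> x0)" by (subst key[OF x0]) (auto simp: \<nu>.prob_space)
      finally show ?thesis by (simp only: of_real_eq_iff)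
    qed
    moreover have "norm (fourier_density \<mu> (f x0) l) = pmf \<rho> x0 * norm (fourier_measure \<nu> l)" for l
    proof -
      have "fourier_density \<mu> (f x0) l = pmf \<rho> x0 * (LINT y|\<nu>. exp (- 2 * pi * \<i> * of_real ((x0 + y) * l)))"
        unfolding fourier_density_def
        by (rule key[OF x0, of "\<lambda>y. exp (- 2 * pi * \<i> * of_real (y * l))"])
           (auto simp only: norm_fourier_kernel intro!: borel_measurable_continuous_onI continuous_intros)
      also have "\<dots> = pmf \<rho> x0 * (exp (- 2 * pi * \<i> * of_real (x0 * l)) * fourier_measure \<nu> l)"
        unfolding fourier_kernel_add fourier_measure_def by (simp only: integral_mult_right_zero)
      finally show ?thesis by (simp only: norm_mult norm_fourier_kernel) simp
    qed
    ultimately have "A * pmf \<rho> x0 \<le> (\<Sum>\<^sub>\<infinity>l\<in>\<Lambda>. (pmf \<rho> x0)\<^sup>2 * (norm (fourier_measure \<nu> l))\<^sup>2)"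
      by (simp add: power_mult_distrib)
    also have "\<dots> = (pmf \<rho> x0)\<^sup>2 * S" unfolding S_def by (rule infsum_cmult_right')
    finally have "pmf \<rho> x0 * A \<le> pmf \<rho> x0 * (pmf \<rho> x0 * S)" by (simp add: power2_eq_square mult_ac)
    then show ?thesis using p by (simp only: mult_le_cancel_left_pos)
  qed
  \<comment> \<open>Were the transform of \<open>\<nu>\<close> not square summable over
    \<open>\<Lambda>\<close>, \<open>infsum\<close> would give \<open>S\<close> the value 0;
    \<open>lower\<close> excludes this case too.\<close>
  have "S > 0"
  proof -
    obtain x0 where x0: "x0 \<in> set_pmf \<rho>" using set_pmf_not_empty[of \<rho>] by blast
    then show ?thesis using lower[OF x0] A pmf_nonneg[of \<rho> x0] by (meson less_le_trans zero_less_mult_pos pmf_positive)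
  qed
  then have "finite (set_pmf \<rho>)"
    using lower A by (intro pmf_bounded_below_finite_support[of "A / S"]) (auto simp: divide_le_eq)
  then show False using inf by contradiction
qed

section \<open>Hausdorff dimension\<close>

lemma hausdorff_premeasure_le:
  assumes "S \<subseteq> (\<Union>k. U k)" "\<And>k. bounded (U k) \<and> diameter (U k) \<le> \<delta>"
  shows "hausdorff_premeasure t \<delta> S \<le> (\<Sum>k. diameter_powr (U k) t)"
  unfolding hausdorff_premeasure_def by (rule INF_lower) (use assms in auto)

lemma diameter_powr_ball_le:
  assumes "r > 0" "t > 0"
  shows "diameter_powr (ball (x::real) r) t \<le> ennreal ((2 * r) powr t)"
proof -
  have "ball x r \<noteq> {}" using assms by simp
  moreover have "diameter (ball x r) = 2 * r" using assms by (subst diameter_ball) auto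
  ultimately show ?thesis using assms by (simp add: diameter_powr_def)
qed

text \<open>One ball of radius \<open>1 / q i\<close> per fraction: since points lie in
  \<open>[-1/2, 1/2]\<close>, numerators are at most \<open>2 * h\<close> in modulus, leaving
  \<open>h * (4 * h + 1) \<le> 5 * h^2 \<le> 5 * q i powr s\<close> balls.\<close>

lemma hausdorff_premeasure_well_approx_le:
  assumes s: "s > 0" and t: "t > 0" and i: "1 \<le> i" and q: "q i > 1" and \<delta>: "2 / q i \<le> \<delta>"
  shows "hausdorff_premeasure t \<delta> (well_approx_set s q) \<le> ennreal (5 * 2 powr t * q i powr (s - t))"
proof -
  define h where "h = nat \<lfloor>q i powr (s / 2)\<rfloor>"
  have h: "real h \<le> q i powr (s / 2)" unfolding h_def by simp
  define J where "J = {1..h} \<times> {-(2 * int h)..2 * int h}"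
  have "nat (4 * int h + 1) = 4 * h + 1" by linarith
  then have J: "finite J" "card J = h * (4 * h + 1)" by (simp_all add: J_def card_cartesian_product)
  obtain f where f: "bij_betw f {0..<card J} J" using ex_bij_betw_nat_finite[OF J(1)] by blast
  define c where "c = (\<lambda>(a::nat, m::int). of_int m / real a)"
  \<comment> \<open>Padding by empty sets, whose \<open>diameter_powr\<close> is 0, turns the finite
    cover into a sequence.\<close>
  define U where "U k = (if k < card J then ball (c (f k)) (1 / q i) else {})" for k
  have "hausdorff_premeasure t \<delta> (well_approx_set s q) \<le> (\<Sum>k. diameter_powr (U k) t)"
  proof (rule hausdorff_premeasure_le)
    show "well_approx_set s q \<subseteq> (\<Union>k. U k)"
    proof
      fix x assume "x \<in> well_approx_set s q"
      then obtain a where a: "1 \<le> a" "real a \<le> q i powr (s / 2)" "x \<in> nbhd (1 / q i) (int_over a)" "x \<in> {-1/2..1/2}"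
        using i by (auto simp: well_approx_set_def)
      then obtain m :: int where m: "\<bar>of_int m / real a - x\<bar> < 1 / q i"
        by (auto simp: nbhd_def int_over_def dist_real_def)
      have ah: "a \<le> h" using a(2) unfolding h_def by (simp add: le_nat_floor)
      have "1 / q i < 1" using q by simp
      then have "\<bar>of_int m / real a\<bar> < 2" using m a(4) by auto
      then have "\<bar>of_int m :: real\<bar> < 2 * real a" using a(1) by (simp add: field_simps)
      then have "\<bar>m\<bar> \<le> 2 * int h" using ah by linarith
      then have "(a, m) \<in> J" using a(1) ah by (auto simp: J_def)
      then obtain k where k: "k < card J" "f k = (a, m)" using f by (force simp: bij_betw_def)
      have "x \<in> U k" using k m by (simp add: U_def c_def dist_real_def)
      then show "x \<in> (\<Union>k. U k)" by blast
    qed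
    fix k
    have "2 * (1 / q i) \<le> \<delta>" using \<delta> by simp
    moreover have "0 \<le> \<delta>" using \<delta> q by (smt (verit) divide_pos_pos)
    ultimately show "bounded (U k) \<and> diameter (U k) \<le> \<delta>"
      using q by (auto simp: U_def diameter_ball)
  qed
  also have "\<dots> = (\<Sum>k<card J. diameter_powr (U k) t)"
    by (rule suminf_finite) (auto simp: U_def diameter_powr_def)
  also have "\<dots> \<le> (\<Sum>k<card J. ennreal ((2 * (1 / q i)) powr t))"
    using q diameter_powr_ball_le[OF _ t, of "1 / q i"] by (intro sum_mono) (simp add: U_def)
  also have "\<dots> = ennreal (real (card J) * (2 * (1 / q i)) powr t)"
    by (simp add: ennreal_mult ennreal_of_nat_eq_real_of_nat)
  also have "\<dots> \<le> ennreal (5 * 2 powr t * q i powr (s - t))"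
  proof (rule ennreal_leI)
    have "h \<le> h * h" by (cases h) auto
    then have "h * (4 * h + 1) \<le> 5 * (h * h)" by (simp add: algebra_simps)
    from of_nat_mono[OF this, where 'a = real]
    have "real (card J) \<le> 5 * (real h * real h)" unfolding J(2) by simp
    also have "\<dots> \<le> 5 * (q i powr (s / 2) * q i powr (s / 2))"
      using h by (intro mult_left_mono mult_mono) auto
    also have "\<dots> = 5 * q i powr s" using q by (simp add: powr_add[symmetric])
    finally have "real (card J) * (2 * (1 / q i)) powr t \<le> 5 * q i powr s * (2 * (1 / q i)) powr t"
      by (rule mult_right_mono) simp
    also have "\<dots> = 5 * 2 powr t * q i powr (s - t)"
      using q by (simp add: powr_divide powr_diff)
    finally show "real (card J) * (2 * (1 / q i)) powr t \<le> 5 * 2 powr t * q i powr (s - t)" .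
  qed
  finally show ?thesis .
qed

lemma hausdorff_premeasure_mono: "S \<subseteq> T \<Longrightarrow> hausdorff_premeasure t \<delta> S \<le> hausdorff_premeasure t \<delta> T"
  unfolding hausdorff_premeasure_def by (rule INF_superset_mono) auto

text \<open>The cover at scale \<open>q i\<close> costs a constant times
  \<open>q i powr (s - t)\<close>, which tends to 0, and is admissible for \<open>\<delta>\<close>
  once \<open>2 / q i \<le> \<delta>\<close>.\<close>

lemma hausdorff_measure_well_approx_zero:
  assumes s: "s > 0" and t: "s < t" and q: "\<And>i. 1 \<le> i \<Longrightarrow> q i > 1" and lim: "filterlim q at_top sequentially"
    and S: "S \<subseteq> well_approx_set s q"
  shows "hausdorff_measure t S = 0"
proof -
  have "hausdorff_premeasure t \<delta> S \<le> 0" if \<delta>: "\<delta> > 0" for \<delta>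
  proof (rule tendsto_lowerbound)
    have "((\<lambda>i. q i powr (s - t)) \<longlongrightarrow> 0) sequentially"
      by (rule tendsto_neg_powr[OF _ lim]) (use t in auto)
    then have "((\<lambda>i. 5 * 2 powr t * q i powr (s - t)) \<longlongrightarrow> 5 * 2 powr t * 0) sequentially"
      by (rule tendsto_mult_left)
    then show "((\<lambda>i. ennreal (5 * 2 powr t * q i powr (s - t))) \<longlongrightarrow> 0) sequentially"
      using tendsto_ennrealI by fastforce
    show "\<forall>\<^sub>F i in sequentially. hausdorff_premeasure t \<delta> S \<le> ennreal (5 * 2 powr t * q i powr (s - t))"
      using filterlim_at_top_dense[THEN iffD1, OF lim, rule_format, of "2 / \<delta>"] eventually_ge_at_top[of 1]
    proof eventually_elim
      case (elim i)
      then have "2 / q i \<le> \<delta>" using \<delta> q[of i] by (simp add: field_simps)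
      then show ?case
        using elim s t q by (intro order.trans[OF hausdorff_premeasure_mono[OF S]] hausdorff_premeasure_well_approx_le) auto
    qed
  qed simp
  then show ?thesis unfolding hausdorff_measure_def by (auto simp: SUP_eq_iff bot_ennreal intro!: antisym SUP_least)
qed

text \<open>Powers of diameters at most 1 decrease in the exponent. Exponent 0 is treated apart
  because \<open>diameter_powr\<close> follows its own convention there.\<close>

lemma hausdorff_premeasure_zero_mono:
  assumes "hausdorff_premeasure t \<delta> S = 0" "0 \<le> t" "t \<le> t'" "\<delta> \<le> 1"
  shows "hausdorff_premeasure t' \<delta> S = 0"
proof -
  have "diameter_powr U t' \<le> diameter_powr U t" if "bounded U" "diameter U \<le> \<delta>" for U :: "'a set"
  proof (cases "t = 0 \<or> t' = 0")
    case True
    have "diameter U powr t' \<le> 1"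
      using diameter_ge_0[OF that(1)] that(2) assms by (intro powr_le1) auto
    then show ?thesis using True assms by (auto simp: diameter_powr_def)
  next
    case False
    have "diameter U powr t' \<le> diameter U powr t"
      using diameter_ge_0[OF that(1)] that(2) assms by (intro powr_mono') auto
    then show ?thesis using False by (auto simp: diameter_powr_def intro: ennreal_leI)
  qed
  then have "hausdorff_premeasure t' \<delta> S \<le> hausdorff_premeasure t \<delta> S"
    unfolding hausdorff_premeasure_def by (intro INF_mono) (auto intro!: bexI suminf_le)
  then show ?thesis using assms(1) by simp
qed

section \<open>Lower bound for the dimension by energies\<close>

lemma norm_fourier_measure_sq:
  assumes "finite_measure M" "sets M = sets borel"
  shows "(norm (fourier_measure M \<xi>))\<^sup>2 =
    (LINT x|M. cos (2 * pi * (x * \<xi>)))\<^sup>2 + (LINT x|M. sin (2 * pi * (x * \<xi>)))\<^sup>2"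
proof -
  interpret finite_measure M by fact
  note [measurable_cong] = assms(2)
  have int: "integrable M f" if "f \<in> borel_measurable borel" "\<And>x. norm (f x) \<le> 1" for f :: "real \<Rightarrow> 'b::{banach, second_countable_topology}"
    by (rule integrable_const_bound[where B = 1]) (use that assms(2) in auto)
  have "fourier_measure M \<xi> = (LINT x|M. of_real (cos (2 * pi * (x * \<xi>))) - \<i> * of_real (sin (2 * pi * (x * \<xi>))))"
    unfolding fourier_measure_def fourier_kernel_eq ..
  also have "\<dots> = of_real (LINT x|M. cos (2 * pi * (x * \<xi>))) - \<i> * of_real (LINT x|M. sin (2 * pi * (x * \<xi>)))"
    by (subst Bochner_Integration.integral_diff) (auto intro!: int simp: norm_mult)
  finally show ?thesis by (simp add: cmod_power2)
qed

lemma integral_pair_product: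
  fixes f g :: "real \<Rightarrow> real"
  assumes M: "finite_measure M" "sets M = sets borel"
    and f: "f \<in> borel_measurable borel" "\<And>x. \<bar>f x\<bar> \<le> 1" and g: "g \<in> borel_measurable borel" "\<And>x. \<bar>g x\<bar> \<le> 1"
  shows "integrable (M \<Otimes>\<^sub>M M) (\<lambda>z. f (fst z) * g (snd z))"
    "integral\<^sup>L (M \<Otimes>\<^sub>M M) (\<lambda>z. f (fst z) * g (snd z)) = integral\<^sup>L M f * integral\<^sup>L M g"
proof -
  interpret finite_measure M by fact
  interpret P: pair_sigma_finite M M ..
  interpret PF: finite_measure "M \<Otimes>\<^sub>M M" by (rule finite_measure_pair_measure) fact+
  note [measurable_cong] = M(2)
  note [measurable] = f(1) g(1)
  have "norm (f x * g y) \<le> 1" for x y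
    using mult_mono[OF f(2)[of x] g(2)[of y]] by (simp add: abs_mult)
  then show int: "integrable (M \<Otimes>\<^sub>M M) (\<lambda>z. f (fst z) * g (snd z))"
    by (intro PF.integrable_const_bound[where B = 1]) auto
  have "integral\<^sup>L (M \<Otimes>\<^sub>M M) (\<lambda>z. f (fst z) * g (snd z)) = (LINT x|M. LINT y|M. f (fst (x, y)) * g (snd (x, y)))"
    by (rule P.integral_fst'[symmetric, OF int])
  then show "integral\<^sup>L (M \<Otimes>\<^sub>M M) (\<lambda>z. f (fst z) * g (snd z)) = integral\<^sup>L M f * integral\<^sup>L M g"
    by simp
qed

lemma near_diagonal_sets:
  fixes M :: "real measure"
  assumes [measurable_cong]: "sets M = sets borel"
  shows "{z. \<bar>fst z - snd z\<bar> \<le> r} \<in> sets (M \<Otimes>\<^sub>M M)"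
proof -
  have "{z \<in> space (M \<Otimes>\<^sub>M M). \<bar>fst z - snd z\<bar> \<le> r} \<in> sets (M \<Otimes>\<^sub>M M)" by measurable
  then show ?thesis using sets_eq_imp_space_eq[OF assms] by (simp add: space_pair_measure)
qed

lemma triangle_wave_le: "\<eta> > 0 \<Longrightarrow> triangle_wave \<eta> x \<le> 1 / \<eta>"
  unfolding triangle_wave_def
  by (intro divide_right_mono max.boundedI) (auto simp: infdist_nonneg)

text \<open>The integral of the wave in \<open>x - y\<close> over the product measure is the sum of
  \<open>fejer_coeff \<eta> l * w l\<close>, because cosines of differences split into products. The
  decay makes this of order \<open>\<eta> powr (t - 1)\<close>, while the wave has height of order
  \<open>1/\<eta>\<close> near the diagonal.\<close>

lemma correlation_bound:
  assumes M: "finite_measure M" "sets M = sets borel" and t: "0 < t" "t < b" "t \<le> 1"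
    and decay: "\<And>l. l > 0 \<Longrightarrow> (norm (fourier_measure M (real l)))\<^sup>2 \<le> C * real l powr (- b)"
  obtains K where "K > 0"
    "\<And>r. 0 < r \<Longrightarrow> r \<le> 1/4 \<Longrightarrow> measure (M \<Otimes>\<^sub>M M) {z. \<bar>fst z - snd z\<bar> \<le> r} \<le> K * r powr t"
proof -
  interpret finite_measure M by fact
  interpret PF: finite_measure "M \<Otimes>\<^sub>M M" by (rule finite_measure_pair_measure) fact+
  note [measurable_cong] = M(2)
  have spM: "space M = UNIV" using sets_eq_imp_space_eq[OF M(2)] by simp
  have sp: "space (M \<Otimes>\<^sub>M M) = UNIV" by (simp add: space_pair_measure spM)
  define w where "w l = (norm (fourier_measure M (real l)))\<^sup>2" for l :: nat
  have w0: "w l \<ge> 0" for l by (simp add: w_def)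
  have C: "C \<ge> 0" using order.trans[OF w0[of 1, unfolded w_def] decay[of 1]] by simp
  define Z where "Z = (\<Sum>l. real (Suc l) powr (- (1 - t) - b))"
  \<comment> \<open>The exponent is below -1 exactly because \<open>t < b\<close>.\<close>
  have sZ: "summable (\<lambda>l. real (Suc l) powr (- (1 - t) - b))"
    using t by (subst summable_Suc_iff) (simp add: summable_real_powr_iff)
  have Z0: "Z \<ge> 0" unfolding Z_def by (intro suminf_nonneg sZ) simp
  define K0 where "K0 = w 0 + 2 * C * Z"
  have K0: "K0 \<ge> 0" using w0 C Z0 by (simp add: K0_def)
  have corr: "(\<lambda>l. fejer_coeff \<eta> l * w l) sums (LINT z|(M \<Otimes>\<^sub>M M). triangle_wave \<eta> (fst z - snd z))"
    if \<eta>: "0 < \<eta>" "\<eta> \<le> 1/2" for \<eta>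
  proof -
    define cs where "cs l x = cos (2 * pi * (x * real l))" for l :: nat and x :: real
    define sn where "sn l x = sin (2 * pi * (x * real l))" for l :: nat and x :: real
    have mcs [measurable]: "cs l \<in> borel_measurable borel" and msn [measurable]: "sn l \<in> borel_measurable borel" for l
      unfolding cs_def sn_def by (intro borel_measurable_continuous_onI continuous_intros)+
    have bd: "\<bar>cs l x\<bar> \<le> 1" "\<bar>sn l x\<bar> \<le> 1" for l x by (auto simp: cs_def sn_def)
    have split: "cos (2 * pi * (real l * (fst z - snd z))) = cs l (fst z) * cs l (snd z) + sn l (fst z) * sn l (snd z)" for l z
    proof -
      have "2 * pi * (real l * (fst z - snd z)) = 2 * pi * (fst z * real l) - 2 * pi * (snd z * real l)"
        by (simp add: algebra_simps)
      then show ?thesis by (simp only: cos_diff cs_def sn_def)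
    qed
    define F where "F l z = fejer_coeff \<eta> l * cos (2 * pi * (real l * (fst z - snd z)))" for l and z :: "real \<times> real"
    have Fint: "integrable (M \<Otimes>\<^sub>M M) (F l)" for l
      unfolding F_def split
      by (intro integrable_mult_right Bochner_Integration.integrable_add integral_pair_product(1) M bd) measurable
    have FI: "integral\<^sup>L (M \<Otimes>\<^sub>M M) (F l) = fejer_coeff \<eta> l * w l" for l
    proof -
      have "integral\<^sup>L (M \<Otimes>\<^sub>M M) (F l) = fejer_coeff \<eta> l *
          (integral\<^sup>L (M \<Otimes>\<^sub>M M) (\<lambda>z. cs l (fst z) * cs l (snd z)) + integral\<^sup>L (M \<Otimes>\<^sub>M M) (\<lambda>z. sn l (fst z) * sn l (snd z)))"
        unfolding F_def split
        by (subst integral_mult_right_zero, subst Bochner_Integration.integral_add)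
           (intro integral_pair_product(1) M bd refl; measurable)+
      also have "\<dots> = fejer_coeff \<eta> l * (integral\<^sup>L M (cs l) * integral\<^sup>L M (cs l) + integral\<^sup>L M (sn l) * integral\<^sup>L M (sn l))"
        by (simp only: integral_pair_product(2)[OF M mcs bd(1) mcs bd(1)] integral_pair_product(2)[OF M msn bd(2) msn bd(2)])
      finally have FI: "integral\<^sup>L (M \<Otimes>\<^sub>M M) (F l) = fejer_coeff \<eta> l *
          (integral\<^sup>L M (cs l) * integral\<^sup>L M (cs l) + integral\<^sup>L M (sn l) * integral\<^sup>L M (sn l))" .
      have trig: "cs l = (\<lambda>x. cos (2 * pi * (x * real l)))" "sn l = (\<lambda>x. sin (2 * pi * (x * real l)))"
        by (simp_all add: cs_def sn_def fun_eq_iff)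
      have "w l = (integral\<^sup>L M (cs l))\<^sup>2 + (integral\<^sup>L M (sn l))\<^sup>2"
        unfolding w_def trig by (rule norm_fourier_measure_sq[OF M])
      then show ?thesis by (simp only: FI power2_eq_square)
    qed
    have Fle: "norm (F l z) \<le> fejer_coeff \<eta> l" for l z
      by (simp add: F_def abs_mult fejer_coeff_nonneg mult_left_le)
    have "summable (\<lambda>l. norm (F l z))" for z
      by (rule summable_comparison_test'[OF summable_fejer_coeff[OF \<eta>(1)], of 0]) (use Fle in auto)
    moreover have "summable (\<lambda>l. LINT z|(M \<Otimes>\<^sub>M M). norm (F l z))"
    proof (rule summable_comparison_test'[OF summable_mult2[OF summable_fejer_coeff[OF \<eta>(1)]], of 0])
      fix l
      have "(LINT z|(M \<Otimes>\<^sub>M M). norm (F l z)) \<le> (LINT z|(M \<Otimes>\<^sub>M M). fejer_coeff \<eta> l)"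
        by (intro integral_mono Fle integrable_norm Fint) simp
      then show "norm (LINT z|(M \<Otimes>\<^sub>M M). norm (F l z)) \<le> fejer_coeff \<eta> l * measure (M \<Otimes>\<^sub>M M) (space (M \<Otimes>\<^sub>M M))"
        by (simp add: mult.commute)
    qed
    ultimately have "(\<lambda>l. integral\<^sup>L (M \<Otimes>\<^sub>M M) (F l)) sums (LINT z|(M \<Otimes>\<^sub>M M). (\<Sum>l. F l z))"
      using Fint by (intro sums_integral) auto
    moreover have "(\<Sum>l. F l z) = triangle_wave \<eta> (fst z - snd z)" for z
      using triangle_wave_sums[OF \<eta>] unfolding F_def by (simp add: sums_iff)
    ultimately show ?thesis by (simp add: FI)
  qed
  have upper: "(LINT z|(M \<Otimes>\<^sub>M M). triangle_wave \<eta> (fst z - snd z)) \<le> K0 * \<eta> powr (t - 1)"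
    if \<eta>: "0 < \<eta>" "\<eta> \<le> 1/2" for \<eta>
  proof -
    \<comment> \<open>Interpolation between the bounds of order 0 and order 2; \<open>1 - t\<close>
      lies in between.\<close>
    have fej: "fejer_coeff \<eta> l \<le> 2 * (\<eta> * real l) powr (- (1 - t))" if l: "l > 0" for l
    proof (cases "\<eta> * real l \<le> 1")
      case True
      have "(1::real) = 1 powr (- (1 - t))" by simp
      also have "\<dots> \<le> (\<eta> * real l) powr (- (1 - t))"
        using True t \<eta> l by (intro powr_mono2') auto
      finally show ?thesis using fejer_coeff_le(1)[OF \<eta>(1), of l] by linarith
    next
      case False
      have "fejer_coeff \<eta> l \<le> 2 * (\<eta> * real l) powr (-2)"
        using fejer_coeff_le(2)[OF \<eta>(1) l] \<eta> l by (simp add: powr_minus_divide powr_numeral)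
      also have "\<dots> \<le> 2 * (\<eta> * real l) powr (- (1 - t))"
        using False t by (intro mult_left_mono powr_mono) auto
      finally show ?thesis .
    qed
    have term_le: "fejer_coeff \<eta> (Suc l) * w (Suc l) \<le> 2 * C * \<eta> powr (t - 1) * real (Suc l) powr (- (1 - t) - b)" for l
    proof -
      have "fejer_coeff \<eta> (Suc l) * w (Suc l) \<le> (2 * (\<eta> * real (Suc l)) powr (- (1 - t))) * (C * real (Suc l) powr (- b))"
        using fej[of "Suc l"] decay[of "Suc l"] w0 by (intro mult_mono) (auto simp: w_def)
      also have "\<dots> = 2 * C * \<eta> powr (t - 1) * (real (Suc l) powr (- (1 - t)) * real (Suc l) powr (- b))"
        using \<eta> by (simp add: powr_mult mult_ac)
      also have "real (Suc l) powr (- (1 - t)) * real (Suc l) powr (- b) = real (Suc l) powr (- (1 - t) - b)"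
        by (simp add: powr_add[symmetric])
      finally show ?thesis .
    qed
    have sm: "summable (\<lambda>l. fejer_coeff \<eta> l * w l)" using corr[OF \<eta>] by (rule sums_summable)
    have "(LINT z|(M \<Otimes>\<^sub>M M). triangle_wave \<eta> (fst z - snd z)) = (\<Sum>l. fejer_coeff \<eta> l * w l)"
      using corr[OF \<eta>] by (simp add: sums_iff)
    also have "\<dots> = (\<Sum>l. fejer_coeff \<eta> (Suc l) * w (Suc l)) + w 0"
      using suminf_split_head[OF sm] by (simp add: fejer_coeff_def)
    also have "\<dots> \<le> (\<Sum>l. 2 * C * \<eta> powr (t - 1) * real (Suc l) powr (- (1 - t) - b)) + w 0 * \<eta> powr (t - 1)"
    proof (intro add_mono suminf_le term_le)
      show "summable (\<lambda>l. fejer_coeff \<eta> (Suc l) * w (Suc l))" using sm by (subst summable_Suc_iff)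
      show "summable (\<lambda>l. 2 * C * \<eta> powr (t - 1) * real (Suc l) powr (- (1 - t) - b))"
        by (intro summable_mult sZ)
      have "1 powr (t - 1) \<le> \<eta> powr (t - 1)" using \<eta> t by (intro powr_mono2') auto
      then show "w 0 \<le> w 0 * \<eta> powr (t - 1)" using w0[of 0] mult_left_mono[of 1 "\<eta> powr (t - 1)" "w 0"] by simp
    qed
    also have "(\<Sum>l. 2 * C * \<eta> powr (t - 1) * real (Suc l) powr (- (1 - t) - b)) = 2 * C * \<eta> powr (t - 1) * Z"
      unfolding Z_def by (rule suminf_mult[OF sZ])
    finally show ?thesis by (simp add: K0_def algebra_simps)
  qed
  show ?thesis
  proof (rule that)
    show "4 * K0 + 1 > 0" using K0 by simp
    fix r :: real assume r: "0 < r" "r \<le> 1/4"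
    \<comment> \<open>With this width the wave is still at least half its height,
      \<open>1 / (2 * \<eta>)\<close>, on \<open>|x - y| \<le> r\<close>.\<close>
    define \<eta> where "\<eta> = 2 * r"
    have \<eta>: "0 < \<eta>" "\<eta> \<le> 1/2" using r by (auto simp: \<eta>_def)
    let ?A = "{z. \<bar>fst z - snd z\<bar> \<le> r} :: (real \<times> real) set"
    have A: "?A \<in> sets (M \<Otimes>\<^sub>M M)" by (rule near_diagonal_sets[OF M(2)])
    have [measurable]: "triangle_wave \<eta> \<in> borel_measurable borel"
      by (intro borel_measurable_continuous_onI continuous_intros)
    have tw_int: "integrable (M \<Otimes>\<^sub>M M) (\<lambda>z. triangle_wave \<eta> (fst z - snd z))"
    proof (rule PF.integrable_const_bound[where B = "1 / \<eta>"])
      show "AE z in M \<Otimes>\<^sub>M M. norm (triangle_wave \<eta> (fst z - snd z)) \<le> 1 / \<eta>"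
        using triangle_wave_le triangle_wave_nonneg \<eta> by (intro AE_I2) simp
    qed measurable
    have "measure (M \<Otimes>\<^sub>M M) ?A / (2 * \<eta>) = (LINT z|(M \<Otimes>\<^sub>M M). indicator ?A z / (2 * \<eta>))"
      using A by (simp add: sp)
    also have "\<dots> \<le> (LINT z|(M \<Otimes>\<^sub>M M). triangle_wave \<eta> (fst z - snd z))"
    proof (intro integral_mono tw_int)
      show "integrable (M \<Otimes>\<^sub>M M) (\<lambda>z. indicator ?A z / (2 * \<eta>) :: real)"
        using A by (intro integrable_divide) (auto simp: PF.emeasure_eq_measure)
      fix z
      show "indicator ?A z / (2 * \<eta>) \<le> triangle_wave \<eta> (fst z - snd z)"
      proof (cases "z \<in> ?A")
        case True
        then have "infdist (fst z - snd z) \<int> \<le> \<eta> / 2"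
          using infdist_Ints_le[of "fst z - snd z" 0] by (simp add: \<eta>_def)
        then have "infdist (fst z - snd z) \<int> / \<eta> \<le> 1 / 2" using \<eta> by (simp add: field_simps)
        then have "1 / 2 \<le> max 0 (1 - infdist (fst z - snd z) \<int> / \<eta>)" by linarith
        then have "(1 / 2) / \<eta> \<le> triangle_wave \<eta> (fst z - snd z)"
          unfolding triangle_wave_def using \<eta> by (intro divide_right_mono) auto
        then show ?thesis using True by simp
      qed (use triangle_wave_nonneg \<eta> in simp)
    qed
    also have "\<dots> \<le> K0 * \<eta> powr (t - 1)" by (rule upper[OF \<eta>])
    finally have "measure (M \<Otimes>\<^sub>M M) ?A \<le> 2 * \<eta> * (K0 * \<eta> powr (t - 1))"
      using \<eta> by (simp add: field_simps)
    also have "\<dots> = 2 * K0 * \<eta> powr t" using \<eta> by (simp add: powr_diff)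
    also have "\<dots> = 2 * K0 * (2 powr t * r powr t)" using r by (simp add: \<eta>_def powr_mult)
    also have "\<dots> \<le> 2 * K0 * (2 powr 1 * r powr t)"
      using t K0 by (intro mult_left_mono mult_right_mono powr_mono) auto
    also have "\<dots> \<le> (4 * K0 + 1) * r powr t" by (simp add: algebra_simps)
    finally show "measure (M \<Otimes>\<^sub>M M) ?A \<le> (4 * K0 + 1) * r powr t" .
  qed
qed

text \<open>For \<open>t > 0\<close> a dyadic substitute for the Riesz kernel
  \<open>|x - y| powr (-t)\<close>, comparable to it when \<open>0 < |x - y| \<le> 1/4\<close>;
  being a sum of indicators, it integrates directly against the correlation bound. The shift
  \<open>j + 2\<close> starts the scales at 1/4.\<close>

definition energy_kernel :: "real \<Rightarrow> real \<times> real \<Rightarrow> ennreal" where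
  "energy_kernel t z = (\<Sum>j. ennreal ((2 ^ (j + 2)) powr t) * indicator {z. \<bar>fst z - snd z\<bar> \<le> (1/2) ^ (j + 2)} z)"

lemma dyadic_scale:
  fixes d :: real
  assumes "0 < d" "d \<le> 1/4"
  obtains j :: nat where "d \<le> (1/2) ^ (j + 2)" "(1/2) ^ (j + 2) \<le> 2 * d"
proof -
  define N where "N = (LEAST N. (1/2) ^ N < d)"
  have ex: "\<exists>N. (1/2) ^ N < d" using real_arch_pow_inv[of d "1/2"] assms by auto
  have N: "(1/2) ^ N < d" unfolding N_def by (rule LeastI_ex[OF ex])
  have less: "d \<le> (1/2) ^ M" if "M < N" for M
    using not_less_Least[of M "\<lambda>N. (1/2) ^ N < d"] that unfolding N_def by auto
  have "3 \<le> N"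
  proof (rule ccontr)
    assume "\<not> 3 \<le> N"
    then have "(1/2::real) ^ 2 \<le> (1/2) ^ N" by (intro power_decreasing) auto
    then show False using N assms by (simp add: power2_eq_square)
  qed
  then obtain j where j: "N = Suc (j + 2)" using nat_le_iff_add[of 3 N] by auto
  show ?thesis
  proof (rule that[of j])
    show "d \<le> (1/2) ^ (j + 2)" using less[of "j + 2"] j by simp
    show "(1/2) ^ (j + 2) \<le> 2 * d" using N by (simp add: j)
  qed
qed

text \<open>The \<open>j\<close>-th scale contributes at most \<open>K * x ^ (j + 2)\<close> with
  \<open>x = 2 powr (t - t')\<close>, a convergent geometric series as
  \<open>t < t'\<close>.\<close>

lemma energy_finite:
  assumes M: "finite_measure M" "sets M = sets borel" and t: "0 < t" "t < t'"
    and K: "\<And>r. 0 < r \<Longrightarrow> r \<le> 1/4 \<Longrightarrow> measure (M \<Otimes>\<^sub>M M) {z. \<bar>fst z - snd z\<bar> \<le> r} \<le> K * r powr t'"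
  shows "(\<integral>\<^sup>+z. energy_kernel t z \<partial>(M \<Otimes>\<^sub>M M)) < \<infinity>"
    and "energy_kernel t \<in> borel_measurable (M \<Otimes>\<^sub>M M)"
    and "K \<ge> 0"
proof -
  interpret finite_measure M by fact
  interpret PF: finite_measure "M \<Otimes>\<^sub>M M" by (rule finite_measure_pair_measure) fact+
  note [measurable_cong] = M(2)
  note A = near_diagonal_sets[OF M(2)]
  show "energy_kernel t \<in> borel_measurable (M \<Otimes>\<^sub>M M)"
  proof -
    note A [measurable]
    show ?thesis unfolding energy_kernel_def by measurable
  qed
  show K0: "K \<ge> 0"
  proof -
    have "0 \<le> K * (1/4) powr t'" by (rule order.trans[OF measure_nonneg K]) simp_all
    then show ?thesis by (simp add: zero_le_mult_iff)
  qed
  define x where "x = 2 powr (t - t')"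
  have x: "0 \<le> x" "x < 1" using t by (auto simp: x_def powr_less_one)
  have "(\<integral>\<^sup>+z. energy_kernel t z \<partial>(M \<Otimes>\<^sub>M M)) =
      (\<Sum>j. \<integral>\<^sup>+z. ennreal ((2 ^ (j + 2)) powr t) * indicator {z. \<bar>fst z - snd z\<bar> \<le> (1/2) ^ (j + 2)} z \<partial>(M \<Otimes>\<^sub>M M))"
    unfolding energy_kernel_def
  proof (rule nn_integral_suminf)
    note A [measurable]
    show "(\<lambda>z. ennreal ((2 ^ (j + 2)) powr t) * indicator {z. \<bar>fst z - snd z\<bar> \<le> (1/2) ^ (j + 2)} z)
        \<in> borel_measurable (M \<Otimes>\<^sub>M M)" for j by measurable
  qed
  also have "\<dots> = (\<Sum>j. ennreal ((2 ^ (j + 2)) powr t) * emeasure (M \<Otimes>\<^sub>M M) {z. \<bar>fst z - snd z\<bar> \<le> (1/2) ^ (j + 2)})"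
    by (intro suminf_cong nn_integral_cmult_indicator A)
  also have "\<dots> \<le> (\<Sum>j. ennreal (K * x ^ (j + 2)))"
  proof (intro suminf_le summableI)
    fix j
    define r :: real where "r = (1/2) ^ (j + 2)"
    have r: "0 < r" "r \<le> 1/4"
    proof -
      show "0 < r" by (simp add: r_def)
      have "r \<le> (1/2) ^ 2" unfolding r_def by (intro power_decreasing) auto
      then show "r \<le> 1/4" by (simp add: power2_eq_square)
    qed
    have eq: "(2 ^ (j + 2)) powr t * r powr t' = x ^ (j + 2)"
    proof -
      have r_eq: "r = 1 / 2 ^ (j + 2)" by (simp only: r_def power_one_over)
      have "(2 ^ (j + 2)) powr t * r powr t' = (2 ^ (j + 2)) powr t / (2 ^ (j + 2)) powr t'"
        unfolding r_eq powr_divide by simp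
      also have "\<dots> = (2 ^ (j + 2)) powr (t - t')" by (rule powr_diff[symmetric])
      also have "\<dots> = (2 powr real (j + 2)) powr (t - t')"
        by (subst powr_realpow) (rule zero_less_numeral, rule refl)
      also have "\<dots> = (2 powr (t - t')) powr real (j + 2)" by (simp only: powr_powr mult.commute)
      also have "\<dots> = x ^ (j + 2)" unfolding x_def by (rule powr_realpow) simp
      finally show ?thesis .
    qed
    have "ennreal ((2 ^ (j + 2)) powr t) * emeasure (M \<Otimes>\<^sub>M M) {z. \<bar>fst z - snd z\<bar> \<le> r}
        \<le> ennreal ((2 ^ (j + 2)) powr t) * ennreal (K * r powr t')"
      using K[OF r] by (intro mult_left_mono) (auto simp: PF.emeasure_eq_measure intro: ennreal_leI)
    also have "\<dots> = ennreal ((2 ^ (j + 2)) powr t * (K * r powr t'))"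
      using K0 by (subst ennreal_mult) auto
    also have "(2 ^ (j + 2)) powr t * (K * r powr t') = K * ((2 ^ (j + 2)) powr t * r powr t')" by simp
    finally show "ennreal ((2 ^ (j + 2)) powr t) * emeasure (M \<Otimes>\<^sub>M M) {z. \<bar>fst z - snd z\<bar> \<le> (1/2) ^ (j + 2)}
        \<le> ennreal (K * x ^ (j + 2))"
      unfolding eq unfolding r_def .
  qed
  also have "\<dots> < \<infinity>"
  proof -
    have "summable (\<lambda>j. K * x ^ (j + 2))"
      using x by (intro summable_mult) (simp add: power_add summable_geometric summable_mult2)
    then show ?thesis
      using K0 x by (subst suminf_ennreal2) auto
  qed
  finally show "(\<integral>\<^sup>+z. energy_kernel t z \<partial>(M \<Otimes>\<^sub>M M)) < \<infinity>" .
qed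

text \<open>By AM-GM, \<open>m \<le> (L a + m\<^sup>2 / (L a)) / 2\<close>; for the mass \<open>m\<close> of a set of diameter \<open>d\<close> and
  \<open>a\<close> comparable to \<open>d powr t\<close> the last summand is controlled by the energy of the set.\<close>
lemma measure_le_diameter_plus_energy:
  assumes M: "finite_measure M" "sets M = sets borel" and t: "0 < t" "t < t'"
    and K: "\<And>r. 0 < r \<Longrightarrow> r \<le> 1/4 \<Longrightarrow> measure (M \<Otimes>\<^sub>M M) {z. \<bar>fst z - snd z\<bar> \<le> r} \<le> K * r powr t'"
    and V: "V \<in> sets borel" "\<And>x y. x \<in> V \<Longrightarrow> y \<in> V \<Longrightarrow> \<bar>x - y\<bar> \<le> d" and d: "0 \<le> d" "d \<le> 1/4" and L: "L > 0"
  shows "emeasure M V \<le> ennreal (L / 2 * 2 powr t) * ennreal (d powr t)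
      + ennreal (1 / (2 * L)) * (\<integral>\<^sup>+z. energy_kernel t z * indicator (V \<times> V) z \<partial>(M \<Otimes>\<^sub>M M))"
proof -
  interpret finite_measure M by fact
  interpret PF: finite_measure "M \<Otimes>\<^sub>M M" by (rule finite_measure_pair_measure) fact+
  note [measurable_cong] = M(2)
  note A = near_diagonal_sets[OF M(2)]
  define m where "m = measure M V"
  have m0: "m \<ge> 0" by (simp add: m_def)
  have VM: "V \<in> sets M" using V(1) M(2) by simp
  have VV: "V \<times> V \<in> sets (M \<Otimes>\<^sub>M M)" using VM by auto
  have eVV: "emeasure (M \<Otimes>\<^sub>M M) (V \<times> V) = ennreal (m\<^sup>2)"
    by (subst emeasure_pair_measure_Times[OF VM VM]) (simp add: emeasure_eq_measure m_def ennreal_mult power2_eq_square)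
  show ?thesis
  proof (cases "d = 0")
    case True
    have "m = 0"
    proof (rule ccontr)
      assume "m \<noteq> 0"
      then have m: "m > 0" using m0 by simp
      have Kpos: "K \<ge> 0" by (rule energy_finite(3)[OF M t K])
      \<comment> \<open>Small enough for \<open>K * r powr t' < m^2\<close>, whereas for
        \<open>d = 0\<close> the set \<open>V \<times> V\<close>, of measure \<open>m^2\<close>,
        lies on the diagonal: the correlation bound excludes atoms.\<close>
      define r where "r = min (1/4) ((m\<^sup>2 / (2 * (K + 1))) powr (1 / t'))"
      have r: "0 < r" "r \<le> 1/4" using m Kpos by (auto simp: r_def)
      have "r powr t' \<le> ((m\<^sup>2 / (2 * (K + 1))) powr (1 / t')) powr t'"
        using r t by (intro powr_mono2) (auto simp: r_def)
      also have "\<dots> = m\<^sup>2 / (2 * (K + 1))" using t m Kpos by (simp add: powr_powr)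
      finally have "K * r powr t' \<le> K * (m\<^sup>2 / (2 * (K + 1)))" using Kpos by (intro mult_left_mono)
      also have "\<dots> = m\<^sup>2 * (K / (2 * (K + 1)))" by simp
      also have "\<dots> < m\<^sup>2 * 1"
        using Kpos m by (intro mult_strict_left_mono) (auto simp: field_simps)
      finally have *: "K * r powr t' < m\<^sup>2" by simp
      have "V \<times> V \<subseteq> {z. \<bar>fst z - snd z\<bar> \<le> r}" using V(2) True r by force
      then have "measure (M \<Otimes>\<^sub>M M) (V \<times> V) \<le> measure (M \<Otimes>\<^sub>M M) {z. \<bar>fst z - snd z\<bar> \<le> r}"
        by (intro PF.finite_measure_mono A)
      moreover have "measure (M \<Otimes>\<^sub>M M) (V \<times> V) = m\<^sup>2" using eVV by (simp add: measure_def)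
      ultimately show False using K[OF r] * by linarith
    qed
    then show ?thesis by (simp add: emeasure_eq_measure m_def)
  next
    case False
    then obtain j where j: "d \<le> (1/2) ^ (j + 2)" "(1/2) ^ (j + 2) \<le> 2 * d"
      using dyadic_scale[of d] d by auto
    define a where "a = ((1/2) ^ (j + 2)) powr t"
    have a: "a > 0" by (simp add: a_def)
    have a': "(2 ^ (j + 2)) powr t = 1 / a"
    proof -
      have eq: "(1/2::real) ^ (j + 2) = 1 / 2 ^ (j + 2)" by (simp only: power_one_over)
      have "a = 1 powr t / (2 ^ (j + 2)) powr t" unfolding a_def eq by (rule powr_divide)
      then show ?thesis by simp
    qed
    have a_le: "a \<le> 2 powr t * d powr t"
    proof -
      have "a \<le> (2 * d) powr t" unfolding a_def using j t by (intro powr_mono2) auto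
      then show ?thesis using d by (simp add: powr_mult)
    qed
    define W where "W = (\<integral>\<^sup>+z. energy_kernel t z * indicator (V \<times> V) z \<partial>(M \<Otimes>\<^sub>M M))"
    have "ennreal (1 / a * m\<^sup>2) = ennreal (1 / a) * emeasure (M \<Otimes>\<^sub>M M) (V \<times> V)"
      unfolding eVV by (rule ennreal_mult) (use a in simp_all)
    also have "\<dots> = (\<integral>\<^sup>+z. ennreal (1 / a) * indicator (V \<times> V) z \<partial>(M \<Otimes>\<^sub>M M))"
      using VV by (simp add: nn_integral_cmult)
    also have "\<dots> \<le> W"
      unfolding W_def
    proof (rule nn_integral_mono)
      fix z
      show "ennreal (1 / a) * indicator (V \<times> V) z \<le> energy_kernel t z * indicator (V \<times> V) z"
      proof (cases "z \<in> V \<times> V")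
        case True
        then have "\<bar>fst z - snd z\<bar> \<le> (1/2) ^ (j + 2)" using V(2)[of "fst z" "snd z"] j(1) by auto
        then have "ennreal (1 / a) = ennreal ((2 ^ (j + 2)) powr t) * indicator {z. \<bar>fst z - snd z\<bar> \<le> (1/2) ^ (j + 2)} z"
          by (simp add: a'[symmetric])
        also have "\<dots> \<le> energy_kernel t z"
        proof -
          define h where "h j = ennreal ((2 ^ (j + 2)) powr t) * indicator {z. \<bar>fst z - snd z\<bar> \<le> (1/2) ^ (j + 2)} z" for j
          have "h j \<le> suminf h" using sum_le_suminf[OF summableI, of "{j}" h] by simp
          moreover have "suminf h = energy_kernel t z" unfolding energy_kernel_def h_def ..
          ultimately show ?thesis by (simp only: h_def)
        qed
        finally show ?thesis by (intro mult_right_mono) auto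
      qed simp
    qed
    finally have W: "ennreal (1 / a * m\<^sup>2) \<le> W" .
    have "0 \<le> (m - L * a)\<^sup>2 / (2 * L * a)" using a L by simp
    also have "\<dots> = L / 2 * a + 1 / (2 * L) * (1 / a * m\<^sup>2) - m"
      using a L by (simp add: field_simps power2_eq_square)
    finally have "m \<le> L / 2 * a + 1 / (2 * L) * (1 / a * m\<^sup>2)" by simp
    also have "\<dots> \<le> L / 2 * (2 powr t * d powr t) + 1 / (2 * L) * (1 / a * m\<^sup>2)"
      using mult_left_mono[OF a_le, of "L / 2"] L by simp
    also have "\<dots> = (L / 2 * 2 powr t) * d powr t + 1 / (2 * L) * (1 / a * m\<^sup>2)" by simp
    finally have "ennreal m \<le> ennreal ((L / 2 * 2 powr t) * d powr t + 1 / (2 * L) * (1 / a * m\<^sup>2))"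
      by (rule ennreal_leI)
    also have "\<dots> = ennreal ((L / 2 * 2 powr t) * d powr t) + ennreal (1 / (2 * L) * (1 / a * m\<^sup>2))"
      by (rule ennreal_plus) (use L a in simp_all)
    also have "\<dots> = ennreal (L / 2 * 2 powr t) * ennreal (d powr t) + ennreal (1 / (2 * L)) * ennreal (1 / a * m\<^sup>2)"
      by (intro arg_cong2[where f = "(+)"] ennreal_mult) (use L a in simp_all)
    also have "\<dots> \<le> ennreal (L / 2 * 2 powr t) * ennreal (d powr t) + ennreal (1 / (2 * L)) * W"
      using W by (intro add_left_mono mult_left_mono) auto
    finally show ?thesis by (simp add: emeasure_eq_measure m_def W_def)
  qed
qed

text \<open>Closures are Borel and keep the diameter; disjointing them makes the squares
  \<open>V k \<times> V k\<close> disjoint, so that their energies add up to at most the total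
  energy.\<close>

lemma emeasure_le_premeasure_plus_energy:
  fixes U :: "nat \<Rightarrow> real set"
  assumes M: "finite_measure M" "sets M = sets borel" and t: "0 < t" "t < t'"
    and K: "\<And>r. 0 < r \<Longrightarrow> r \<le> 1/4 \<Longrightarrow> measure (M \<Otimes>\<^sub>M M) {z. \<bar>fst z - snd z\<bar> \<le> r} \<le> K * r powr t'"
    and S: "S \<in> sets borel" "S \<subseteq> (\<Union>k. U k)" and U: "\<And>k. bounded (U k) \<and> diameter (U k) \<le> 1/4" and L: "L > 0"
  shows "emeasure M S \<le> ennreal (L / 2 * 2 powr t) * (\<Sum>k. diameter_powr (U k) t)
      + ennreal (1 / (2 * L)) * (\<integral>\<^sup>+z. energy_kernel t z \<partial>(M \<Otimes>\<^sub>M M))"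
proof -
  note [measurable_cong] = M(2)
  define V where "V = disjointed (\<lambda>k. closure (U k))"
  have V: "V k \<in> sets borel" for k
  proof -
    have "range (\<lambda>k. closure (U k)) \<subseteq> sets borel" by auto
    from sets.range_disjointed_sets[OF this] show ?thesis unfolding V_def by (rule range_subsetD)
  qed
  have VM: "V k \<in> sets M" for k using V M(2) by simp
  have Vsub: "V k \<subseteq> closure (U k)" for k unfolding V_def by (rule disjointed_subset)
  have Vdisj: "disjoint_family V" unfolding V_def by (rule disjoint_family_disjointed)
  have "S \<subseteq> (\<Union>k. closure (U k))"
    using S(2) by (rule order.trans) (intro UN_mono closure_subset order_refl)
  then have SV: "S \<subseteq> (\<Union>k. V k)" unfolding V_def UN_disjointed_eq .
  have one: "emeasure M (V k) \<le> ennreal (L / 2 * 2 powr t) * diameter_powr (U k) t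
      + ennreal (1 / (2 * L)) * (\<integral>\<^sup>+z. energy_kernel t z * indicator (V k \<times> V k) z \<partial>(M \<Otimes>\<^sub>M M))" for k
  proof (cases "U k = {}")
    case True
    then have "V k = {}" using Vsub[of k] by simp
    then show ?thesis by simp
  next
    case False
    have diam: "\<bar>x - y\<bar> \<le> diameter (U k)" if "x \<in> V k" "y \<in> V k" for x y
    proof -
      have "dist x y \<le> diameter (closure (U k))"
        using that Vsub[of k] U[of k] by (intro diameter_bounded_bound) (auto simp: bounded_closure)
      then show ?thesis using U[of k] by (simp add: diameter_closure dist_real_def)
    qed
    have "emeasure M (V k) \<le> ennreal (L / 2 * 2 powr t) * ennreal (diameter (U k) powr t)
      + ennreal (1 / (2 * L)) * (\<integral>\<^sup>+z. energy_kernel t z * indicator (V k \<times> V k) z \<partial>(M \<Otimes>\<^sub>M M))"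
      by (rule measure_le_diameter_plus_energy[OF M t K V diam _ _ L])
         (use U[of k] diameter_ge_0[of "U k"] in auto)
    then show ?thesis using False t by (simp add: diameter_powr_def)
  qed
  have "emeasure M S \<le> emeasure M (\<Union>k. V k)"
    using SV VM by (intro emeasure_mono) auto
  also have "\<dots> = (\<Sum>k. emeasure M (V k))"
    by (rule suminf_emeasure[symmetric]) (use VM Vdisj in auto)
  also have "\<dots> \<le> (\<Sum>k. ennreal (L / 2 * 2 powr t) * diameter_powr (U k) t
      + ennreal (1 / (2 * L)) * (\<integral>\<^sup>+z. energy_kernel t z * indicator (V k \<times> V k) z \<partial>(M \<Otimes>\<^sub>M M)))"
    by (intro suminf_le one summableI)
  also have "\<dots> = ennreal (L / 2 * 2 powr t) * (\<Sum>k. diameter_powr (U k) t)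
      + ennreal (1 / (2 * L)) * (\<Sum>k. \<integral>\<^sup>+z. energy_kernel t z * indicator (V k \<times> V k) z \<partial>(M \<Otimes>\<^sub>M M))"
    by (simp add: suminf_add[symmetric] ennreal_suminf_cmult summableI)
  also have "(\<Sum>k. \<integral>\<^sup>+z. energy_kernel t z * indicator (V k \<times> V k) z \<partial>(M \<Otimes>\<^sub>M M))
      = (\<integral>\<^sup>+z. (\<Sum>k. energy_kernel t z * indicator (V k \<times> V k) z) \<partial>(M \<Otimes>\<^sub>M M))"
    using VM energy_finite(2)[OF M t K]
    by (intro nn_integral_suminf[symmetric] borel_measurable_times_ennreal borel_measurable_indicator) auto
  also have "\<dots> \<le> (\<integral>\<^sup>+z. energy_kernel t z \<partial>(M \<Otimes>\<^sub>M M))"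
  proof (intro nn_integral_mono)
    fix z
    have "disjoint_family (\<lambda>k. V k \<times> V k)"
      using Vdisj unfolding disjoint_family_on_def by blast
    then have "(\<Sum>k. energy_kernel t z * indicator (V k \<times> V k) z) = energy_kernel t z * indicator (\<Union>k. V k \<times> V k) z"
      by (simp add: ennreal_suminf_cmult suminf_indicator)
    also have "\<dots> \<le> energy_kernel t z * 1" by (intro mult_left_mono) (auto simp: indicator_def)
    finally show "(\<Sum>k. energy_kernel t z * indicator (V k \<times> V k) z) \<le> energy_kernel t z" by simp
  qed
  finally show ?thesis by (simp add: add_left_mono mult_left_mono)
qed

text \<open>For suitable \<open>L\<close> the energy term is at most half of the mass
  \<open>m\<close>, and a cover with sum below \<open>m / (4 * c)\<close> would bound
  \<open>m\<close> by \<open>m/4 + m/2\<close>.\<close>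

lemma hausdorff_premeasure_pos:
  assumes M: "finite_measure M" "sets M = sets borel" and t: "0 < t" "t < b" "b \<le> 1"
    and decay: "\<And>l. l > 0 \<Longrightarrow> (norm (fourier_measure M (real l)))\<^sup>2 \<le> C * real l powr (- b)"
    and S: "S \<in> sets borel" "emeasure M S \<noteq> 0"
  shows "hausdorff_premeasure t (1/4) S \<noteq> 0"
proof
  assume zero: "hausdorff_premeasure t (1/4) S = 0"
  interpret finite_measure M by fact
  \<comment> \<open>Strictly between: the correlation bound needs \<open>t' < b\<close>, finiteness
    of the energy needs \<open>t < t'\<close>.\<close>
  define t' where "t' = (t + b) / 2"
  have t': "t < t'" "t' < b" "0 < t'" "t' \<le> 1" using t by (auto simp: t'_def)
  obtain K where K: "K > 0"
    "\<And>r. 0 < r \<Longrightarrow> r \<le> 1/4 \<Longrightarrow> measure (M \<Otimes>\<^sub>M M) {z. \<bar>fst z - snd z\<bar> \<le> r} \<le> K * r powr t'"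
    using correlation_bound[OF M t'(3,2,4) decay] by blast
  define I where "I = (\<integral>\<^sup>+z. energy_kernel t z \<partial>(M \<Otimes>\<^sub>M M))"
  have "I < \<infinity>" unfolding I_def by (rule energy_finite(1)[OF M t(1) t'(1) K(2)])
  then obtain i where i: "I = ennreal i" "i \<ge> 0" by (cases I) auto
  define m where "m = measure M S"
  have m: "m > 0" using S(2) by (simp add: m_def emeasure_eq_measure zero_less_measure_iff)
  \<comment> \<open>This choice gives \<open>i / (2 * L) \<le> m / 2\<close>; the added 1 keeps
    \<open>L\<close> positive when \<open>i = 0\<close>.\<close>
  define L where "L = (i + 1) / m"
  have L: "L > 0" using i m by (simp add: L_def)
  define c where "c = L / 2 * 2 powr t"
  have c: "c > 0" using L by (simp add: c_def)
  have "hausdorff_premeasure t (1/4) S < ennreal (m / (4 * c))" using zero m c by simp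
  then obtain U where U: "S \<subseteq> (\<Union>k. U k)" "\<And>k. bounded (U k) \<and> diameter (U k) \<le> 1/4"
    "(\<Sum>k. diameter_powr (U k) t) < ennreal (m / (4 * c))"
    unfolding hausdorff_premeasure_def INF_less_iff by auto
  have "emeasure M S \<le> ennreal c * (\<Sum>k. diameter_powr (U k) t) + ennreal (1 / (2 * L)) * I"
    unfolding c_def I_def by (rule emeasure_le_premeasure_plus_energy[OF M t(1) t'(1) K(2) S(1) U(1,2) L])
  also have "\<dots> \<le> ennreal c * ennreal (m / (4 * c)) + ennreal (1 / (2 * L)) * ennreal i"
    unfolding i(1) using U(3) by (intro add_mono mult_left_mono) auto
  also have "\<dots> = ennreal (c * (m / (4 * c)) + 1 / (2 * L) * i)"
    using c m L i by (subst ennreal_plus, simp, simp, subst (1 2) ennreal_mult) simp_all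
  also have "\<dots> < ennreal m"
  proof (rule ennreal_lessI[OF m])
    have "c * (m / (4 * c)) = m / 4" using c by simp
    moreover have "1 / (2 * L) * i \<le> m / 2"
      using i m by (simp add: L_def field_simps)
    ultimately show "c * (m / (4 * c)) + 1 / (2 * L) * i < m" using m by linarith
  qed
  finally show False by (simp add: emeasure_eq_measure m_def)
qed

lemma emeasure_Compl_measure_support:
  fixes M :: "'a::second_countable_topology measure"
  assumes M: "sets M = sets borel"
  shows "closed (measure_support M)" "emeasure M (- measure_support M) = 0"
proof -
  define F where "F = {U. open U \<and> emeasure M U = 0}"
  have eq: "- measure_support M = \<Union>F"
    by (auto simp: measure_support_def F_def zero_less_iff_neq_zero)
  show "closed (measure_support M)"
    unfolding closed_def eq by (intro open_Union) (auto simp: F_def)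
  \<comment> \<open>The complement is a possibly uncountable union of null open sets; Lindelof
    leaves countably many.\<close>
  obtain F' where F': "F' \<subseteq> F" "countable F'" "\<Union>F' = \<Union>F"
    using Lindelof[of F] by (auto simp: F_def)
  have "(\<Union>U\<in>F'. U) \<in> null_sets M"
    using F'(1) M by (intro null_sets_UN' F'(2)) (auto simp: F_def null_sets_def)
  then show "emeasure M (- measure_support M) = 0" using eq F'(3) by (simp add: null_sets_def)
qed

lemma hausdorff_dim_measure_support:
  assumes M: "finite_measure M" "sets M = sets borel" "emeasure M (space M) \<noteq> 0" and s: "0 < s" "s \<le> 1"
    and decay: "\<And>b. 0 < b \<Longrightarrow> b < s \<Longrightarrow> \<exists>C. \<forall>l::nat. l > 0 \<longrightarrow> (norm (fourier_measure M (real l)))\<^sup>2 \<le> C * real l powr (- b)"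
    and q: "\<And>i. 1 \<le> i \<Longrightarrow> q i > 1" "filterlim q at_top sequentially"
    and supp: "measure_support M \<subseteq> well_approx_set s q"
  shows "hausdorff_dim (measure_support M) = ennreal s"
proof -
  let ?S = "measure_support M"
  have closed: "closed ?S" and null: "emeasure M (- ?S) = 0"
    using emeasure_Compl_measure_support[OF M(2)] by auto
  have spM: "space M = UNIV" using sets_eq_imp_space_eq[OF M(2)] by simp
  have SM: "?S \<in> sets M" using closed M(2) by auto
  have CM: "- ?S \<in> sets M" using open_Compl[OF closed] M(2) by auto
  have pos: "emeasure M ?S \<noteq> 0"
  proof
    assume "emeasure M ?S = 0"
    then have "?S \<union> - ?S \<in> null_sets M"
      using null SM CM by (intro null_sets.Un) (auto simp: null_sets_def)
    then show False using M(3) by (simp add: spM null_sets_def)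
  qed
  have lower: "s \<le> t" if t: "0 \<le> t" "hausdorff_measure t ?S = 0" for t
  proof (rule ccontr)
    assume "\<not> s \<le> t"
    \<comment> \<open>Raising the exponent to at least \<open>s / 2\<close> makes it positive, as
      the energy argument requires, and preserves the vanishing of the premeasure.\<close>
    define u where "u = max t (s / 2)"
    have u: "0 < u" "u < s" "t \<le> u" using s \<open>\<not> s \<le> t\<close> by (auto simp: u_def)
    have "hausdorff_premeasure t (1/4) ?S \<le> hausdorff_measure t ?S"
      unfolding hausdorff_measure_def by (rule SUP_upper) auto
    then have "hausdorff_premeasure t (1/4) ?S = 0" using t(2) by simp
    then have "hausdorff_premeasure u (1/4) ?S = 0"
      by (rule hausdorff_premeasure_zero_mono) (use t u in auto)
    moreover define b where "b = (u + s) / 2"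
    have b: "0 < b" "b < s" "u < b" "b \<le> 1" using u s by (auto simp: b_def)
    obtain C where "\<forall>l::nat. l > 0 \<longrightarrow> (norm (fourier_measure M (real l)))\<^sup>2 \<le> C * real l powr (- b)"
      using decay[OF b(1,2)] by blast
    then have "hausdorff_premeasure u (1/4) ?S \<noteq> 0"
      using closed pos by (intro hausdorff_premeasure_pos[OF M(1,2) u(1) b(3,4)]) auto
    ultimately show False by simp
  qed
  have upper: "hausdorff_measure t ?S = 0" if "s < t" for t
    by (rule hausdorff_measure_well_approx_zero[OF s(1) that q supp])
  show ?thesis
    unfolding hausdorff_dim_def
  proof (rule antisym)
    show "ennreal s \<le> Inf (ennreal ` {t. 0 \<le> t \<and> hausdorff_measure t ?S = 0})"
      using lower by (intro Inf_greatest) (auto intro: ennreal_leI)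
    have Inf_le: "Inf (ennreal ` {t. 0 \<le> t \<and> hausdorff_measure t ?S = 0}) \<le> ennreal t" if "s < t" for t
      using upper[OF that] that s by (intro Inf_lower) auto
    have "Inf (ennreal ` {t. 0 \<le> t \<and> hausdorff_measure t ?S = 0}) \<le> ennreal s + ennreal e" if "e > 0" for e
      using Inf_le[of "s + e"] that s by (simp add: ennreal_plus)
    then show "Inf (ennreal ` {t. 0 \<le> t \<and> hausdorff_measure t ?S = 0}) \<le> ennreal s"
      by (rule ennreal_le_epsilon)
  qed
qed

theorem theorem6p1:
  fixes s :: real
  assumes "0 < s" and "s \<le> 1"
  shows "\<exists>(q :: nat \<Rightarrow> real) (\<mu> :: real measure).
    (\<forall>i\<ge>1. q i > 1) \<and> rapidly_increasing q \<and>
    finite_borel_measure \<mu> \<and> emeasure \<mu> (space \<mu>) \<noteq> 0 \<and>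
    measure_support \<mu> \<subseteq> well_approx_set s q \<and>
    (\<forall>k::int. fourier_measure \<mu> (of_int k) \<in> \<real> \<and> Re (fourier_measure \<mu> (of_int k)) > 0) \<and>
    hausdorff_dim (measure_support \<mu>) = ennreal s \<and>
    (\<forall>\<epsilon>>0. \<exists>C. \<forall>\<xi>. \<bar>\<xi>\<bar> \<ge> 1 \<longrightarrow>
        norm (fourier_measure \<mu> \<xi>) \<le> C * \<bar>\<xi>\<bar> powr (- s / 2 + \<epsilon>)) \<and>
    \<not> admits_fourier_frame \<mu>"
proof -
  obtain \<psi> D n where stages: "bump_stages s \<psi> D n"
    using stages_exist[OF assms] by blast
  interpret bump_stages s \<psi> D n by (rule stages)
  obtain \<nu> where \<nu>: "real_distribution \<nu>" and \<nu>E: "AE x in \<nu>. x \<in> E"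
    and \<nu>_fourier: "\<And>\<xi>. fourier_measure \<nu> \<xi> = of_real (limit_transform \<xi> / limit_transform 0)"
    using limit_measure_exists by blast
  obtain \<rho> where \<rho>: "set_pmf \<rho> = shifts" "map_pmf uminus \<rho> = \<rho>" "pmf \<rho> 0 > 1/2"
    using shift_distribution_exists by blast
  interpret \<nu>: real_distribution \<nu> by fact
  interpret \<rho>: prob_space "borel_pmf \<rho>" by (rule prob_space_borel_pmf)
  have \<nu>_sets: "sets \<nu> = sets borel" by simp
  \<comment> \<open>Stages count from 0, the sequence of the theorem from 1.\<close>
  define Q where "Q i = q (i - 1)" for i :: nat
  define \<mu> where "\<mu> = (borel_pmf \<rho> \<star> \<nu>)"
  have \<mu>_fin: "finite_measure \<mu>" and \<mu>_sets: "sets \<mu> = sets borel"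
    unfolding \<mu>_def
    by (rule convolution_finite[OF \<rho>.finite_measure_axioms \<nu>.finite_measure_axioms \<nu>_sets sets_borel_pmf]) simp
  have \<mu>_emeasure: "emeasure \<mu> A = (\<integral>\<^sup>+x. \<integral>\<^sup>+y. indicator A (x + y) \<partial>\<nu> \<partial>borel_pmf \<rho>)" if "A \<in> sets borel" for A
    unfolding \<mu>_def
    by (rule convolution_emeasure'[OF that \<rho>.finite_measure_axioms \<nu>.finite_measure_axioms \<nu>_sets sets_borel_pmf])
  have \<mu>_space: "space \<mu> = UNIV" using sets_eq_imp_space_eq[OF \<mu>_sets] by simp
  have mass: "emeasure \<mu> (space \<mu>) = 1"
    unfolding \<mu>_space by (subst \<mu>_emeasure) (auto simp: \<nu>.emeasure_space_1[simplified] \<rho>.emeasure_space_1)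

  have limit_pos: "0 < limit_transform 0" "1 \<le> limit_transform 0"
    using limit_transform_ge[of 0 0] transform_0 by auto
  have limit_nonneg: "0 \<le> limit_transform \<xi>" for \<xi>
    using limit_transform_ge[of 0 \<xi>] bump_stage_facts(5)[of 0 \<xi>] by linarith
  have fourier: "\<exists>a. 0 < a \<and> a \<le> 1 \<and> fourier_measure \<mu> \<xi> = of_real (a * (limit_transform \<xi> / limit_transform 0))" for \<xi>
  proof -
    obtain a where "0 < a" "a \<le> 1" "fourier_measure (borel_pmf \<rho>) \<xi> = of_real a"
      using fourier_symmetric_pmf_pos[OF \<rho>(2,3)] by blast
    moreover have "fourier_measure \<mu> \<xi> = fourier_measure (borel_pmf \<rho>) \<xi> * fourier_measure \<nu> \<xi>"
      unfolding \<mu>_def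
      by (rule fourier_measure_convolution[OF \<rho>.finite_measure_axioms sets_borel_pmf \<nu>.finite_measure_axioms \<nu>_sets])
    ultimately show ?thesis unfolding \<nu>_fourier by (auto simp only: of_real_mult[symmetric])
  qed
  have norm_le: "norm (fourier_measure \<mu> \<xi>) \<le> limit_transform \<xi>" for \<xi>
  proof -
    obtain a where a: "0 < a" "a \<le> 1" "fourier_measure \<mu> \<xi> = of_real (a * (limit_transform \<xi> / limit_transform 0))"
      using fourier by blast
    have "norm (fourier_measure \<mu> \<xi>) = a * (limit_transform \<xi> / limit_transform 0)"
      unfolding a(3) norm_of_real using a limit_nonneg limit_pos by simp
    also have "\<dots> \<le> 1 * (limit_transform \<xi> / 1)"
      using a limit_nonneg limit_pos by (intro mult_mono divide_left_mono) auto
    finally show ?thesis by simp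
  qed
  have decay: "\<exists>C. \<forall>\<xi>. \<bar>\<xi>\<bar> \<ge> 1 \<longrightarrow> norm (fourier_measure \<mu> \<xi>) \<le> C * \<bar>\<xi>\<bar> powr (- s / 2 + \<epsilon>)" if \<epsilon>: "\<epsilon> > 0" for \<epsilon>
  proof -
    \<comment> \<open>The cap \<open>s / 2\<close> keeps the exponent nonpositive, so that
      \<open>1 + |\<xi>|\<close> may be replaced by the smaller \<open>|\<xi>|\<close>.\<close>
    define \<epsilon>' where "\<epsilon>' = min \<epsilon> (s / 2)"
    have \<epsilon>': "0 < \<epsilon>'" "\<epsilon>' \<le> \<epsilon>" "- s / 2 + \<epsilon>' \<le> 0" using \<epsilon> assms by (auto simp: \<epsilon>'_def)
    obtain C where C: "\<And>\<xi>. limit_transform \<xi> \<le> C * (1 + \<bar>\<xi>\<bar>) powr (- s / 2 + \<epsilon>')"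
      using limit_transform_bound[OF \<epsilon>'(1)] by blast
    have C0: "C \<ge> 0" using C[of 0] limit_nonneg[of 0] by simp
    have "norm (fourier_measure \<mu> \<xi>) \<le> C * \<bar>\<xi>\<bar> powr (- s / 2 + \<epsilon>)" if \<xi>: "\<bar>\<xi>\<bar> \<ge> 1" for \<xi>
    proof -
      have "norm (fourier_measure \<mu> \<xi>) \<le> C * (1 + \<bar>\<xi>\<bar>) powr (- s / 2 + \<epsilon>')"
        using norm_le C by (rule order.trans)
      also have "\<dots> \<le> C * \<bar>\<xi>\<bar> powr (- s / 2 + \<epsilon>')"
        using C0 \<epsilon>' \<xi> by (intro mult_left_mono powr_mono2') auto
      also have "\<dots> \<le> C * \<bar>\<xi>\<bar> powr (- s / 2 + \<epsilon>)"
        using C0 \<epsilon>' \<xi> by (intro mult_left_mono powr_mono) auto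
      finally show ?thesis .
    qed
    then show ?thesis by blast
  qed

  have support: "measure_support \<mu> \<subseteq> well_approx_set s Q"
  proof -
    \<comment> \<open>A sum of two compact sets is closed, so its complement, being open and null
      for \<open>\<mu>\<close>, misses the support.\<close>
    define K where "K = {y + x | y x. y \<in> E \<and> x \<in> shifts}"
    have "compact K" unfolding K_def by (rule compact_sums[OF compact_E compact_shifts])
    then have "closed K" by (rule compact_imp_closed)
    have "AE x in borel_pmf \<rho>. x \<in> shifts"
      by (rule AE_borel_pmf) (use \<rho>(1) compact_imp_closed[OF compact_shifts] in \<open>auto simp: pred_def\<close>)
    then have "AE x in borel_pmf \<rho>. (\<integral>\<^sup>+y. indicator (- K) (x + y) \<partial>\<nu>) = 0"
    proof eventually_elim
      case (elim x)
      have "AE y in \<nu>. indicator (- K) (x + y) = (0 :: ennreal)"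
        using \<nu>E
      proof eventually_elim
        case (elim y)
        then have "x + y \<in> K" using \<open>x \<in> shifts\<close> unfolding K_def by (auto intro: add.commute)
        then show ?case by simp
      qed
      then show ?case by (subst nn_integral_cong_AE[where v = "\<lambda>_. 0"]) auto
    qed
    then have "emeasure \<mu> (- K) = 0"
      using \<open>closed K\<close> by (subst \<mu>_emeasure) (auto intro: nn_integral_cong_AE[where v = "\<lambda>_. 0", THEN trans])
    then have "measure_support \<mu> \<subseteq> K"
      using \<open>closed K\<close> by (force simp: measure_support_def)
    also have "K \<subseteq> well_approx_set s Q"
      unfolding K_def Q_def using translates_well_approximable by blast
    finally show ?thesis .
  qed
  have Q_gt_1: "Q i > 1" for i by (simp add: Q_def q_gt_1)
  have "rapidly_increasing Q"
    unfolding rapidly_increasing_def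
  proof (intro allI impI)
    fix i :: nat assume "i \<ge> 1"
    then show "Q i ^ (10 * i) \<le> Q (Suc i)" using rapid[of "i - 1"] by (simp add: Q_def q_def)
  qed
  moreover have "hausdorff_dim (measure_support \<mu>) = ennreal s"
  proof (rule hausdorff_dim_measure_support[OF \<mu>_fin \<mu>_sets _ assms _ Q_gt_1 _ support])
    show "emeasure \<mu> (space \<mu>) \<noteq> 0" using mass by simp
    \<comment> \<open>The scales diverge through \<open>i \<le> D i \<le> q i\<close>.\<close>
    have "real i \<le> q i" for i
    proof -
      have D: "real i \<le> real (D i)" using seq_suble[OF strict_mono_D, of i] by simp
      have n: "1 \<le> real (n i)" "1 \<le> real (D i)" using n_pos[of i] D_pos[of i] by auto
      have "real (D i) * 1 \<le> real (D i) * (2 * (real (D i) * real (n i)))"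
        using mult_mono[OF n(2) n(1)] by (intro mult_left_mono) auto
      also have "\<dots> = 2 * real (D i) ^ 2 * real (n i)" by (simp add: power2_eq_square)
      also have "\<dots> \<le> (2 * real (D i) ^ 2 * real (n i)) ^ 2"
        using scale_ge(2)[OF s D_pos n_pos] by (intro self_le_power) (simp_all add: order.trans[of 1 2])
      also have "\<dots> \<le> q i" by (rule q_ge)
      finally show ?thesis using D by linarith
    qed
    then have "filterlim (\<lambda>i. Q (Suc i)) at_top sequentially"
      unfolding Q_def by (intro filterlim_at_top_mono[OF filterlim_real_sequentially]) auto
    then show "filterlim Q at_top sequentially" by (simp only: filterlim_sequentially_Suc)
    fix b assume b: "0 < b" "b < s"
    \<comment> \<open>The loss \<open>(s - b) / 2\<close> leaves the exponent
      \<open>- b / 2\<close>, which becomes \<open>- b\<close> after squaring.\<close>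
    obtain C where C: "\<And>\<xi>. \<bar>\<xi>\<bar> \<ge> 1 \<Longrightarrow> norm (fourier_measure \<mu> \<xi>) \<le> C * \<bar>\<xi>\<bar> powr (- s / 2 + (s - b) / 2)"
      using decay[of "(s - b) / 2"] b by auto
    have "(norm (fourier_measure \<mu> (real l)))\<^sup>2 \<le> C\<^sup>2 * real l powr (- b)" if "l > 0" for l :: nat
    proof -
      have e: "- s / 2 + (s - b) / 2 = - b / 2" by (simp add: field_simps)
      have "norm (fourier_measure \<mu> (real l)) \<le> C * real l powr (- b / 2)"
        using C[of "real l"] that unfolding e by simp
      then have "(norm (fourier_measure \<mu> (real l)))\<^sup>2 \<le> (C * real l powr (- b / 2))\<^sup>2"
        by (rule power_mono) simp
      also have "\<dots> = C\<^sup>2 * (real l powr (- b / 2) * real l powr (- b / 2))"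
        by (simp add: power2_eq_square)
      also have "real l powr (- b / 2) * real l powr (- b / 2) = real l powr (- b)"
        by (simp add: powr_add[symmetric])
      finally show ?thesis .
    qed
    then show "\<exists>C. \<forall>l::nat. l > 0 \<longrightarrow> (norm (fourier_measure \<mu> (real l)))\<^sup>2 \<le> C * real l powr (- b)"
      by blast
  qed
  moreover have "\<not> admits_fourier_frame \<mu>"
    unfolding \<mu>_def
  proof (rule no_fourier_frame_convolution[OF \<nu>.prob_space_axioms \<nu>_sets _ \<nu>E])
    show "E \<in> sets borel" using compact_imp_closed[OF compact_E] by auto
    show "infinite (set_pmf \<rho>)" using infinite_shifts by (simp add: \<rho>(1))
  qed (use translates_disjoint \<rho>(1) in blast)
  moreover have "fourier_measure \<mu> (of_int k) \<in> \<real> \<and> Re (fourier_measure \<mu> (of_int k)) > 0" for k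
  proof -
    have "0 < limit_transform (of_int k)" using limit_transform_ge[of 0 "of_int k"] transform_0(2)[of k] by linarith
    then show ?thesis using fourier[of "of_int k"] limit_pos by auto
  qed
  moreover have "finite_borel_measure \<mu>"
    by (simp add: finite_borel_measure_def finite_borel_measure_axioms_def \<mu>_fin \<mu>_sets)
  ultimately show ?thesis
    using Q_gt_1 mass support decay by (intro exI[of _ Q] exI[of _ \<mu>]) simp
qed

end
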